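(* Let $\Delta$ be a complete unimodular fan in $\mathbb{R}^n$ and let $\varphi_1,\ldots,\varphi_k$ be rational functions on $\mathbb{R}^n$ which are linear on every cone of $\Delta$. Let $f=\varphi_1\cdots\varphi_k\in \mathrm{PP}^k(\Delta)$ be their pointwise product. Then $$f\cdot\mathbb{R}^n=\varphi_1\cdots\varphi_k\cdot\mathbb{R}^n,$$ where the left-hand side is the Katz--Payne intersection of the piecewise polynomial $f$ with $\mathbb{R}^n$ (the fan cycle of $f\cdot\Delta$, with weights $c_{f\cdot\Delta}$) and the right-hand side is the inductive intersection product of the rational functions $\varphi_1,\dots,\varphi_k$ with the tropical cycle $\mathbb{R}^n$.
   Context: **Tropical cycles.** Let $\Lambda$ be a lattice, $V=\Lambda\otimes_{\mathbb Z}\mathbb R$. For a rational polyhedron $\sigma\subset V$ let $V_\sigma$ be the linear span of differences of vectors of $\sigma$ and $\Lambda_\sigma=\Lambda\cap V_\sigma$. If $\tau$ is a codimension 1 face of $\sigma$, $u_{\sigma/\tau}\in\Lambda_\sigma/\Lambda_\tau\subset V/V_\tau$ is the primitive normal vector of $\sigma$ relative to $\tau$ (primitive generator pointing towards $\sigma$). A tropical polyhedral complex (tropical fan, if all polyhedra are cones) of dimension $d$ is a rational polyhedral complex $\mathcal X$ of pure dimension $d$ with integer weights $\omega_{\mathcal X}$ on its maximal polyhedra satisfying, for each $(d-1)$-dimensional $\tau\in\mathcal X$, $\sum_{\sigma>\tau}\omega_{\mathcal X}(\sigma)u_{\sigma/\tau}=0\in V/V_\tau$. A tropical cycle is the class of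 a tropical polyhedral complex modulo refinement (polyhedra of weight $0$ are disregarded); a fan cycle is one represented by a tropical fan. $\mathbb{R}^n$ (with lattice $\mathbb Z^n$) is a fan cycle with weight 1. $\mathcal X^{(k)}$ denotes the set of $k$-dimensional polyhedra of $\mathcal X$. **Intersection with rational functions.** A rational function on a cycle $X$ is a function $\varphi:|X|\to\mathbb R$ such that for some polyhedral structure $\mathcal X$ of $X$, on each $\sigma\in\mathcal X$ it is the sum of an integer linear form $\varphi_\sigma\in\Lambda_\sigma^\vee$ and a real constant. (A function linear on the cones of $\Delta$ is integer linear on each cone.) The cycle $\varphi\cdot X$ is represented by $\mathcal X\setminus\mathcal X^{(\dim X)}$ with weights $$\omega_{\varphi\cdot\mathcal X}(\tau)=\sum_{\sigma>\tau}\omega_{\mathcal X}(\sigma)\varphi_\sigma(v_{\sigma/\tau})-\varphi_\tau\Big(\sum_{\sigma>\tau}\omega_{\mathcal X}(\sigma)v_{\sigma/\tau}\Big)$$ on codimension 1 polyhedra $\tau$, where $v_{\sigma/\tau}\in V$ represents $u_{\sigma/\tau}$. For a subcycle $Y$ of $X$ (i.e. $|Y|\subseteq |X|$), $\varphi\cdot Y:=\varphi_{|Y}\cdot Y$; the product $\varphi_1\cdots\varphi_k\cdot X:=\varphi_1\cdot(\varphi_2\cdots(\varphi_k\cdot X))$ is defined inductively. **Piecewise polynomials.** A piecewise polynomial of degree $k$ on a rational fan $F$ in $V$ is a continuous function $f:|F|\to\mathbb R$ whose restriction to each $\sigma\in F$ is given by a homogeneous polynomial of degree $k$ on $V_\sigma$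 with integer coefficients, i.e. an element of $\mathrm{Sym}^k(\Lambda_\sigma^\vee)$. The group of these is $\mathrm{PP}^k(F)$. **Katz--Payne intersection.** A fan is unimodular if every cone is generated by part of a lattice basis. Let $\Delta$ be a complete unimodular fan in $\mathbb R^n$ and $f\in\mathrm{PP}^k(\Delta)$. For a maximal cone $\sigma\in\Delta^{(n)}$ generated by a basis $v_1,\dots,v_n$ of $\mathbb Z^n$, with dual basis $v_1^*,\dots,v_n^*$, and a face $\tau$ of $\sigma$, put $e_{\sigma,\tau}=\prod_{i:v_i\notin\tau}\frac1{v_i^*}$, and let $f_\sigma$ be the polynomial on $\mathbb R^n$ agreeing with $f$ on $\sigma$. For $\tau\in\Delta^{(n-k)}$ set $c_{f\cdot\Delta}(\tau)=\sum_{\sigma\in\Delta^{(n)},\ \sigma\supseteq\tau}e_{\sigma,\tau}f_\sigma$. It is known (Katz--Payne) that this is an integer, that $f\cdot\Delta:=\big(\bigcup_{i\le n-k}\Delta^{(i)},c_{f\cdot\Delta}\big)$ is a tropical fan, and that the associated fan cycle, denoted $f\cdot\mathbb R^n$, is invariant under refinement of $\Delta$. *)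

theory Defs
  imports "HOL-Analysis.Analysis"
begin

section \<open>Rational polyhedra in \<open>\<real>\<^sup>n\<close> with lattice \<open>\<int>\<^sup>n\<close>\<close>

definition int_lattice :: "(real^'n) set" where
  "int_lattice = {x. \<forall>i. x $ i \<in> \<int>}"

definition rational_polyhedron :: "(real^'n) set \<Rightarrow> bool" where
  "rational_polyhedron \<sigma> \<longleftrightarrow>
     (\<exists>F :: ((real^'n) \<times> real) set. finite F \<and> (\<forall>(a, b)\<in>F. a \<in> int_lattice) \<and>
        \<sigma> = {x. \<forall>(a, b)\<in>F. a \<bullet> x \<le> b})"

text \<open>The linear space \<open>V\<^sub>\<sigma>\<close> and the lattice \<open>\<Lambda>\<^sub>\<sigma>\<close>.\<close>

definition dir_space :: "(real^'n) set \<Rightarrow> (real^'n) set" where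
  "dir_space \<sigma> = span {x - y | x y. x \<in> \<sigma> \<and> y \<in> \<sigma>}"

definition dir_lattice :: "(real^'n) set \<Rightarrow> (real^'n) set" where
  "dir_lattice \<sigma> = int_lattice \<inter> dir_space \<sigma>"

text \<open>The elements of \<open>\<Lambda>\<^sub>\<sigma>\<^sup>\<or>\<close> are represented by linear forms on the whole of \<open>\<real>\<^sup>n\<close> taking
  integer values on \<open>\<Lambda>\<^sub>\<sigma>\<close>; only their restriction to \<open>V\<^sub>\<sigma>\<close> matters.\<close>

definition int_form_on :: "(real^'n) set \<Rightarrow> (real^'n \<Rightarrow> real) \<Rightarrow> bool" where
  "int_form_on \<sigma> l \<longleftrightarrow> linear l \<and> (\<forall>v\<in>dir_lattice \<sigma>. l v \<in> \<int>)"

definition polyhedral_complex :: "(real^'n) set set \<Rightarrow> bool" where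
  "polyhedral_complex X \<longleftrightarrow>
     finite X \<and>
     (\<forall>\<sigma>\<in>X. rational_polyhedron \<sigma> \<and> \<sigma> \<noteq> {}) \<and>
     (\<forall>\<sigma>\<in>X. \<forall>\<tau>. \<tau> face_of \<sigma> \<and> \<tau> \<noteq> {} \<longrightarrow> \<tau> \<in> X) \<and>
     (\<forall>\<sigma>\<in>X. \<forall>\<sigma>'\<in>X. (\<sigma> \<inter> \<sigma>') face_of \<sigma> \<and> (\<sigma> \<inter> \<sigma>') face_of \<sigma>')"

definition rational_fan :: "(real^'n) set set \<Rightarrow> bool" where
  "rational_fan \<Delta> \<longleftrightarrow> polyhedral_complex \<Delta> \<and> (\<forall>\<sigma>\<in>\<Delta>. cone \<sigma>)"

definition cells_of_dim :: "int \<Rightarrow> (real^'n) set set \<Rightarrow> (real^'n) set set" where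
  "cells_of_dim d X = {\<sigma>\<in>X. aff_dim \<sigma> = d}"

text \<open>\<open>v \<in> \<Lambda>\<^sub>\<sigma>\<close> represents the primitive normal vector \<open>u\<^bsub>\<sigma>/\<tau>\<^esub>\<close>: its class generates
  \<open>\<Lambda>\<^sub>\<sigma>/\<Lambda>\<^sub>\<tau>\<close>, and modulo \<open>V\<^sub>\<tau>\<close> the polyhedron \<open>\<sigma>\<close> lies on the side of \<open>\<tau>\<close> of its nonnegative
  multiples.\<close>

definition represents_normal :: "(real^'n) set \<Rightarrow> (real^'n) set \<Rightarrow> real^'n \<Rightarrow> bool" where
  "represents_normal \<sigma> \<tau> v \<longleftrightarrow>
     v \<in> dir_lattice \<sigma> \<and>
     dir_lattice \<sigma> = {of_int a *\<^sub>R v + w | a w. w \<in> dir_lattice \<tau>} \<and>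
     (\<forall>x\<in>\<tau>. \<forall>y\<in>\<sigma>. \<exists>t\<ge>0. y - x - t *\<^sub>R v \<in> dir_space \<tau>)"

definition normal_vec :: "(real^'n) set \<Rightarrow> (real^'n) set \<Rightarrow> real^'n" where
  "normal_vec \<sigma> \<tau> = (SOME v. represents_normal \<sigma> \<tau> v)"


section \<open>Tropical cycles\<close>

text \<open>The dimension is part of the data, as it cannot be read off an empty complex. Weights of
  cells below this dimension are irrelevant.\<close>

datatype 'n weighted_complex =
  WComplex (dimension: int) (cells: "(real^'n) set set") (weight: "(real^'n) set \<Rightarrow> int")

definition max_cells :: "'n::finite weighted_complex \<Rightarrow> (real^'n) set set" where
  "max_cells A = cells_of_dim (dimension A) (cells A)"

definition adjacent_cells :: "'n::finite weighted_complex \<Rightarrow> (real^'n) set \<Rightarrow> (real^'n) set set" where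
  "adjacent_cells A \<tau> = {\<sigma>\<in>max_cells A. \<tau> facet_of \<sigma>}"

definition normal_sum :: "'n::finite weighted_complex \<Rightarrow> (real^'n) set \<Rightarrow> real^'n" where
  "normal_sum A \<tau> = (\<Sum>\<sigma>\<in>adjacent_cells A \<tau>. of_int (weight A \<sigma>) *\<^sub>R normal_vec \<sigma> \<tau>)"

text \<open>In the balancing condition, vanishing in \<open>V/V\<^sub>\<tau>\<close> is membership in \<open>V\<^sub>\<tau>\<close>; it does not depend
  on the chosen representatives \<^const>\<open>normal_vec\<close>.\<close>

definition tropical_complex :: "'n::finite weighted_complex \<Rightarrow> bool" where
  "tropical_complex A \<longleftrightarrow>
     polyhedral_complex (cells A) \<and>
     (\<forall>\<tau>\<in>cells A. \<exists>\<sigma>\<in>max_cells A. \<tau> \<subseteq> \<sigma>) \<and>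
     (\<forall>\<tau>\<in>cells_of_dim (dimension A - 1) (cells A). normal_sum A \<tau> \<in> dir_space \<tau>)"

definition supp_cells :: "'n::finite weighted_complex \<Rightarrow> (real^'n) set set" where
  "supp_cells A = {\<sigma>\<in>max_cells A. weight A \<sigma> \<noteq> 0}"

text \<open>Polyhedra of weight 0 are disregarded. It is enough to look at maximal polyhedra, since all
  others are faces of these.\<close>

definition refines :: "'n::finite weighted_complex \<Rightarrow> 'n weighted_complex \<Rightarrow> bool" where
  "refines B A \<longleftrightarrow>
     tropical_complex A \<and> tropical_complex B \<and> dimension B = dimension A \<and>
     \<Union>(supp_cells B) = \<Union>(supp_cells A) \<and>
     (\<forall>\<rho>\<in>supp_cells B. \<exists>\<sigma>\<in>supp_cells A. \<rho> \<subseteq> \<sigma> \<and> weight B \<rho> = weight A \<sigma>)"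

text \<open>A tropical cycle is an equivalence class of tropical polyhedral complexes under the
  equivalence relation generated by refinement.\<close>

definition cycle_of :: "'n::finite weighted_complex \<Rightarrow> 'n weighted_complex set" where
  "cycle_of A = {B. tropical_complex B \<and> equivclp refines A B}"

text \<open>The cycle \<open>\<real>\<^sup>n\<close> with weight 1.\<close>

definition Rn_cycle :: "'n::finite weighted_complex set" where
  "Rn_cycle = cycle_of (WComplex (int CARD('n)) {UNIV} (\<lambda>_. 1))"


section \<open>Intersection with rational functions\<close>

text \<open>The function is integer affine linear on every polyhedron of the given complex.\<close>

definition int_affine_on_cells :: "(real^'n \<Rightarrow> real) \<Rightarrow> 'n::finite weighted_complex \<Rightarrow> bool" where
  "int_affine_on_cells \<phi> A \<longleftrightarrow>
     (\<forall>\<sigma>\<in>cells A. \<exists>l c. int_form_on \<sigma> l \<and> (\<forall>x\<in>\<sigma>. \<phi> x = l x + c))"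

text \<open>Functions on the support of a cycle are represented by functions on all of \<open>\<real>\<^sup>n\<close>. Values
  outside the support are irrelevant, because a cycle contains complexes all of whose polyhedra
  lie in the support.\<close>

definition rational_function_on :: "'n::finite weighted_complex set \<Rightarrow> (real^'n \<Rightarrow> real) \<Rightarrow> bool" where
  "rational_function_on C \<phi> \<longleftrightarrow> (\<exists>A\<in>C. int_affine_on_cells \<phi> A)"

text \<open>The linear part \<open>\<phi>\<^sub>\<sigma>\<close>; it is determined on \<open>V\<^sub>\<sigma>\<close>.\<close>

definition linear_part :: "(real^'n \<Rightarrow> real) \<Rightarrow> (real^'n) set \<Rightarrow> real^'n \<Rightarrow> real" where
  "linear_part \<phi> \<sigma> = (SOME l. linear l \<and> (\<exists>c. \<forall>x\<in>\<sigma>. \<phi> x = l x + c))"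

text \<open>The expression inside the floor is an integer whenever \<open>A\<close> is tropical and \<open>\<phi>\<close> is integer
  affine linear on its cells; the floor only converts it to type \<^typ>\<open>int\<close>.\<close>

definition divisor_weight ::
    "(real^'n \<Rightarrow> real) \<Rightarrow> 'n::finite weighted_complex \<Rightarrow> (real^'n) set \<Rightarrow> int" where
  "divisor_weight \<phi> A \<tau> =
     \<lfloor>(\<Sum>\<sigma>\<in>adjacent_cells A \<tau>. of_int (weight A \<sigma>) * linear_part \<phi> \<sigma> (normal_vec \<sigma> \<tau>))
       - linear_part \<phi> \<tau> (normal_sum A \<tau>)\<rfloor>"

definition divisor_complex ::
    "(real^'n \<Rightarrow> real) \<Rightarrow> 'n::finite weighted_complex \<Rightarrow> 'n weighted_complex" where
  "divisor_complex \<phi> A =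
     WComplex (dimension A - 1) (cells A - max_cells A) (divisor_weight \<phi> A)"

definition intersect :: "(real^'n \<Rightarrow> real) \<Rightarrow> 'n::finite weighted_complex set \<Rightarrow> 'n weighted_complex set" where
  "intersect \<phi> C = cycle_of (divisor_complex \<phi> (SOME A. A \<in> C \<and> int_affine_on_cells \<phi> A))"

text \<open>\<open>\<phi>\<^sub>1 \<cdot> (\<phi>\<^sub>2 \<cdots> (\<phi>\<^sub>k \<cdot> C))\<close>\<close>

definition intersect_list ::
    "(real^'n \<Rightarrow> real) list \<Rightarrow> 'n::finite weighted_complex set \<Rightarrow> 'n weighted_complex set" where
  "intersect_list \<phi>s C = foldr intersect \<phi>s C"


section \<open>Piecewise polynomials and the Katz--Payne intersection\<close>

text \<open>Integer linear combinations of \<open>k\<close>-fold products of elements of \<open>\<Lambda>\<^sub>\<sigma>\<^sup>\<or>\<close>, that is,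
  \<open>Sym\<^sup>k(\<Lambda>\<^sub>\<sigma>\<^sup>\<or>)\<close> (as functions, of which only the restriction to \<open>V\<^sub>\<sigma>\<close> matters).\<close>

definition int_sym_power :: "nat \<Rightarrow> (real^'n) set \<Rightarrow> (real^'n \<Rightarrow> real) set" where
  "int_sym_power k \<sigma> =
     {p. \<exists>(m::nat) (a :: nat \<Rightarrow> int) (l :: nat \<Rightarrow> nat \<Rightarrow> real^'n \<Rightarrow> real).
           (\<forall>j<m. \<forall>i<k. int_form_on \<sigma> (l j i)) \<and>
           p = (\<lambda>x. \<Sum>j<m. of_int (a j) * (\<Prod>i<k. l j i x))}"

definition piecewise_polynomials :: "nat \<Rightarrow> (real^'n) set set \<Rightarrow> (real^'n \<Rightarrow> real) set" where
  "piecewise_polynomials k F =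
     {f. continuous_on (\<Union>F) f \<and>
         (\<forall>\<sigma>\<in>F. \<exists>p\<in>int_sym_power k \<sigma>. \<forall>x\<in>\<sigma>. f x = p x)}"

definition lattice_basis :: "(real^'n) set \<Rightarrow> bool" where
  "lattice_basis B \<longleftrightarrow>
     finite B \<and> independent B \<and> B \<subseteq> int_lattice \<and>
     (\<forall>x\<in>int_lattice. \<exists>a :: real^'n \<Rightarrow> int. x = (\<Sum>v\<in>B. of_int (a v) *\<^sub>R v))"

definition complete_fan :: "(real^'n) set set \<Rightarrow> bool" where
  "complete_fan \<Delta> \<longleftrightarrow> rational_fan \<Delta> \<and> \<Union>\<Delta> = UNIV"

definition unimodular_fan :: "(real^'n) set set \<Rightarrow> bool" where
  "unimodular_fan \<Delta> \<longleftrightarrow>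
     rational_fan \<Delta> \<and> (\<forall>\<sigma>\<in>\<Delta>. \<exists>B S. lattice_basis B \<and> S \<subseteq> B \<and> \<sigma> = convex_cone hull S)"

definition cone_basis :: "(real^'n) set \<Rightarrow> (real^'n) set" where
  "cone_basis \<sigma> = (THE B. lattice_basis B \<and> \<sigma> = convex_cone hull B)"

text \<open>\<^term>\<open>representation B x v\<close> is the value at \<open>x\<close> of the dual basis vector \<open>v\<^sup>*\<close>.\<close>

definition e_factor :: "(real^'n) set \<Rightarrow> (real^'n) set \<Rightarrow> real^'n \<Rightarrow> real" where
  "e_factor \<sigma> \<tau> x = (\<Prod>v\<in>cone_basis \<sigma> - \<tau>. 1 / representation (cone_basis \<sigma>) x v)"

definition poly_on_cone :: "(real^'n \<Rightarrow> real) \<Rightarrow> (real^'n) set \<Rightarrow> real^'n \<Rightarrow> real" where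
  "poly_on_cone f \<sigma> = (THE p. real_polynomial_function p \<and> (\<forall>x\<in>\<sigma>. p x = f x))"

text \<open>The sum \<open>\<Sum> e\<^bsub>\<sigma>,\<tau>\<^esub> f\<^sub>\<sigma>\<close> is a constant rational function; its value is the number taken at every
  point where none of the denominators vanishes.\<close>

definition kp_weight :: "(real^'n \<Rightarrow> real) \<Rightarrow> (real^'n::finite) set set \<Rightarrow> (real^'n) set \<Rightarrow> int" where
  "kp_weight f \<Delta> \<tau> =
     (let S = {\<sigma>\<in>cells_of_dim (int CARD('n)) \<Delta>. \<tau> \<subseteq> \<sigma>}
      in THE c. \<forall>x. (\<forall>\<sigma>\<in>S. \<forall>v\<in>cone_basis \<sigma> - \<tau>. representation (cone_basis \<sigma>) x v \<noteq> 0) \<longrightarrow>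
                    (\<Sum>\<sigma>\<in>S. e_factor \<sigma> \<tau> x * poly_on_cone f \<sigma> x) = of_int c)"

definition kp_complex :: "nat \<Rightarrow> (real^'n \<Rightarrow> real) \<Rightarrow> (real^'n) set set \<Rightarrow> 'n::finite weighted_complex" where
  "kp_complex k f \<Delta> =
     WComplex (int CARD('n) - int k) {\<sigma>\<in>\<Delta>. aff_dim \<sigma> \<le> int CARD('n) - int k} (kp_weight f \<Delta>)"

definition kp_intersection :: "nat \<Rightarrow> (real^'n \<Rightarrow> real) \<Rightarrow> (real^'n) set set \<Rightarrow> 'n::finite weighted_complex set" where
  "kp_intersection k f \<Delta> = cycle_of (kp_complex k f \<Delta>)"

end

theory Submission
  imports Defs
begin

text \<open>
  The weight of a complex is a function on points, defined off the cells of smaller dimension. Two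
  tropical complexes represent the same cycle iff these functions agree off finitely many affine
  subspaces of smaller dimension: a common refinement exists, and it is balanced because balancing at
  a generic point \<open>x\<close> of a codimension one cell \<open>\<tau>\<close> says \<open>\<Sum> w(x, u) u = 0\<close>, where \<open>u\<close> runs through the
  primitive vectors of \<open>V\<^sub>\<tau>\<^sup>\<bottom>\<close> (images of lattice vectors) and \<open>w(x, u)\<close> is the germ of the weight at
  \<open>x\<close> in direction \<open>u\<close>. Similarly the weight of the divisor of \<open>\<phi>\<close> is \<open>\<Sum> w(x, u) \<phi>'(x; u)\<close>, so it does
  not depend on the representative.

  On a complete unimodular fan put \<open>S\<^sub>f(\<tau>) = \<Sum>\<^sub>\<sigma> e\<^sub>\<sigma>\<^sub>\<tau> f\<^sub>\<sigma>\<close>. If \<open>l\<close> is linear and agrees with \<open>\<phi>\<close> on \<open>\<tau>\<close>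
  then \<open>S\<^sub>\<phi>\<^sub>f(\<tau>) = \<Sum>\<^sub>\<rho> (\<phi>\<^sub>\<rho> - l)(u\<^sub>\<rho>\<^sub>\<tau>) S\<^sub>f(\<rho>) + l S\<^sub>f(\<tau>)\<close>, where \<open>\<rho>\<close> runs through the cones with facet \<open>\<tau>\<close>.
  By induction \<open>S\<^sub>f(\<tau>) = 0\<close> if the codimension of \<open>\<tau>\<close> exceeds the degree of \<open>f\<close>; for such \<open>\<tau>\<close> the case
  \<open>\<phi> = 0\<close> is the balancing condition of the Katz--Payne weights, and for general \<open>\<phi>\<close> the recursion is
  the formula for the weights of the divisor.
\<close>

subsection \<open>Direction spaces and generic points\<close>

text \<open>The obstacle is that \<open>intersect\<close> takes the divisor of a representative
  chosen by \<open>SOME\<close>, whose cells have no relation to the fan. A cell of one complex may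
  therefore run through the interior of a maximal cell of the other; there the directions
  \<open>u\<close> and \<open>- u\<close> contribute opposite terms, so nothing is seen of it.

  Katz--Payne sums are evaluated only at points off their poles. That they are constant comes from
  the recursion: where the sum of the shorter product vanishes, the right-hand side no longer
  mentions the point. The induction starts with the constant 1, whose sum is 1 on maximal cones and
  0 on smaller ones. For the latter, multiplication by a dual coordinate that vanishes on
  \<open>\<tau>\<close> gives a sum over cofaces, and at walls this sum is zero because the fan
  subdivides the whole space, which is trivially balanced. Integrality of the functions on the cones
  is extracted from the overlap of a maximal cone with a full-dimensional cell of some
  representative of the whole space.\<close>

lemma subspace_dir_space: "subspace (dir_space S)"
  unfolding dir_space_def by simp

lemma diff_in_dir_space: "x \<in> S \<Longrightarrow> y \<in> S \<Longrightarrow> x - y \<in> dir_space S"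
  unfolding dir_space_def by (rule span_base) auto

lemma dir_space_mono: "S \<subseteq> T \<Longrightarrow> dir_space S \<subseteq> dir_space T"
  unfolding dir_space_def by (rule span_mono) auto

lemma dir_space_eq_span:
  assumes "x \<in> S"
  shows "dir_space S = span ((\<lambda>y. y - x) ` S)"
proof
  have "y - z \<in> span ((\<lambda>y. y - x) ` S)" if "y \<in> S" "z \<in> S" for y z
  proof -
    have "(y - x) - (z - x) \<in> span ((\<lambda>y. y - x) ` S)"
      by (rule span_diff; rule span_base) (use that in auto)
    then show ?thesis by simp
  qed
  then show "dir_space S \<subseteq> span ((\<lambda>y. y - x) ` S)"
    unfolding dir_space_def by (intro span_minimal) auto
  show "span ((\<lambda>y. y - x) ` S) \<subseteq> dir_space S"
    by (intro span_minimal subspace_dir_space) (use assms in \<open>auto intro: diff_in_dir_space\<close>)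
qed

lemma affine_hull_eq_dir_space:
  assumes "x \<in> S"
  shows "affine hull S = (+) x ` dir_space S"
  using affine_hull_span_gen[of x S] assms hull_inc[of x S affine]
  by (simp add: dir_space_eq_span[OF assms] cong: image_cong)

lemma mem_affine_hull_iff_dir_space:
  assumes "x \<in> S"
  shows "y \<in> affine hull S \<longleftrightarrow> y - x \<in> dir_space S"
  unfolding affine_hull_eq_dir_space[OF assms]
  by (auto intro: image_eqI[of _ _ "y - x"])

lemma dir_space_affine_hull: "dir_space (affine hull S) = dir_space S"
proof (cases "S = {}")
  case False
  then obtain x where x: "x \<in> S" by auto
  have "dir_space (affine hull S) = span ((\<lambda>y. y - x) ` (affine hull S))"
    by (rule dir_space_eq_span) (simp add: x hull_inc)
  also have "\<dots> = span (dir_space S)"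
    unfolding affine_hull_eq_dir_space[OF x] by (simp add: image_image)
  finally show ?thesis by (simp add: subspace_dir_space span_eq_iff[THEN iffD2])
qed simp

lemma aff_dim_eq_dim_dir_space:
  assumes "S \<noteq> {}"
  shows "aff_dim S = int (dim (dir_space S))"
proof -
  from assms obtain x where x: "x \<in> S" by auto
  have "aff_dim S = int (dim ((\<lambda>y. y - x) ` S))"
    using aff_dim_eq_dim_subtract[of x S] x by (simp add: hull_inc)
  then show ?thesis by (simp add: dir_space_eq_span[OF x] dim_span)
qed

lemma affine_hull_eq_if_subset:
  fixes S T :: "(real^'n) set"
  assumes "S \<subseteq> affine hull T" "aff_dim T \<le> aff_dim S"
  shows "affine hull S = affine hull T"
proof (rule ccontr)
  assume ne: "affine hull S \<noteq> affine hull T"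
  have "affine hull S \<subseteq> affine hull T"
    using assms(1) by (simp add: hull_minimal)
  then have "aff_dim (affine hull S) < aff_dim (affine hull T)"
    using ne by (intro aff_dim_psubset) (auto simp: hull_hull)
  then show False using assms(2) by simp
qed

text \<open>Two distinct parameters already put the whole line into the affine set, in particular
  both endpoints. Finiteness is the form that survives taking unions over finitely many affine
  sets.\<close>

lemma finite_affine_meets_segment:
  fixes T :: "(real^'n) set"
  assumes "affine T" "\<not> (a \<in> T \<and> b \<in> T)"
  shows "finite {t::real. (1 - t) *\<^sub>R a + t *\<^sub>R b \<in> T}"
proof (rule ccontr)
  assume inf: "infinite {t::real. (1 - t) *\<^sub>R a + t *\<^sub>R b \<in> T}" (is "infinite ?U")
  then obtain s where s: "s \<in> ?U" by (meson not_finite_existsD mem_Collect_eq)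
  from inf have "infinite (?U - {s})" by simp
  then obtain t where "t \<in> ?U - {s}" using infinite_imp_nonempty by blast
  then have t: "t \<in> ?U" "t \<noteq> s" by auto
  have comb: "(1 - r) *\<^sub>R ((1 - s) *\<^sub>R a + s *\<^sub>R b) + r *\<^sub>R ((1 - t) *\<^sub>R a + t *\<^sub>R b) \<in> T" for r
    using assms(1) s t by (auto simp: affine_def)
  have eq: "(1 - r) *\<^sub>R ((1 - s) *\<^sub>R a + s *\<^sub>R b) + r *\<^sub>R ((1 - t) *\<^sub>R a + t *\<^sub>R b)
      = (1 - q) *\<^sub>R a + q *\<^sub>R b" if "q = (1 - r) * s + r * t" for q r
    unfolding that vec_eq_iff vector_add_component vector_scaleR_component real_scaleR_def by (intro allI) algebra
  have "(1 - q) *\<^sub>R a + q *\<^sub>R b \<in> T" for q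
  proof -
    have "(1 - (q - s)/(t - s)) * s + (q - s)/(t - s) * t = s + (q - s)/(t - s) * (t - s)"
      by algebra
    also have "\<dots> = q" using t by simp
    finally have q: "q = (1 - (q - s)/(t - s)) * s + (q - s)/(t - s) * t" by simp
    from comb[of "(q - s)/(t - s)"] show ?thesis unfolding eq[OF q] .
  qed
  from this[of 0] this[of 1] assms(2) show False by simp
qed

text \<open>Walk from a point that avoids the sets in \<open>F\<close> towards a point of
  \<open>S\<close> outside \<open>T\<close>: the walk stays in the relative interior until its end,
  and each affine set is met for finitely many parameters only.\<close>

lemma generic_point_exists:
  fixes S :: "(real^'n) set"
  assumes "convex S" "S \<noteq> {}" "finite F" "\<And>T. T \<in> F \<Longrightarrow> affine T \<and> \<not> S \<subseteq> T"
  shows "\<exists>x\<in>rel_interior S. \<forall>T\<in>F. x \<notin> T"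
  using assms(3,4)
proof (induction F)
  case empty
  then show ?case using assms rel_interior_eq_empty by fastforce
next
  case (insert T F)
  then obtain x where x: "x \<in> rel_interior S" "\<forall>T\<in>F. x \<notin> T" by auto
  obtain y where y: "y \<in> S" "y \<notin> T" using insert.prems by auto
  have "finite (\<Union>U\<in>insert T F. {t::real. (1 - t) *\<^sub>R x + t *\<^sub>R y \<in> U})"
    using insert.hyps x y insert.prems by (intro finite_UN_I finite_affine_meets_segment) auto
  then have "infinite ({0<..<1} - (\<Union>U\<in>insert T F. {t::real. (1 - t) *\<^sub>R x + t *\<^sub>R y \<in> U}))"
    by (intro Diff_infinite_finite) auto
  then obtain t where "t \<in> {0<..<1} - (\<Union>U\<in>insert T F. {t::real. (1 - t) *\<^sub>R x + t *\<^sub>R y \<in> U})"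
    using infinite_imp_nonempty by blast
  then have t: "0 < t" "t < 1" "\<forall>U\<in>insert T F. (1 - t) *\<^sub>R x + t *\<^sub>R y \<notin> U" by auto
  have "y - (1 - t) *\<^sub>R (y - x) \<in> rel_interior S"
    by (rule rel_interior_convex_shrink) (use assms x y t in auto)
  moreover have "y - (1 - t) *\<^sub>R (y - x) = (1 - t) *\<^sub>R x + t *\<^sub>R y" by (simp add: algebra_simps)
  ultimately show ?case using t by auto
qed

text \<open>Shrink towards one generic point \<open>z\<close>: as \<open>z\<close> lies in none of
  the sets, the segment from \<open>x\<close> to \<open>z\<close> meets them for finitely many
  parameters, so its points close to \<open>x\<close> are generic.\<close>

lemma generic_points_dense:
  fixes S :: "(real^'n) set"
  assumes "convex S" "finite F" "\<And>T. T \<in> F \<Longrightarrow> affine T \<and> \<not> S \<subseteq> T"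
  shows "S \<subseteq> closure {x \<in> rel_interior S. \<forall>T\<in>F. x \<notin> T}"
proof
  fix x assume x: "x \<in> S"
  obtain z where z: "z \<in> rel_interior S" "\<forall>T\<in>F. z \<notin> T"
    using generic_point_exists[OF assms(1) _ assms(2,3)] x by blast
  have fin: "finite (\<Union>U\<in>F. {t::real. (1 - t) *\<^sub>R x + t *\<^sub>R z \<in> U})"
    using assms z by (intro finite_UN_I finite_affine_meets_segment) auto
  have ev: "\<forall>\<^sub>F t in at_right 0. (1 - t) *\<^sub>R x + t *\<^sub>R z \<in> {x \<in> rel_interior S. \<forall>T\<in>F. x \<notin> T}"
  proof -
    have "\<forall>\<^sub>F t in at_right 0. t \<notin> (\<Union>U\<in>F. {t::real. (1 - t) *\<^sub>R x + t *\<^sub>R z \<in> U})"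
      using fin islimpt_finite[OF fin, of 0]
      by (auto simp: islimpt_iff_eventually eventually_at_filter elim!: eventually_mono)
    moreover have "\<forall>\<^sub>F t::real in at_right 0. t \<in> {0<..<1}"
      by (rule eventually_at_right_real) simp
    ultimately show ?thesis
    proof eventually_elim
      case (elim t)
      have "x - t *\<^sub>R (x - z) \<in> rel_interior S"
        by (rule rel_interior_convex_shrink) (use assms x z elim in auto)
      moreover have "x - t *\<^sub>R (x - z) = (1 - t) *\<^sub>R x + t *\<^sub>R z" by (simp add: algebra_simps)
      ultimately show ?case using elim by auto
    qed
  qed
  have lim: "((\<lambda>t. (1 - t) *\<^sub>R x + t *\<^sub>R z) \<longlongrightarrow> (1 - 0) *\<^sub>R x + 0 *\<^sub>R z) (at_right 0)"
    by (intro tendsto_intros)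
  have "\<forall>\<^sub>F t in at_right 0. (1 - t) *\<^sub>R x + t *\<^sub>R z \<in> closure {x \<in> rel_interior S. \<forall>T\<in>F. x \<notin> T}"
    using ev by (rule eventually_mono) (rule subsetD[OF closure_subset])
  from Lim_in_closed_set[OF closed_closure this _ lim]
  show "x \<in> closure {x \<in> rel_interior S. \<forall>T\<in>F. x \<notin> T}" by simp
qed

subsection \<open>Polyhedral complexes\<close>

lemma rational_polyhedron_imp_polyhedron: "rational_polyhedron S \<Longrightarrow> polyhedron S"
proof -
  assume "rational_polyhedron S"
  then obtain F :: "((real^'a) \<times> real) set" where F: "finite F" "S = {x. \<forall>(a, b)\<in>F. a \<bullet> x \<le> b}"
    unfolding rational_polyhedron_def by auto
  have "S = \<Inter>((\<lambda>(a, b). {x. a \<bullet> x \<le> b}) ` F)" using F by auto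
  also have "polyhedron \<dots>" using F by (intro polyhedron_Inter) (auto simp: polyhedron_halfspace_le)
  finally show ?thesis .
qed

lemma rational_polyhedron_Int:
  "rational_polyhedron S \<Longrightarrow> rational_polyhedron T \<Longrightarrow> rational_polyhedron (S \<inter> T)"
proof -
  assume "rational_polyhedron S" "rational_polyhedron T"
  then obtain F G :: "((real^'a) \<times> real) set" where
    "finite F" "finite G" "S = {x. \<forall>(a, b)\<in>F. a \<bullet> x \<le> b}" "T = {x. \<forall>(a, b)\<in>G. a \<bullet> x \<le> b}"
    "\<forall>(a, b)\<in>F. a \<in> int_lattice" "\<forall>(a, b)\<in>G. a \<in> int_lattice"
    unfolding rational_polyhedron_def by auto
  then show ?thesis
    unfolding rational_polyhedron_def by (intro exI[of _ "F \<union> G"]) auto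
qed

context
  fixes X :: "(real^'n) set set"
  assumes X: "polyhedral_complex X"
begin

lemma complex_finite: "finite X"
  using X unfolding polyhedral_complex_def by auto

lemma complex_rational: "\<sigma> \<in> X \<Longrightarrow> rational_polyhedron \<sigma>"
  using X unfolding polyhedral_complex_def by auto

lemma complex_polyhedron: "\<sigma> \<in> X \<Longrightarrow> polyhedron \<sigma>"
  using complex_rational rational_polyhedron_imp_polyhedron by blast

lemma complex_closed: "\<sigma> \<in> X \<Longrightarrow> closed \<sigma>"
  using complex_polyhedron polyhedron_imp_closed by blast

lemma complex_convex: "\<sigma> \<in> X \<Longrightarrow> convex \<sigma>"
  using complex_polyhedron polyhedron_imp_convex by blast

lemma complex_nonempty: "\<sigma> \<in> X \<Longrightarrow> \<sigma> \<noteq> {}"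
  using X unfolding polyhedral_complex_def by auto

lemma complex_face: "\<sigma> \<in> X \<Longrightarrow> \<tau> face_of \<sigma> \<Longrightarrow> \<tau> \<noteq> {} \<Longrightarrow> \<tau> \<in> X"
  using X unfolding polyhedral_complex_def by blast

lemma complex_Int: "\<sigma> \<in> X \<Longrightarrow> \<sigma>' \<in> X \<Longrightarrow> (\<sigma> \<inter> \<sigma>') face_of \<sigma> \<and> (\<sigma> \<inter> \<sigma>') face_of \<sigma>'"
  using X unfolding polyhedral_complex_def by blast

text \<open>The intersection of the two cells is a face of \<open>\<sigma>\<close> meeting the
  relative interior of \<open>\<sigma>\<close>, and the only such face is \<open>\<sigma>\<close>
  itself.\<close>

lemma complex_face_if_rel_interior:
  assumes "\<sigma> \<in> X" "\<sigma>' \<in> X" "x \<in> rel_interior \<sigma>" "x \<in> \<sigma>'"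
  shows "\<sigma> face_of \<sigma>'"
proof -
  have faces: "(\<sigma> \<inter> \<sigma>') face_of \<sigma>" "(\<sigma> \<inter> \<sigma>') face_of \<sigma>'"
    using complex_Int[OF assms(1,2)] by auto
  have "(\<sigma> \<inter> \<sigma>') \<inter> rel_interior \<sigma> \<noteq> {}"
    using assms(3,4) rel_interior_subset[of \<sigma>] by auto
  from subset_of_face_of[OF faces(1) order_refl this] have "\<sigma> \<inter> \<sigma>' = \<sigma>" by auto
  with faces(2) show ?thesis by simp
qed

lemma complex_eq_if_rel_interior:
  assumes "\<sigma> \<in> X" "\<sigma>' \<in> X" "x \<in> rel_interior \<sigma>" "x \<in> rel_interior \<sigma>'"
  shows "\<sigma> = \<sigma>'"
proof
  show "\<sigma> \<subseteq> \<sigma>'"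
    using complex_face_if_rel_interior[OF assms(1,2,3)] assms(4) rel_interior_subset[of \<sigma>']
    by (auto dest: face_of_imp_subset)
  show "\<sigma>' \<subseteq> \<sigma>"
    using complex_face_if_rel_interior[OF assms(2,1,4)] assms(3) rel_interior_subset[of \<sigma>]
    by (auto dest: face_of_imp_subset)
qed

text \<open>Descent on the dimension: a point off the relative interior lies on a facet. The cell
  obtained is the smallest face through \<open>x\<close>, the main tool for locating points later
  on.\<close>

lemma complex_point_in_rel_interior:
  assumes "\<sigma> \<in> X" "x \<in> \<sigma>"
  obtains \<tau> where "\<tau> \<in> X" "\<tau> face_of \<sigma>" "x \<in> rel_interior \<tau>"
proof -
  have "\<exists>\<tau>. \<tau> \<in> X \<and> \<tau> face_of \<sigma> \<and> x \<in> rel_interior \<tau>"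
    using assms
  proof (induction "nat (aff_dim \<sigma>)" arbitrary: \<sigma> rule: less_induct)
    case less
    show ?case
    proof (cases "x \<in> rel_interior \<sigma>")
      case True
      then show ?thesis using less.prems complex_convex face_of_refl by blast
    next
      case False
      then have "x \<in> rel_frontier \<sigma>"
        using less.prems complex_closed by (simp add: rel_frontier_def)
      then obtain F where F: "F facet_of \<sigma>" "x \<in> F"
        using rel_frontier_of_polyhedron[OF complex_polyhedron[OF less.prems(1)]] by auto
      then have FX: "F \<in> X" using complex_face[OF less.prems(1) facet_of_imp_face_of[OF F(1)]] by auto
      have "nat (aff_dim F) < nat (aff_dim \<sigma>)"
        using F complex_nonempty[OF FX] aff_dim_geq[of F]
        by (auto simp: facet_of_def aff_dim_negative_iff[symmetric] simp del: aff_dim_negative_iff)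
      from less.hyps[OF this FX F(2)] show ?thesis
        using face_of_trans[OF _ facet_of_imp_face_of[OF F(1)]] by auto
    qed
  qed
  then show ?thesis using that by auto
qed

lemma complex_subset_imp_face:
  assumes "\<tau> \<in> X" "\<sigma> \<in> X" "\<tau> \<subseteq> \<sigma>"
  shows "\<tau> face_of \<sigma>"
  using complex_Int[OF assms(1,2)] assms(3) by (metis inf.absorb1)

lemma polyhedral_subcomplex:
  assumes "Y \<subseteq> X" "\<And>\<sigma> \<tau>. \<sigma> \<in> Y \<Longrightarrow> \<tau> face_of \<sigma> \<Longrightarrow> \<tau> \<noteq> {} \<Longrightarrow> \<tau> \<in> Y"
  shows "polyhedral_complex Y"
  unfolding polyhedral_complex_def
proof (intro conjI ballI allI impI)
  show "finite Y" using complex_finite assms(1) by (rule rev_finite_subset)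
  show "rational_polyhedron \<sigma>" "\<sigma> \<noteq> {}" if "\<sigma> \<in> Y" for \<sigma>
    using that assms(1) complex_rational complex_nonempty by auto
  show "\<tau> \<in> Y" if "\<sigma> \<in> Y" "\<tau> face_of \<sigma> \<and> \<tau> \<noteq> {}" for \<sigma> \<tau> using that assms(2)[of \<sigma> \<tau>] by simp
  show "(\<sigma> \<inter> \<tau>) face_of \<sigma>" "(\<sigma> \<inter> \<tau>) face_of \<tau>" if "\<sigma> \<in> Y" "\<tau> \<in> Y" for \<sigma> \<tau>
    using complex_Int[of \<sigma> \<tau>] that assms(1) by auto
qed

end

subsection \<open>Rational subspaces and primitive normal vectors\<close>

lemma int_lattice_iff: "x \<in> int_lattice \<longleftrightarrow> (\<forall>i. x $ i \<in> \<int>)"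
  by (simp add: int_lattice_def)

lemma int_lattice_add: "x \<in> int_lattice \<Longrightarrow> y \<in> int_lattice \<Longrightarrow> x + y \<in> int_lattice"
  by (simp add: int_lattice_iff)

lemma int_lattice_diff: "x \<in> int_lattice \<Longrightarrow> y \<in> int_lattice \<Longrightarrow> x - y \<in> int_lattice"
  by (simp add: int_lattice_iff)

lemma int_lattice_minus: "x \<in> int_lattice \<Longrightarrow> - x \<in> int_lattice"
  by (simp add: int_lattice_iff)

lemma int_lattice_scale: "c \<in> \<int> \<Longrightarrow> x \<in> int_lattice \<Longrightarrow> c *\<^sub>R x \<in> int_lattice"
  by (simp add: int_lattice_iff)

lemma int_lattice_inner: "x \<in> int_lattice \<Longrightarrow> y \<in> int_lattice \<Longrightarrow> x \<bullet> y \<in> \<int>"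
  by (auto simp: int_lattice_iff inner_vec_def intro!: Ints_sum)

lemma Basis_subset_int_lattice: "Basis \<subseteq> (int_lattice :: (real^'n) set)"
  by (auto simp: Basis_vec_def int_lattice_iff axis_def)

text \<open>Only the inequalities that are equalities on all of \<open>\<sigma>\<close> cut down the
  direction space. The others are strict at a relatively interior point \<open>z\<close>, so a short
  step from \<open>z\<close> along a solution \<open>w\<close> of the equalities stays in
  \<open>\<sigma>\<close>.\<close>

lemma dir_space_rational_polyhedron:
  fixes \<sigma> :: "(real^'n) set"
  assumes "rational_polyhedron \<sigma>" "\<sigma> \<noteq> {}"
  obtains E where "finite E" "E \<subseteq> int_lattice" "dir_space \<sigma> = {x. \<forall>a\<in>E. a \<bullet> x = 0}"
proof -
  obtain F :: "((real^'n) \<times> real) set" where F: "finite F" "\<forall>(a, b)\<in>F. a \<in> int_lattice"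
      "\<sigma> = {x. \<forall>(a, b)\<in>F. a \<bullet> x \<le> b}"
    using assms(1) unfolding rational_polyhedron_def by auto
  have conv: "convex \<sigma>"
    using assms(1) polyhedron_imp_convex rational_polyhedron_imp_polyhedron by auto
  obtain z where z: "z \<in> rel_interior \<sigma>" using assms(2) conv rel_interior_eq_empty by auto
  have zs: "z \<in> \<sigma>" using z rel_interior_subset by auto
  define E where "E = fst ` {(a, b) \<in> F. \<forall>x\<in>\<sigma>. a \<bullet> x = b}"
  have "finite E" using F(1) unfolding E_def by (auto intro: finite_subset[of _ F])
  moreover have "E \<subseteq> int_lattice" using F(2) unfolding E_def by auto
  moreover have "dir_space \<sigma> = {x. \<forall>a\<in>E. a \<bullet> x = 0}"
  proof
    have sub: "subspace {x. \<forall>a\<in>E. a \<bullet> x = 0}"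
      by (auto simp: subspace_def inner_right_distrib)
    show "dir_space \<sigma> \<subseteq> {x. \<forall>a\<in>E. a \<bullet> x = 0}"
      unfolding dir_space_def
      by (rule span_minimal[OF _ sub]) (auto simp: E_def inner_diff_right)
    show "{x. \<forall>a\<in>E. a \<bullet> x = 0} \<subseteq> dir_space \<sigma>"
    proof
      fix w assume w: "w \<in> {x. \<forall>a\<in>E. a \<bullet> x = 0}"
      have "\<forall>\<^sub>F t in at_right (0::real). \<forall>p\<in>F. fst p \<bullet> (z + t *\<^sub>R w) \<le> snd p"
      proof (rule eventually_ball_finite[OF F(1)], rule ballI)
        fix p assume p: "p \<in> F"
        obtain a b where ab: "p = (a, b)" by (cases p)
        have le: "a \<bullet> x \<le> b" if "x \<in> \<sigma>" for x using F(3) p ab that by auto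
        show "\<forall>\<^sub>F t in at_right (0::real). fst p \<bullet> (z + t *\<^sub>R w) \<le> snd p"
        proof (cases "\<forall>x\<in>\<sigma>. a \<bullet> x = b")
          case True
          then have "a \<in> E" using p ab unfolding E_def by force
          then have "a \<bullet> w = 0" using w by auto
          then show ?thesis using True zs ab by (simp add: inner_right_distrib)
        next
          case False
          then obtain y where y: "y \<in> \<sigma>" "a \<bullet> y < b" using le by force
          \<comment> \<open>The segment from \<open>y\<close> to \<open>z\<close> can be prolonged
            beyond \<open>z\<close>; if the inequality were tight at \<open>z\<close>, it would fail
            at the prolonged point because it is strict at \<open>y\<close>.\<close>
          obtain e where e: "e > 1" "(1 - e) *\<^sub>R y + e *\<^sub>R z \<in> \<sigma>"
            using convex_rel_interior_iff[OF conv assms(2)] z y by auto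
          have "a \<bullet> z < b"
          proof (rule ccontr)
            assume "\<not> a \<bullet> z < b"
            then have "a \<bullet> z = b" using le[OF zs] by simp
            moreover have "a \<bullet> ((1 - e) *\<^sub>R y + e *\<^sub>R z) \<le> b" using le e by auto
            ultimately have "(1 - e) * (a \<bullet> y - b) \<le> 0" by (simp add: inner_right_distrib algebra_simps)
            moreover have "(1 - e) * (a \<bullet> y - b) > 0" using e y by (intro mult_neg_neg) auto
            ultimately show False by simp
          qed
          moreover have "((\<lambda>t. a \<bullet> (z + t *\<^sub>R w)) \<longlongrightarrow> a \<bullet> (z + 0 *\<^sub>R w)) (at_right 0)"
            by (intro tendsto_intros)
          ultimately have "\<forall>\<^sub>F t in at_right 0. a \<bullet> (z + t *\<^sub>R w) < b"
            by (intro order_tendstoD(2)) auto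
          then show ?thesis by (rule eventually_mono) (simp add: ab)
        qed
      qed
      then obtain t where t: "t > 0" "\<forall>p\<in>F. fst p \<bullet> (z + t *\<^sub>R w) \<le> snd p"
        by (auto simp: eventually_at_right_field dest: dense)
      then have "z + t *\<^sub>R w \<in> \<sigma>" using F(3) by auto
      then have "(z + t *\<^sub>R w) - z \<in> dir_space \<sigma>" using zs by (rule diff_in_dir_space)
      then have "(1/t) *\<^sub>R ((z + t *\<^sub>R w) - z) \<in> dir_space \<sigma>"
        by (rule subspace_scale[OF subspace_dir_space])
      then show "w \<in> dir_space \<sigma>" using t by simp
    qed
  qed
  ultimately show thesis by (rule that)
qed

text \<open>Gaussian elimination without division: \<open>h\<close> clears the
  \<open>a\<close>-component by cross-multiplication with \<open>b0\<close>, so it keeps vectors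
  integral, and on the hyperplane of \<open>a\<close> it is multiplication by the nonzero number
  \<open>a \<bullet> b0\<close>.\<close>

lemma integer_equations_span:
  fixes E :: "(real^'n) set"
  assumes "finite E" "E \<subseteq> int_lattice"
  shows "\<exists>B \<subseteq> int_lattice. {x. \<forall>a\<in>E. a \<bullet> x = 0} = span B"
  using assms
proof (induction E)
  case empty
  then show ?case using Basis_subset_int_lattice by (auto intro!: exI[of _ Basis])
next
  case (insert a E)
  then obtain B where B: "B \<subseteq> int_lattice" "{x. \<forall>a\<in>E. a \<bullet> x = 0} = span B" by auto
  have eq: "{x. \<forall>a\<in>insert a E. a \<bullet> x = 0} = {x \<in> span B. a \<bullet> x = 0}" using B(2) by auto
  have aL: "a \<in> int_lattice" using insert.prems by auto
  show ?case
  proof (cases "\<forall>b\<in>B. a \<bullet> b = 0")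
    case True
    have sub: "subspace {x. a \<bullet> x = 0}" by (simp add: subspace_hyperplane)
    have "span B \<subseteq> {x. a \<bullet> x = 0}" by (rule span_minimal[OF _ sub]) (use True in auto)
    then have "{x \<in> span B. a \<bullet> x = 0} = span B" by auto
    then show ?thesis using B(1) eq by auto
  next
    case False
    then obtain b0 where b0: "b0 \<in> B" "a \<bullet> b0 \<noteq> 0" by auto
    define h where "h x = (a \<bullet> b0) *\<^sub>R x - (a \<bullet> x) *\<^sub>R b0" for x
    have h: "linear h" unfolding h_def
      by (rule linearI) (simp_all add: inner_right_distrib algebra_simps)
    have "h ` B \<subseteq> int_lattice"
      unfolding h_def using B(1) b0 aL
      by (auto intro!: int_lattice_diff int_lattice_scale int_lattice_inner)
    moreover have "{x \<in> span B. a \<bullet> x = 0} = span (h ` B)"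
    proof
      have sub: "subspace {x \<in> span B. a \<bullet> x = 0}"
        by (auto simp: subspace_def inner_right_distrib span_zero span_add span_scale)
      show "span (h ` B) \<subseteq> {x \<in> span B. a \<bullet> x = 0}"
        by (rule span_minimal[OF _ sub])
          (use b0 in \<open>auto simp: h_def inner_diff_right intro: span_diff span_scale span_base\<close>)
      show "{x \<in> span B. a \<bullet> x = 0} \<subseteq> span (h ` B)"
      proof
        fix x assume "x \<in> {x \<in> span B. a \<bullet> x = 0}"
        then have x: "x \<in> span B" "a \<bullet> x = 0" by auto
        then have "h x \<in> span (h ` B)" using h by (simp add: linear_span_image)
        then have "(1 / (a \<bullet> b0)) *\<^sub>R h x \<in> span (h ` B)" by (rule span_scale)
        then show "x \<in> span (h ` B)" using x b0 by (simp add: h_def)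
      qed
    qed
    ultimately show ?thesis using eq by auto
  qed
qed

section \<open>Facets and their primitive normal vectors\<close>

lemma facet_affine_hull_Int:
  fixes \<sigma> :: "(real^'n) set"
  assumes "convex \<sigma>" "\<tau> facet_of \<sigma>" "y \<in> \<sigma>" "x \<in> \<tau>" "y - x \<in> dir_space \<tau>"
  shows "y \<in> \<tau>"
proof -
  have "y \<in> affine hull \<tau>" using assms(4,5) by (simp add: mem_affine_hull_iff_dir_space)
  then show ?thesis
    using face_of_imp_eq_affine_Int[OF assms(1) facet_of_imp_face_of[OF assms(2)]] assms(3) by auto
qed

lemma facet_proper: "\<tau> facet_of \<sigma> \<Longrightarrow> \<exists>y\<in>\<sigma>. y \<notin> \<tau>"
  by (metis subsetI subset_antisym facet_of_imp_subset facet_of_irrefl)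

text \<open>An integer form \<open>a\<close> has kernel \<open>V_\<tau>\<close> on
  \<open>V_\<sigma>\<close>. A vector of \<open>\<Lambda>_\<sigma>\<close> on which \<open>a\<close>
  takes its least positive value generates modulo \<open>\<Lambda>_\<tau>\<close> by division with
  remainder, and it points to the correct side because \<open>a\<close> is nonnegative on
  differences \<open>y - x\<close> with \<open>y\<close> in \<open>\<sigma>\<close> and
  \<open>x\<close> in \<open>\<tau>\<close>.\<close>

lemma represents_normal_exists:
  fixes \<sigma> :: "(real^'n) set"
  assumes "rational_polyhedron \<sigma>" "rational_polyhedron \<tau>" "\<tau> facet_of \<sigma>"
  shows "\<exists>v. represents_normal \<sigma> \<tau> v"
proof -
  have conv: "convex \<sigma>"
    using assms(1) polyhedron_imp_convex rational_polyhedron_imp_polyhedron by auto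
  have face: "\<tau> face_of \<sigma>" using assms(3) by (rule facet_of_imp_face_of)
  have sub: "\<tau> \<subseteq> \<sigma>" using assms(3) by (rule facet_of_imp_subset)
  have tne: "\<tau> \<noteq> {}" and dim: "aff_dim \<tau> = aff_dim \<sigma> - 1"
    using assms(3) unfolding facet_of_def by auto
  have sne: "\<sigma> \<noteq> {}" using sub tne by auto
  let ?T = "dir_space \<tau>" and ?V = "dir_space \<sigma>"
  have TV: "?T \<subseteq> ?V" using sub by (rule dir_space_mono)
  have dims: "dim ?V = dim ?T + 1"
    using dim aff_dim_eq_dim_dir_space[OF tne] aff_dim_eq_dim_dir_space[OF sne] by simp
  obtain E where E: "finite E" "E \<subseteq> int_lattice" "?T = {x. \<forall>a\<in>E. a \<bullet> x = 0}"
    using dir_space_rational_polyhedron[OF assms(2) tne] .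
  obtain x0 where x0: "x0 \<in> rel_interior \<tau>"
    using tne rel_interior_eq_empty[OF face_of_imp_convex[OF face]] by auto
  have x0t: "x0 \<in> \<tau>" using x0 rel_interior_subset by auto
  obtain y0 where y0: "y0 \<in> \<sigma>" "y0 \<notin> \<tau>" using facet_proper[OF assms(3)] by auto
  have "y0 - x0 \<notin> ?T" using facet_affine_hull_Int[OF conv assms(3)] y0 x0t by blast
  then obtain a' where a': "a' \<in> E" "a' \<bullet> (y0 - x0) \<noteq> 0" using E(3) by auto
  \<comment> \<open>The sign puts \<open>\<sigma>\<close> on the positive side. One equation of
    \<open>V_\<tau>\<close> that fails at \<open>y0 - x0\<close> is enough because
    \<open>V_\<tau>\<close> has codimension one in \<open>V_\<sigma>\<close>.\<close>
  define a where "a = (if a' \<bullet> (y0 - x0) > 0 then a' else - a')"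
  have aL: "a \<in> int_lattice" using a' E(2) int_lattice_minus by (auto simp: a_def)
  have apos: "a \<bullet> (y0 - x0) > 0" using a' by (auto simp: a_def)
  have aT: "a \<bullet> t = 0" if "t \<in> ?T" for t using that a' E(3) by (auto simp: a_def)
  have T_eq: "?T = {x \<in> ?V. a \<bullet> x = 0}"
  proof (rule subspace_dim_equal)
    show subH: "subspace {x \<in> ?V. a \<bullet> x = 0}"
      using subspace_dir_space[of \<sigma>] by (auto simp: subspace_def inner_right_distrib)
    show "subspace ?T" by (rule subspace_dir_space)
    show "?T \<subseteq> {x \<in> ?V. a \<bullet> x = 0}" using TV aT by auto
    have "{x \<in> ?V. a \<bullet> x = 0} \<noteq> ?V" using diff_in_dir_space[OF y0(1), of x0] sub x0t apos by force
    then have "{x \<in> ?V. a \<bullet> x = 0} \<subset> ?V" by auto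
    then have "span {x \<in> ?V. a \<bullet> x = 0} \<subset> span ?V"
      by (simp add: subH subspace_dir_space span_eq_iff[THEN iffD2])
    then have "dim {x \<in> ?V. a \<bullet> x = 0} < dim ?V" by (rule dim_psubset)
    then show "dim {x \<in> ?V. a \<bullet> x = 0} \<le> dim ?T" using dims by simp
  qed
  have nonneg: "a \<bullet> (y - x) \<ge> 0" if y: "y \<in> \<sigma>" and x: "x \<in> \<tau>" for x y
  proof (rule ccontr)
    assume "\<not> a \<bullet> (y - x) \<ge> 0"
    moreover have "a \<bullet> (x - x0) = 0" by (intro aT diff_in_dir_space x x0t)
    ultimately have neg: "a \<bullet> (y - x0) < 0" by (simp add: inner_diff_right)
    define p q where "p = a \<bullet> (y0 - x0)" and "q = - (a \<bullet> (y - x0))"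
    have pq: "p > 0" "q > 0" using neg apos by (auto simp: p_def q_def)
    \<comment> \<open>The parameter at which the segment from \<open>y0\<close> to \<open>y\<close>
      crosses the level of \<open>x0\<close> under \<open>a\<close>. The crossing point would lie in
      \<open>\<tau>\<close>, and the face property would pull \<open>y0\<close> into
      \<open>\<tau>\<close>.\<close>
    define s where "s = p / (p + q)"
    have s: "0 < s" "s < 1" using pq by (auto simp: s_def field_simps)
    define z where "z = (1 - s) *\<^sub>R y0 + s *\<^sub>R y"
    have zo: "z \<in> open_segment y0 y"
      unfolding in_segment z_def using s neg apos by auto
    have zs: "z \<in> \<sigma>" using conv y0 y s unfolding z_def convex_alt by auto
    have "a \<bullet> (z - x0) = (1 - s) * p - s * q"
      by (simp add: z_def p_def q_def inner_diff_right inner_right_distrib algebra_simps)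
    also have "\<dots> = 0" using pq by (simp add: s_def field_simps)
    finally have "z - x0 \<in> ?T"
      using T_eq diff_in_dir_space[OF zs, of x0] sub x0t by auto
    then have "z \<in> \<tau>" using facet_affine_hull_Int[OF conv assms(3) zs x0t] by auto
    then have "y0 \<in> \<tau>" using face_ofD[OF face zo y0(1) y] by auto
    then show False using y0 by auto
  qed
  obtain EV where EV: "finite EV" "EV \<subseteq> int_lattice" "?V = {x. \<forall>a\<in>EV. a \<bullet> x = 0}"
    using dir_space_rational_polyhedron[OF assms(1) sne] .
  obtain B where B: "B \<subseteq> int_lattice" "?V = span B"
    using integer_equations_span[OF EV(1,2)] EV(3) by auto
  \<comment> \<open>Rationality of \<open>V_\<sigma>\<close> enters here: without a spanning set of
    lattice vectors, \<open>a\<close> could vanish on all of \<open>\<Lambda>_\<sigma>\<close> and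
    there would be no least positive value.\<close>
  have "\<exists>b\<in>B. a \<bullet> b \<noteq> 0"
  proof (rule ccontr)
    assume "\<not> (\<exists>b\<in>B. a \<bullet> b \<noteq> 0)"
    then have "span B \<subseteq> {x. a \<bullet> x = 0}"
      by (intro span_minimal subspace_hyperplane) auto
    then show False using B(2) diff_in_dir_space[OF y0(1), of x0] sub x0t apos by force
  qed
  then obtain b where b: "b \<in> B" "a \<bullet> b \<noteq> 0" by auto
  define N where "N = (\<lambda>n::nat. n > 0 \<and> (\<exists>w\<in>dir_lattice \<sigma>. a \<bullet> w = real n))"
  have latt: "dir_lattice \<sigma> = int_lattice \<inter> ?V" "dir_lattice \<tau> = int_lattice \<inter> ?T"
    by (auto simp: dir_lattice_def)
  have bL: "b \<in> int_lattice" using b B(1) by auto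
  have bV: "b \<in> ?V" using b B(2) span_base by auto
  have "\<exists>n. N n"
  proof -
    obtain m where m: "a \<bullet> b = of_int m"
      using int_lattice_inner[OF aL bL] by (auto elim: Ints_cases)
    have "m \<noteq> 0" using m b by auto
    define c where "c = (if m > 0 then b else - b)"
    have "c \<in> dir_lattice \<sigma>"
      using bL bV int_lattice_minus subspace_neg[OF subspace_dir_space] by (auto simp: c_def latt)
    moreover have "a \<bullet> c = real (nat \<bar>m\<bar>)" using m by (auto simp: c_def)
    ultimately have "N (nat \<bar>m\<bar>)" using \<open>m \<noteq> 0\<close> unfolding N_def by auto
    then show ?thesis ..
  qed
  then have N: "N (LEAST n. N n)" by (rule LeastI_ex)
  define n where "n = (LEAST n. N n)"
  obtain v where v: "n > 0" "v \<in> dir_lattice \<sigma>" "a \<bullet> v = real n" using N unfolding n_def N_def by auto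
  have "represents_normal \<sigma> \<tau> v"
    unfolding represents_normal_def
  proof (intro conjI)
    show "v \<in> dir_lattice \<sigma>" by fact
    show "dir_lattice \<sigma> = {of_int a *\<^sub>R v + w |a w. w \<in> dir_lattice \<tau>}"
    proof
      show "{of_int a *\<^sub>R v + w |a w. w \<in> dir_lattice \<tau>} \<subseteq> dir_lattice \<sigma>"
        using v(2) TV unfolding latt
        by (auto intro!: int_lattice_add int_lattice_scale subspace_add[OF subspace_dir_space]
            subspace_scale[OF subspace_dir_space])
      show "dir_lattice \<sigma> \<subseteq> {of_int a *\<^sub>R v + w |a w. w \<in> dir_lattice \<tau>}"
      proof
        fix w assume w: "w \<in> dir_lattice \<sigma>"
        obtain m where m: "a \<bullet> w = of_int m"
          using int_lattice_inner[OF aL, of w] w by (auto elim: Ints_cases simp: latt)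
        define r where "r = w - of_int (m div int n) *\<^sub>R v"
        have rs: "r \<in> dir_lattice \<sigma>"
          using v(2) w unfolding latt r_def
          by (auto intro!: int_lattice_diff int_lattice_scale subspace_diff[OF subspace_dir_space]
            subspace_scale[OF subspace_dir_space])
        have "a \<bullet> r = of_int m - of_int (m div int n) * real n"
          by (simp add: r_def inner_diff_right m v)
        also have "\<dots> = of_int (m - (m div int n) * int n)" by simp
        also have "\<dots> = of_int (m mod int n)" by (simp only: minus_div_mult_eq_mod)
        finally have ar: "a \<bullet> r = of_int (m mod int n)" .
        have bounds: "0 \<le> m mod int n" "m mod int n < int n" using v(1) by auto
        have "m mod int n = 0"
        proof (rule ccontr)
          assume "m mod int n \<noteq> 0"
          then have "N (nat (m mod int n))" using rs ar bounds unfolding N_def by auto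
          then have "n \<le> nat (m mod int n)" unfolding n_def by (rule Least_le)
          then show False using bounds by linarith
        qed
        then have "r \<in> dir_lattice \<tau>" using ar rs T_eq unfolding latt by auto
        moreover have "w = of_int (m div int n) *\<^sub>R v + r" by (simp add: r_def)
        ultimately show "w \<in> {of_int a *\<^sub>R v + w |a w. w \<in> dir_lattice \<tau>}" by blast
      qed
    qed
    show "\<forall>x\<in>\<tau>. \<forall>y\<in>\<sigma>. \<exists>t\<ge>0. y - x - t *\<^sub>R v \<in> dir_space \<tau>"
    proof (intro ballI)
      fix x y assume x: "x \<in> \<tau>" and y: "y \<in> \<sigma>"
      define t where "t = a \<bullet> (y - x) / real n"
      have "t \<ge> 0" using nonneg[OF y x] by (simp add: t_def)
      moreover have "y - x - t *\<^sub>R v \<in> ?T"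
      proof -
        have "y - x - t *\<^sub>R v \<in> ?V"
          using v(2) diff_in_dir_space[OF y subsetD[OF sub x]] unfolding latt
          by (intro subspace_diff[OF subspace_dir_space, of "y - x"] subspace_scale[OF subspace_dir_space]) auto
        moreover have "a \<bullet> (y - x - t *\<^sub>R v) = 0"
          using v by (simp add: t_def inner_diff_right)
        ultimately show ?thesis using T_eq by auto
      qed
      ultimately show "\<exists>t\<ge>0. y - x - t *\<^sub>R v \<in> dir_space \<tau>" by auto
    qed
  qed
  then show ?thesis ..
qed

lemma represents_normal_normal_vec:
  assumes "polyhedral_complex X" "\<sigma> \<in> X" "\<tau> \<in> X" "\<tau> facet_of \<sigma>"
  shows "represents_normal \<sigma> \<tau> (normal_vec \<sigma> \<tau>)"
  unfolding normal_vec_def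
  by (rule someI_ex, rule represents_normal_exists)
    (use assms complex_rational[OF assms(1)] in auto)

subsection \<open>Orthogonal projection modulo a subspace\<close>

definition orth_proj :: "'a::euclidean_space set \<Rightarrow> 'a \<Rightarrow> 'a" where
  "orth_proj T v = (SOME u. (\<forall>t\<in>T. u \<bullet> t = 0) \<and> v - u \<in> T)"

context
  fixes T :: "'a::euclidean_space set"
  assumes T: "subspace T"
begin

lemma orth_proj: "(\<forall>t\<in>T. orth_proj T v \<bullet> t = 0) \<and> v - orth_proj T v \<in> T"
  unfolding orth_proj_def
proof (rule someI_ex)
  obtain y z where "y \<in> span T" "\<And>w. w \<in> span T \<Longrightarrow> orthogonal z w" "v = y + z"
    using orthogonal_subspace_decomp_exists[of T v] by metis
  then show "\<exists>u. (\<forall>t\<in>T. u \<bullet> t = 0) \<and> v - u \<in> T"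
    using T by (intro exI[of _ z]) (auto simp: orthogonal_def span_eq_iff[THEN iffD2])
qed

lemma orth_proj_orthogonal: "t \<in> T \<Longrightarrow> orth_proj T v \<bullet> t = 0"
  using orth_proj by auto

lemma orth_proj_diff: "v - orth_proj T v \<in> T"
  using orth_proj by auto

lemma orthogonal_in_subspace_zero: "u \<in> T \<Longrightarrow> (\<And>t. t \<in> T \<Longrightarrow> u \<bullet> t = 0) \<Longrightarrow> u = 0"
  using inner_eq_zero_iff by blast

lemma orth_proj_unique:
  assumes "\<And>t. t \<in> T \<Longrightarrow> u \<bullet> t = 0" "v - u \<in> T"
  shows "orth_proj T v = u"
proof -
  have "(v - u) - (v - orth_proj T v) \<in> T"
    by (rule subspace_diff[OF T assms(2) orth_proj_diff])
  then have "orth_proj T v - u \<in> T" by simp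
  then have "orth_proj T v - u = 0"
    by (rule orthogonal_in_subspace_zero)
      (simp add: inner_diff_left orth_proj_orthogonal assms(1))
  then show ?thesis by simp
qed

lemma linear_orth_proj: "linear (orth_proj T)"
proof (rule linearI)
  fix x y :: 'a and c :: real
  show "orth_proj T (x + y) = orth_proj T x + orth_proj T y"
  proof (rule orth_proj_unique)
    have "(x - orth_proj T x) + (y - orth_proj T y) \<in> T"
      by (intro subspace_add[OF T] orth_proj_diff)
    then show "x + y - (orth_proj T x + orth_proj T y) \<in> T" by (simp add: algebra_simps)
  qed (simp add: inner_add_left orth_proj_orthogonal)
  show "orth_proj T (c *\<^sub>R x) = c *\<^sub>R orth_proj T x"
  proof (rule orth_proj_unique)
    have "c *\<^sub>R (x - orth_proj T x) \<in> T"
      by (intro subspace_scale[OF T] orth_proj_diff)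
    then show "c *\<^sub>R x - c *\<^sub>R orth_proj T x \<in> T" by (simp add: algebra_simps)
  qed (simp add: orth_proj_orthogonal)
qed

lemma orth_proj_zero_iff: "orth_proj T v = 0 \<longleftrightarrow> v \<in> T"
  using orth_proj_diff[of v] orth_proj_unique[of 0 v] by auto

lemma orth_proj_eq_iff: "orth_proj T v = orth_proj T w \<longleftrightarrow> v - w \<in> T"
  using orth_proj_zero_iff[of "v - w"] linear_diff[OF linear_orth_proj, of v w] by auto

end

text \<open>The projection to the orthogonal complement gives canonical representatives in \<open>V/V\<^sub>\<tau>\<close>: the
  vectors satisfying the following predicate are the images of the primitive normal vectors.\<close>

definition primitive_mod :: "(real^'n) set \<Rightarrow> real^'n \<Rightarrow> bool" where
  "primitive_mod T u \<longleftrightarrow> u \<noteq> 0 \<and> (\<exists>v\<in>int_lattice. orth_proj T v = u) \<and>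
     (\<forall>w\<in>int_lattice. \<forall>c. orth_proj T w = c *\<^sub>R u \<longrightarrow> c \<in> \<int>)"

lemma primitive_mod_orthogonal:
  "primitive_mod T u \<Longrightarrow> subspace T \<Longrightarrow> t \<in> T \<Longrightarrow> u \<bullet> t = 0"
  unfolding primitive_mod_def using orth_proj_orthogonal by blast

lemma primitive_mod_minus:
  assumes "subspace T" "primitive_mod T u"
  shows "primitive_mod T (- u)"
  unfolding primitive_mod_def
proof (intro conjI ballI allI impI)
  show "- u \<noteq> 0" using assms(2) by (simp add: primitive_mod_def)
  obtain v where "v \<in> int_lattice" "orth_proj T v = u" using assms(2) by (auto simp: primitive_mod_def)
  then show "\<exists>v\<in>int_lattice. orth_proj T v = - u"
    using linear_neg[OF linear_orth_proj[OF assms(1)], of v] int_lattice_minus by (intro bexI[of _ "- v"]) auto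
  fix w :: "real^'a" and c :: real assume "w \<in> int_lattice" "orth_proj T w = c *\<^sub>R - u"
  then have "- c \<in> \<int>" using assms(2) unfolding primitive_mod_def by (metis scaleR_minus_left scaleR_minus_right)
  then show "c \<in> \<int>" by simp
qed

text \<open>Each vector is the image of a lattice vector and a multiple of the other, so
  \<open>c\<close> and \<open>1 / c\<close> are both integers.\<close>

lemma primitive_mod_unique:
  assumes "primitive_mod T u" "primitive_mod T u'" "u = c *\<^sub>R u'" "c > 0"
  shows "u = u'"
proof -
  have "c \<in> \<int>" using assms unfolding primitive_mod_def by metis
  moreover have "u' = (1 / c) *\<^sub>R u" using assms by simp
  then have "1 / c \<in> \<int>" using assms unfolding primitive_mod_def by metis
  ultimately obtain a b :: int where ab: "c = of_int a" "1 / c = of_int b" by (auto elim!: Ints_cases)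
  then have "of_int a * of_int b = (1::real)" using assms(4) by (metis mult.commute nonzero_divide_eq_eq less_numeral_extra(3))
  then have "a * b = 1" by (metis of_int_eq_1_iff of_int_mult)
  moreover have "a > 0" using ab assms(4) by simp
  ultimately have "a = 1" using pos_zmult_eq_1_iff by blast
  then show ?thesis using ab assms by simp
qed

lemma represents_normal_side:
  assumes "represents_normal \<sigma> \<tau> v" "x \<in> \<tau>" "y \<in> \<sigma>"
  obtains t where "t \<ge> 0" "y - x - t *\<^sub>R v \<in> dir_space \<tau>"
proof -
  have "\<forall>x\<in>\<tau>. \<forall>y\<in>\<sigma>. \<exists>t\<ge>0. y - x - t *\<^sub>R v \<in> dir_space \<tau>"
    using assms(1) unfolding represents_normal_def by (elim conjE)
  then show thesis using assms(2,3) that by auto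
qed

lemma represents_normal_notin:
  assumes "represents_normal \<sigma> \<tau> v" "\<tau> facet_of \<sigma>" "convex \<sigma>"
  shows "v \<notin> dir_space \<tau>"
proof
  assume v: "v \<in> dir_space \<tau>"
  obtain y where y: "y \<in> \<sigma>" "y \<notin> \<tau>" using facet_proper[OF assms(2)] by auto
  obtain x where x: "x \<in> \<tau>" using assms(2) by (auto simp: facet_of_def)
  obtain t where t: "y - x - t *\<^sub>R v \<in> dir_space \<tau>"
    using represents_normal_side[OF assms(1) x y(1)] .
  have "(y - x - t *\<^sub>R v) + t *\<^sub>R v \<in> dir_space \<tau>"
    by (intro subspace_add[OF subspace_dir_space] subspace_scale[OF subspace_dir_space] t v)
  then have "y - x \<in> dir_space \<tau>" by simp
  then show False using facet_affine_hull_Int[OF assms(3,2)] x y by blast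
qed

text \<open>A lattice vector projecting to a multiple of the projection of \<open>v\<close> lies in
  \<open>\<Lambda>_\<sigma>\<close>, where the generator property allows only integer multiples of
  \<open>v\<close> modulo \<open>\<Lambda>_\<tau>\<close>.\<close>

lemma represents_normal_primitive:
  assumes "represents_normal \<sigma> \<tau> v" "\<tau> facet_of \<sigma>" "convex \<sigma>"
  shows "primitive_mod (dir_space \<tau>) (orth_proj (dir_space \<tau>) v)"
  unfolding primitive_mod_def
proof (intro conjI ballI allI impI)
  let ?T = "dir_space \<tau>"
  note sT = subspace_dir_space[of \<tau>]
  have v: "v \<in> int_lattice" "v \<in> dir_space \<sigma>"
    using assms(1) by (auto simp: represents_normal_def dir_lattice_def)
  show nz: "orth_proj ?T v \<noteq> 0"
    using represents_normal_notin[OF assms] by (simp add: orth_proj_zero_iff sT)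
  show "\<exists>v'\<in>int_lattice. orth_proj ?T v' = orth_proj ?T v" using v by auto
  fix w :: "real^'a" and c :: real
  assume w: "w \<in> int_lattice" "orth_proj ?T w = c *\<^sub>R orth_proj ?T v"
  then have "orth_proj ?T w = orth_proj ?T (c *\<^sub>R v)"
    by (simp add: linear_scale[OF linear_orth_proj[OF sT]])
  then have "w - c *\<^sub>R v \<in> ?T" by (simp add: orth_proj_eq_iff sT)
  then have "w - c *\<^sub>R v \<in> dir_space \<sigma>"
    using dir_space_mono[OF facet_of_imp_subset[OF assms(2)]] by auto
  then have "(w - c *\<^sub>R v) + c *\<^sub>R v \<in> dir_space \<sigma>"
    by (intro subspace_add[OF subspace_dir_space] subspace_scale[OF subspace_dir_space] v)
  then have "w \<in> dir_lattice \<sigma>" using w by (simp add: dir_lattice_def)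
  then obtain a w' where aw: "w = of_int a *\<^sub>R v + w'" "w' \<in> dir_lattice \<tau>"
    using assms(1) unfolding represents_normal_def by blast
  then have "w - of_int a *\<^sub>R v \<in> ?T" by (simp add: dir_lattice_def)
  then have "orth_proj ?T w = of_int a *\<^sub>R orth_proj ?T v"
    by (simp add: orth_proj_eq_iff[OF sT, symmetric] linear_scale[OF linear_orth_proj[OF sT]])
  then have "c = of_int a" using w(2) nz by simp
  then show "c \<in> \<int>" by simp
qed

text \<open>Both projections are primitive and lie on the ray through the projection of
  \<open>y - x\<close>. The lemma permits replacing the chosen \<open>normal_vec\<close> by a
  generator of a unimodular cone.\<close>

lemma represents_normal_unique:
  assumes "represents_normal \<sigma> \<tau> v" "represents_normal \<sigma> \<tau> v'" "\<tau> facet_of \<sigma>" "convex \<sigma>"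
  shows "v - v' \<in> dir_space \<tau>"
proof -
  let ?T = "dir_space \<tau>"
  note sT = subspace_dir_space[of \<tau>]
  obtain y where y: "y \<in> \<sigma>" "y \<notin> \<tau>" using facet_proper[OF assms(3)] by auto
  obtain x where x: "x \<in> \<tau>" using assms(3) by (auto simp: facet_of_def)
  have "y - x \<notin> ?T" using facet_affine_hull_Int[OF assms(4,3)] x y by blast
  then have nz: "orth_proj ?T (y - x) \<noteq> 0" by (simp add: orth_proj_zero_iff sT)
  have pos: "\<exists>t. 0 < t \<and> orth_proj ?T (y - x) = t *\<^sub>R orth_proj ?T w" if rep: "represents_normal \<sigma> \<tau> w" for w
  proof -
    obtain t where t: "t \<ge> 0" "y - x - t *\<^sub>R w \<in> ?T"
      using represents_normal_side[OF rep x y(1)] .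
    then have "orth_proj ?T (y - x) = t *\<^sub>R orth_proj ?T w"
      by (simp add: orth_proj_eq_iff[OF sT, symmetric] linear_scale[OF linear_orth_proj[OF sT]])
    moreover have "t \<noteq> 0" using calculation nz by auto
    ultimately show ?thesis using t by (intro exI[of _ t]) auto
  qed
  obtain t where t1: "t > 0" "orth_proj ?T (y - x) = t *\<^sub>R orth_proj ?T v"
    using pos[OF assms(1)] by (elim exE conjE)
  obtain t' where t2: "t' > 0" "orth_proj ?T (y - x) = t' *\<^sub>R orth_proj ?T v'"
    using pos[OF assms(2)] by (elim exE conjE)
  note t = t1 t2
  have "orth_proj ?T v = (1 / t) *\<^sub>R (t *\<^sub>R orth_proj ?T v)" using t(1) by simp
  also have "\<dots> = (t' / t) *\<^sub>R orth_proj ?T v'" by (simp add: t(2)[symmetric] t(4))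
  finally have "orth_proj ?T v = orth_proj ?T v'"
    by (rule primitive_mod_unique[rotated 2])
      (use t represents_normal_primitive[OF assms(1,3,4)] represents_normal_primitive[OF assms(2,3,4)] in auto)
  then show ?thesis by (simp add: orth_proj_eq_iff sT)
qed

subsection \<open>Weights of points and germs of weights\<close>

text \<open>In a polyhedral complex the sum has at most one term, since relative interiors of
  different cells are disjoint, and it is 0 off the relative interiors of maximal cells. Written as
  a sum it requires no choice of a cell.\<close>

definition point_weight :: "'n::finite weighted_complex \<Rightarrow> real^'n \<Rightarrow> int" where
  "point_weight A x = (\<Sum>\<sigma>\<in>{\<sigma>\<in>max_cells A. x \<in> rel_interior \<sigma>}. weight A \<sigma>)"

definition generically_equal :: "'n::finite weighted_complex \<Rightarrow> 'n weighted_complex \<Rightarrow> bool" where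
  "generically_equal A B \<longleftrightarrow> dimension A = dimension B \<and>
     (\<exists>F. finite F \<and> (\<forall>S\<in>F. affine S \<and> aff_dim S < dimension A) \<and>
          (\<forall>x. (\<forall>S\<in>F. x \<notin> S) \<longrightarrow> point_weight A x = point_weight B x))"

lemma generically_equal_sym: "generically_equal A B \<Longrightarrow> generically_equal B A"
  unfolding generically_equal_def by metis

lemma generically_equal_trans:
  assumes "generically_equal A B" "generically_equal B C"
  shows "generically_equal A C"
proof -
  obtain F G where
    "finite F" "\<forall>S\<in>F. affine S \<and> aff_dim S < dimension A"
    "\<forall>x. (\<forall>S\<in>F. x \<notin> S) \<longrightarrow> point_weight A x = point_weight B x"
    "finite G" "\<forall>S\<in>G. affine S \<and> aff_dim S < dimension A"
    "\<forall>x. (\<forall>S\<in>G. x \<notin> S) \<longrightarrow> point_weight B x = point_weight C x"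
    using assms unfolding generically_equal_def by metis
  then show ?thesis
    using assms unfolding generically_equal_def by (auto intro!: exI[of _ "F \<union> G"])
qed

lemma max_cells_iff: "\<sigma> \<in> max_cells A \<longleftrightarrow> \<sigma> \<in> cells A \<and> aff_dim \<sigma> = dimension A"
  by (auto simp: max_cells_def cells_of_dim_def)

lemma supp_cells_iff: "\<sigma> \<in> supp_cells A \<longleftrightarrow> \<sigma> \<in> cells A \<and> aff_dim \<sigma> = dimension A \<and> weight A \<sigma> \<noteq> 0"
  by (auto simp: supp_cells_def max_cells_iff)

definition local_cells :: "'n::finite weighted_complex \<Rightarrow> real^'n \<Rightarrow> real^'n \<Rightarrow> (real^'n) set set" where
  "local_cells A x u = {\<sigma>\<in>max_cells A. \<forall>\<^sub>F t in at_right 0. x + t *\<^sub>R u \<in> rel_interior \<sigma>}"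

definition local_weight :: "'n::finite weighted_complex \<Rightarrow> real^'n \<Rightarrow> real^'n \<Rightarrow> int" where
  "local_weight A x u = (\<Sum>\<sigma>\<in>local_cells A x u. weight A \<sigma>)"

text \<open>The restriction to nonzero weights keeps the index set finite at relatively interior
  points of codimension one cells, where primitive directions alone may be infinitely many.
  \<open>g\<close> is the identity for balancing and the right derivative of \<open>\<phi>\<close>
  for divisors.\<close>

definition local_sum ::
    "'n::finite weighted_complex \<Rightarrow> real^'n \<Rightarrow> (real^'n) set \<Rightarrow> (real^'n \<Rightarrow> 'b::real_vector) \<Rightarrow> 'b" where
  "local_sum A x T g =
     (\<Sum>u\<in>{u. primitive_mod T u \<and> local_weight A x u \<noteq> 0}. of_int (local_weight A x u) *\<^sub>R g u)"

text \<open>A ray meets a convex set in an interval, so meeting it at arbitrarily small parameters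
  forces containment of an initial piece.\<close>

lemma convex_germ:
  fixes C :: "'a::real_vector set"
  assumes "convex C"
  shows "(\<forall>\<^sub>F t in at_right (0::real). x + t *\<^sub>R u \<in> C) \<or> (\<forall>\<^sub>F t in at_right (0::real). x + t *\<^sub>R u \<notin> C)"
proof (rule disjCI)
  assume "\<not> (\<forall>\<^sub>F t in at_right (0::real). x + t *\<^sub>R u \<notin> C)"
  then have ex: "\<exists>t>0. t < e \<and> x + t *\<^sub>R u \<in> C" if "e > 0" for e :: real
    using that unfolding eventually_at_right_field by auto
  obtain s where s: "s > 0" "x + s *\<^sub>R u \<in> C" using ex[of 1] by auto
  have "x + t *\<^sub>R u \<in> C" if t: "0 < t" "t < s" for t
  proof -
    obtain r where r: "r > 0" "r < t" "x + r *\<^sub>R u \<in> C" using ex[OF t(1)] by auto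
    define l where "l = (t - r) / (s - r)"
    have l: "0 \<le> l" "l \<le> 1" "l * (s - r) = t - r" using r t by (auto simp: l_def)
    have "(1 - l) *\<^sub>R (x + r *\<^sub>R u) + l *\<^sub>R (x + s *\<^sub>R u) \<in> C"
      using assms r s l by (auto simp: convex_alt)
    also have "(1 - l) *\<^sub>R (x + r *\<^sub>R u) + l *\<^sub>R (x + s *\<^sub>R u) = x + (r + l * (s - r)) *\<^sub>R u"
      by (simp add: algebra_simps)
    finally show ?thesis using l by simp
  qed
  then show "\<forall>\<^sub>F t in at_right (0::real). x + t *\<^sub>R u \<in> C"
    unfolding eventually_at_right_field using s by blast
qed

locale weighted_polyhedral_complex =
  fixes A :: "'n::finite weighted_complex"
  assumes complex: "polyhedral_complex (cells A)"
begin

lemma finite_max_cells: "finite (max_cells A)"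
  using complex_finite[OF complex] by (auto simp: max_cells_def cells_of_dim_def)

lemma point_weight_rel_interior:
  assumes "\<sigma> \<in> max_cells A" "x \<in> rel_interior \<sigma>"
  shows "point_weight A x = weight A \<sigma>"
proof -
  have "{\<sigma>'\<in>max_cells A. x \<in> rel_interior \<sigma>'} = {\<sigma>}"
    using assms complex_eq_if_rel_interior[OF complex] by (auto simp: max_cells_iff)
  then show ?thesis by (simp add: point_weight_def)
qed

lemma point_weight_nonzero:
  assumes "point_weight A x \<noteq> 0"
  obtains \<sigma> where "\<sigma> \<in> supp_cells A" "x \<in> rel_interior \<sigma>" "point_weight A x = weight A \<sigma>"
proof -
  have "\<exists>\<sigma>\<in>max_cells A. x \<in> rel_interior \<sigma>"
  proof (rule ccontr)
    assume "\<not> (\<exists>\<sigma>\<in>max_cells A. x \<in> rel_interior \<sigma>)"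
    then have "{\<sigma>'\<in>max_cells A. x \<in> rel_interior \<sigma>'} = {}" by auto
    then show False using assms by (simp only: point_weight_def sum.empty)
  qed
  then obtain \<sigma> where "\<sigma> \<in> max_cells A" "x \<in> rel_interior \<sigma>" by auto
  with point_weight_rel_interior[OF this] assms that show thesis by (auto simp: supp_cells_def)
qed

lemma eventually_local_cells:
  "\<forall>\<^sub>F t in at_right 0. \<forall>\<sigma>\<in>max_cells A. x + t *\<^sub>R u \<in> rel_interior \<sigma> \<longleftrightarrow> \<sigma> \<in> local_cells A x u"
proof (rule eventually_ball_finite[OF finite_max_cells], rule ballI)
  fix \<sigma> assume s: "\<sigma> \<in> max_cells A"
  have conv: "convex (rel_interior \<sigma>)"
    using s complex_convex[OF complex] by (intro convex_rel_interior) (auto simp: max_cells_iff)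
  show "\<forall>\<^sub>F t in at_right 0. x + t *\<^sub>R u \<in> rel_interior \<sigma> \<longleftrightarrow> \<sigma> \<in> local_cells A x u"
  proof (cases "\<sigma> \<in> local_cells A x u")
    case True
    then show ?thesis by (auto simp: local_cells_def elim: eventually_mono)
  next
    case False
    then have "\<forall>\<^sub>F t in at_right 0. x + t *\<^sub>R u \<notin> rel_interior \<sigma>"
      using convex_germ[OF conv, of x u] s by (auto simp: local_cells_def)
    then show ?thesis using False by (auto elim: eventually_mono)
  qed
qed

text \<open>Expresses the germ through values of \<open>point_weight\<close> at nearby points, which
  is all that generic equality controls.\<close>

lemma eventually_local_weight:
  "\<forall>\<^sub>F t in at_right 0. point_weight A (x + t *\<^sub>R u) = local_weight A x u"
  using eventually_local_cells[of x u]
proof eventually_elim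
  case (elim t)
  then have "{\<sigma>\<in>max_cells A. x + t *\<^sub>R u \<in> rel_interior \<sigma>} = local_cells A x u"
    by (auto simp: local_cells_def)
  then show ?case by (simp add: point_weight_def local_weight_def)
qed

lemma local_cells_unique:
  assumes "\<sigma> \<in> local_cells A x u" "\<sigma>' \<in> local_cells A x u"
  shows "\<sigma> = \<sigma>'"
proof -
  have "\<forall>\<^sub>F t in at_right 0. x + t *\<^sub>R u \<in> rel_interior \<sigma> \<and> x + t *\<^sub>R u \<in> rel_interior \<sigma>'"
    using assms by (auto simp: local_cells_def intro: eventually_conj)
  then obtain t where "x + t *\<^sub>R u \<in> rel_interior \<sigma>" "x + t *\<^sub>R u \<in> rel_interior \<sigma>'"
    using eventually_happens[of _ "at_right (0::real)"] trivial_limit_at_right_real by blast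
  then show ?thesis
    using assms complex_eq_if_rel_interior[OF complex] by (auto simp: local_cells_def max_cells_iff)
qed

lemma local_weight_local_cell:
  assumes "\<sigma> \<in> local_cells A x u"
  shows "local_weight A x u = weight A \<sigma>"
proof -
  have "local_cells A x u = {\<sigma>}" using assms local_cells_unique by auto
  then show ?thesis by (simp add: local_weight_def)
qed

lemma local_weight_nonzero:
  assumes "local_weight A x u \<noteq> 0"
  obtains \<sigma> where "\<sigma> \<in> local_cells A x u"
  using assms by (auto simp: local_weight_def intro: that) (metis all_not_in_conv sum.empty)

lemma local_cell_contains:
  assumes "\<sigma> \<in> local_cells A x u"
  shows "x \<in> \<sigma>"
proof -
  have cl: "closed \<sigma>" using assms complex_closed[OF complex] by (auto simp: local_cells_def max_cells_iff)
  have ev: "\<forall>\<^sub>F t in at_right 0. x + t *\<^sub>R u \<in> \<sigma>"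
    using assms unfolding local_cells_def
    by (auto elim!: eventually_mono intro: subsetD[OF rel_interior_subset])
  have lim: "((\<lambda>t. x + t *\<^sub>R u) \<longlongrightarrow> x + 0 *\<^sub>R u) (at_right 0)" by (intro tendsto_intros)
  from Lim_in_closed_set[OF cl ev _ lim] show ?thesis by simp
qed

section \<open>Directions at a point of a codimension one cell\<close>

lemma facet_if_rel_interior:
  assumes "\<tau> \<in> cells A" "aff_dim \<tau> = dimension A - 1" "x \<in> rel_interior \<tau>" "\<sigma> \<in> max_cells A" "x \<in> \<sigma>"
  shows "\<tau> facet_of \<sigma>"
  using complex_face_if_rel_interior[OF complex assms(1) _ assms(3,5)] assms complex_nonempty[OF complex]
  by (auto simp: facet_of_def max_cells_iff)

text \<open>Write a relatively interior point \<open>y\<close> of \<open>\<sigma>\<close> as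
  \<open>x + q + t u\<close> with \<open>q\<close> in \<open>V_\<tau>\<close>. As \<open>x\<close>
  is relatively interior to \<open>\<tau>\<close>, a small opposite step \<open>x - d q\<close>
  stays in \<open>\<tau>\<close>, and a convex combination of the two points cancels
  \<open>q\<close>.\<close>

lemma normal_direction_local_cell:
  assumes "\<sigma> \<in> adjacent_cells A \<tau>" "represents_normal \<sigma> \<tau> v" "x \<in> rel_interior \<tau>"
  shows "\<sigma> \<in> local_cells A x (orth_proj (dir_space \<tau>) v)"
proof -
  let ?T = "dir_space \<tau>" and ?u = "orth_proj (dir_space \<tau>) v"
  note sT = subspace_dir_space[of \<tau>]
  have s: "\<sigma> \<in> max_cells A" "\<tau> facet_of \<sigma>" using assms(1) by (auto simp: adjacent_cells_def)
  have conv: "convex \<sigma>" using s complex_convex[OF complex] by (auto simp: max_cells_iff)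
  have ne: "\<sigma> \<noteq> {}" using s complex_nonempty[OF complex] by (auto simp: max_cells_iff)
  have sub: "\<tau> \<subseteq> \<sigma>" using s(2) by (rule facet_of_imp_subset)
  have xt: "x \<in> \<tau>" using assms(3) rel_interior_subset by auto
  obtain y where y: "y \<in> rel_interior \<sigma>" using ne conv rel_interior_eq_empty by auto
  have ys: "y \<in> \<sigma>" using y rel_interior_subset by auto
  have "y \<notin> \<tau>"
  proof
    assume "y \<in> \<tau>"
    moreover have "\<tau> \<noteq> \<sigma>" using s(2) facet_of_irrefl by metis
    ultimately show False
      using face_of_disjoint_rel_interior[OF facet_of_imp_face_of[OF s(2)]] y by auto
  qed
  obtain t where t: "t \<ge> 0" "y - x - t *\<^sub>R v \<in> ?T"
    using represents_normal_side[OF assms(2) xt ys] .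
  have "(y - x - t *\<^sub>R v) + t *\<^sub>R (v - ?u) \<in> ?T"
    by (intro subspace_add[OF sT] subspace_scale[OF sT] t(2) orth_proj_diff[OF sT])
  then have s': "y - x - t *\<^sub>R ?u \<in> ?T" (is "?s \<in> _") by (simp add: algebra_simps)
  have "t \<noteq> 0"
  proof
    assume "t = 0"
    then have "y - x \<in> ?T" using s' by simp
    then show False using facet_affine_hull_Int[OF conv s(2) ys xt] \<open>y \<notin> \<tau>\<close> by auto
  qed
  then have tpos: "t > 0" using t(1) by simp
  have "x + ?s \<in> affine hull \<tau>" using s' by (simp only: mem_affine_hull_iff_dir_space[OF xt] add_diff_cancel_left')
  then obtain m where m: "m > 1" "\<forall>e. e > 1 \<and> e \<le> m \<longrightarrow> (1 - e) *\<^sub>R (x + ?s) + e *\<^sub>R x \<in> \<tau>"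
    using convex_rel_interior_if[OF face_of_imp_convex[OF facet_of_imp_face_of[OF s(2)]] assms(3)] by blast
  have in_tau: "x - d *\<^sub>R ?s \<in> \<tau>" if "0 < d" "d \<le> m - 1" for d
  proof -
    have "(1 - (1 + d)) *\<^sub>R (x + ?s) + (1 + d) *\<^sub>R x \<in> \<tau>" using m that by (intro m(2)[rule_format]) auto
    then show ?thesis by (simp add: algebra_simps)
  qed
  \<comment> \<open>The value \<open>d = h / (1 - h)\<close> solves \<open>(1 - h) d = h\<close>, so
    the multiples of \<open>q\<close> cancel when \<open>x - d q\<close> and \<open>y\<close> are
    combined with weights \<open>1 - h\<close> and \<open>h\<close>.\<close>
  have key: "x + (h * t) *\<^sub>R ?u \<in> rel_interior \<sigma>" if h: "0 < h" "h < 1" "h / (1 - h) \<le> m - 1" for h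
  proof -
    define q where "q = ?s"
    have yq: "y = x + q + t *\<^sub>R ?u" by (simp add: q_def)
    have p: "x - (h / (1 - h)) *\<^sub>R q \<in> \<sigma>" (is "?p \<in> _")
      using in_tau[of "h / (1 - h)"] sub h by (auto simp: q_def)
    have "?p - h *\<^sub>R (?p - y) \<in> rel_interior \<sigma>"
      by (rule rel_interior_convex_shrink[OF conv y p]) (use h in auto)
    also have "?p - h *\<^sub>R (?p - y) = (1 - h) *\<^sub>R ?p + h *\<^sub>R y"
    proof -
      have "p' - h *\<^sub>R (p' - y) = (1 - h) *\<^sub>R p' + h *\<^sub>R y" for p'
        by (simp add: algebra_simps)
      then show ?thesis .
    qed
    also have "(1 - h) *\<^sub>R ?p = (1 - h) *\<^sub>R x - h *\<^sub>R q"
    proof -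
      have "(1 - h) * (h / (1 - h)) = h" using h by simp
      then show ?thesis by (simp only: scaleR_diff_right scaleR_scaleR)
    qed
    also have "\<dots> + h *\<^sub>R y = x + (h * t) *\<^sub>R ?u" by (simp add: yq algebra_simps)
    finally show ?thesis .
  qed
  have "\<forall>\<^sub>F h in at_right (0::real). h / t / (1 - h / t) < m - 1"
  proof (rule order_tendstoD(2))
    show "((\<lambda>h. h / t / (1 - h / t)) \<longlongrightarrow> 0 / t / (1 - 0 / t)) (at_right 0)"
      by (intro tendsto_intros) (use tpos in auto)
  qed (use m in auto)
  moreover have "\<forall>\<^sub>F h in at_right (0::real). h \<in> {0<..<t}"
    by (rule eventually_at_right_real) (rule tpos)
  ultimately have "\<forall>\<^sub>F h in at_right (0::real). x + h *\<^sub>R ?u \<in> rel_interior \<sigma>"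
  proof eventually_elim
    case (elim h)
    have "x + (h / t * t) *\<^sub>R ?u \<in> rel_interior \<sigma>"
      by (rule key) (use elim tpos in auto)
    then show ?case using tpos by simp
  qed
  then show ?thesis using s by (simp add: local_cells_def)
qed

text \<open>By the side condition of the normal vector, \<open>u\<close> is a positive multiple of
  the projected normal, and two primitive vectors on one ray agree. This is the converse of
  \<open>normal_direction_local_cell\<close>.\<close>

lemma local_cell_adjacent:
  assumes "\<tau> \<in> cells A" "aff_dim \<tau> = dimension A - 1" "x \<in> rel_interior \<tau>"
    and "primitive_mod (dir_space \<tau>) u" "\<sigma> \<in> local_cells A x u"
  shows "\<sigma> \<in> adjacent_cells A \<tau>" "u = orth_proj (dir_space \<tau>) (normal_vec \<sigma> \<tau>)"
proof -
  let ?T = "dir_space \<tau>"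
  note sT = subspace_dir_space[of \<tau>]
  have s: "\<sigma> \<in> max_cells A" using assms(5) by (simp add: local_cells_def)
  have facet: "\<tau> facet_of \<sigma>"
    by (rule facet_if_rel_interior[OF assms(1-3) s local_cell_contains[OF assms(5)]])
  show "\<sigma> \<in> adjacent_cells A \<tau>" using s facet by (simp add: adjacent_cells_def)
  have rep: "represents_normal \<sigma> \<tau> (normal_vec \<sigma> \<tau>)" (is "represents_normal _ _ ?v")
    by (rule represents_normal_normal_vec[OF complex _ assms(1) facet]) (use s in \<open>simp add: max_cells_iff\<close>)
  have conv: "convex \<sigma>" using s complex_convex[OF complex] by (auto simp: max_cells_iff)
  have "\<forall>\<^sub>F h in at_right (0::real). h > 0 \<and> x + h *\<^sub>R u \<in> rel_interior \<sigma>"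
    using assms(5) by (auto simp: local_cells_def eventually_at_right_less intro: eventually_conj)
  then obtain h where h: "h > 0" "x + h *\<^sub>R u \<in> rel_interior \<sigma>"
    using eventually_happens[of _ "at_right (0::real)"] trivial_limit_at_right_real by blast
  have "x + h *\<^sub>R u \<in> \<sigma>" "x \<in> \<tau>" using h assms(3) rel_interior_subset by auto
  with represents_normal_side[OF rep]
  obtain t where t: "t \<ge> 0" "(x + h *\<^sub>R u) - x - t *\<^sub>R ?v \<in> ?T" by metis
  then have "orth_proj ?T (h *\<^sub>R u) = orth_proj ?T (t *\<^sub>R ?v)" by (simp add: orth_proj_eq_iff sT)
  then have "h *\<^sub>R orth_proj ?T u = t *\<^sub>R orth_proj ?T ?v"
    by (simp add: linear_scale[OF linear_orth_proj[OF sT]])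
  moreover have "orth_proj ?T u = u"
    by (rule orth_proj_unique[OF sT]) (use primitive_mod_orthogonal[OF assms(4) sT] subspace_0[OF sT] in auto)
  ultimately have eq: "h *\<^sub>R u = t *\<^sub>R orth_proj ?T ?v" by simp
  have "u \<noteq> 0" using assms(4) by (simp add: primitive_mod_def)
  then have "t \<noteq> 0" using eq h by auto
  have "u = (1 / h) *\<^sub>R (h *\<^sub>R u)" using h by simp
  also have "\<dots> = (t / h) *\<^sub>R orth_proj ?T ?v" by (simp add: eq)
  finally show "u = orth_proj ?T ?v"
    by (rule primitive_mod_unique[OF assms(4) represents_normal_primitive[OF rep facet conv]])
      (use h t \<open>t \<noteq> 0\<close> in auto)
qed

text \<open>Adjacent cells of nonzero weight correspond bijectively to primitive directions of
  nonzero local weight. The left-hand side involves \<open>\<tau>\<close> only through its direction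
  space, so it can be formed for another complex at the same point.\<close>

lemma local_sum_codim1:
  assumes "\<tau> \<in> cells A" "aff_dim \<tau> = dimension A - 1" "x \<in> rel_interior \<tau>"
  shows "local_sum A x (dir_space \<tau>) g =
    (\<Sum>\<sigma>\<in>adjacent_cells A \<tau>. of_int (weight A \<sigma>) *\<^sub>R g (orth_proj (dir_space \<tau>) (normal_vec \<sigma> \<tau>)))"
proof -
  let ?p = "\<lambda>\<sigma>. orth_proj (dir_space \<tau>) (normal_vec \<sigma> \<tau>)"
  let ?S = "{\<sigma>\<in>adjacent_cells A \<tau>. weight A \<sigma> \<noteq> 0}"
  have fin: "finite (adjacent_cells A \<tau>)" using finite_max_cells by (simp add: adjacent_cells_def)
  have rep: "represents_normal \<sigma> \<tau> (normal_vec \<sigma> \<tau>)" if "\<sigma> \<in> adjacent_cells A \<tau>" for \<sigma>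
    using that represents_normal_normal_vec[OF complex _ assms(1)] by (auto simp: adjacent_cells_def max_cells_iff)
  have loc: "\<sigma> \<in> local_cells A x (?p \<sigma>)" if "\<sigma> \<in> adjacent_cells A \<tau>" for \<sigma>
    using normal_direction_local_cell[OF that rep[OF that] assms(3)] .
  have prim: "primitive_mod (dir_space \<tau>) (?p \<sigma>)" if "\<sigma> \<in> adjacent_cells A \<tau>" for \<sigma>
    by (rule represents_normal_primitive[OF rep[OF that]])
      (use that complex_convex[OF complex] in \<open>auto simp: adjacent_cells_def max_cells_iff\<close>)
  have img: "{u. primitive_mod (dir_space \<tau>) u \<and> local_weight A x u \<noteq> 0} = ?p ` ?S"
  proof (intro equalityI subsetI)
    fix u assume "u \<in> {u. primitive_mod (dir_space \<tau>) u \<and> local_weight A x u \<noteq> 0}"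
    then have u: "primitive_mod (dir_space \<tau>) u" "local_weight A x u \<noteq> 0" by auto
    obtain \<sigma> where "\<sigma> \<in> local_cells A x u" using local_weight_nonzero[OF u(2)] .
    then show "u \<in> ?p ` ?S"
      using local_cell_adjacent[OF assms u(1)] local_weight_local_cell u(2) by force
  next
    fix u assume "u \<in> ?p ` ?S"
    then show "u \<in> {u. primitive_mod (dir_space \<tau>) u \<and> local_weight A x u \<noteq> 0}"
      using prim loc local_weight_local_cell by force
  qed
  have inj: "inj_on ?p ?S"
    by (rule inj_onI) (metis (mono_tags, lifting) loc local_cells_unique mem_Collect_eq)
  have "local_sum A x (dir_space \<tau>) g = (\<Sum>\<sigma>\<in>?S. of_int (local_weight A x (?p \<sigma>)) *\<^sub>R g (?p \<sigma>))"
    unfolding local_sum_def img by (simp add: sum.reindex[OF inj])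
  also have "\<dots> = (\<Sum>\<sigma>\<in>?S. of_int (weight A \<sigma>) *\<^sub>R g (?p \<sigma>))"
    by (rule sum.cong) (auto simp: local_weight_local_cell[OF loc])
  also have "\<dots> = (\<Sum>\<sigma>\<in>adjacent_cells A \<tau>. of_int (weight A \<sigma>) *\<^sub>R g (?p \<sigma>))"
    by (rule sum.mono_neutral_left) (use fin in auto)
  finally show ?thesis .
qed

text \<open>No lower cell passes through \<open>x\<close>, so the smallest face of
  \<open>\<sigma>\<close> through \<open>x\<close> is \<open>\<sigma>\<close> itself. Hence
  \<open>x\<close> is relatively interior and a segment leaving \<open>x\<close> can be prolonged
  backwards.\<close>

lemma local_cell_minus:
  assumes low: "\<And>\<tau>. \<tau> \<in> cells A \<Longrightarrow> x \<in> \<tau> \<Longrightarrow> aff_dim \<tau> \<ge> dimension A"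
    and s: "\<sigma> \<in> local_cells A x u"
  shows "\<sigma> \<in> local_cells A x (- u)"
proof -
  have sm: "\<sigma> \<in> max_cells A" using s by (simp add: local_cells_def)
  have xs: "x \<in> \<sigma>" by (rule local_cell_contains[OF s])
  have conv: "convex \<sigma>" using sm complex_convex[OF complex] by (auto simp: max_cells_iff)
  obtain \<rho> where \<rho>: "\<rho> \<in> cells A" "\<rho> face_of \<sigma>" "x \<in> rel_interior \<rho>"
    using complex_point_in_rel_interior[OF complex _ xs] sm by (auto simp: max_cells_iff)
  have "aff_dim \<rho> \<ge> dimension A" using low \<rho> rel_interior_subset by blast
  then have "\<rho> = \<sigma>" using face_of_aff_dim_lt[OF conv \<rho>(2)] sm by (force simp: max_cells_iff)
  then have xr: "x \<in> rel_interior \<sigma>" using \<rho> by simp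
  obtain h where h: "h > 0" "x + h *\<^sub>R u \<in> \<sigma>"
  proof -
    have "\<forall>\<^sub>F h in at_right (0::real). h > 0 \<and> x + h *\<^sub>R u \<in> rel_interior \<sigma>"
      using s by (auto simp: local_cells_def eventually_at_right_less intro: eventually_conj)
    then obtain h where "h > 0" "x + h *\<^sub>R u \<in> rel_interior \<sigma>"
      using eventually_happens[of _ "at_right (0::real)"] trivial_limit_at_right_real by blast
    then show thesis using that rel_interior_subset by blast
  qed
  obtain e where e: "e > 1" "(1 - e) *\<^sub>R (x + h *\<^sub>R u) + e *\<^sub>R x \<in> \<sigma>"
    using convex_rel_interior_iff[OF conv] xr xs h by blast
  have "(1 - e) *\<^sub>R (x + h *\<^sub>R u) + e *\<^sub>R x = x - ((e - 1) * h) *\<^sub>R u" by (simp add: algebra_simps)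
  then have y: "x - ((e - 1) * h) *\<^sub>R u \<in> \<sigma>" using e by simp
  define r where "r = (e - 1) * h"
  have r: "r > 0" using e h by (simp add: r_def)
  have "x + t *\<^sub>R (- u) \<in> rel_interior \<sigma>" if t: "0 < t" "t < r" for t
  proof -
    have "(x - r *\<^sub>R u) - (1 - t / r) *\<^sub>R ((x - r *\<^sub>R u) - x) \<in> rel_interior \<sigma>"
      by (rule rel_interior_convex_shrink[OF conv xr]) (use y t in \<open>auto simp: r_def[symmetric]\<close>)
    also have "(x - r *\<^sub>R u) - (1 - t / r) *\<^sub>R ((x - r *\<^sub>R u) - x) = x - (r * (t / r)) *\<^sub>R u"
      by (simp add: algebra_simps)
    finally show ?thesis using r by simp
  qed
  then have "\<forall>\<^sub>F t in at_right 0. x + t *\<^sub>R (- u) \<in> rel_interior \<sigma>"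
    unfolding eventually_at_right_field using r by blast
  then show ?thesis using sm by (simp add: local_cells_def)
qed

text \<open>Reflection \<open>u \<mapsto> - u\<close> permutes the index set, preserves the weights
  and negates \<open>g\<close>, so the sum equals its own negative. This treats points that lie on a
  codimension one cell of the other complex only.\<close>

lemma local_sum_top:
  fixes g :: "real^'n \<Rightarrow> 'b::real_vector"
  assumes low: "\<And>\<tau>. \<tau> \<in> cells A \<Longrightarrow> x \<in> \<tau> \<Longrightarrow> aff_dim \<tau> \<ge> dimension A"
    and T: "subspace T"
    and g: "\<And>u \<sigma>. \<sigma> \<in> local_cells A x u \<Longrightarrow> g (- u) = - g u"
  shows "local_sum A x T g = 0"
proof -
  let ?U = "{u. primitive_mod T u \<and> local_weight A x u \<noteq> 0}"
  have lw: "local_weight A x (- u) = local_weight A x u \<and> g (- u) = - g u" if nz: "local_weight A x u \<noteq> 0" for u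
  proof -
    obtain \<sigma> where "\<sigma> \<in> local_cells A x u" using local_weight_nonzero[OF nz] .
    then show ?thesis using local_cell_minus[OF low] g local_weight_local_cell by metis
  qed
  have img: "uminus ` ?U = ?U"
  proof -
    have "- u \<in> ?U" if "u \<in> ?U" for u using that lw primitive_mod_minus[OF T] by auto
    then show ?thesis by (force intro: image_eqI[of _ uminus "- _"])
  qed
  have "local_sum A x T g = (\<Sum>u\<in>uminus ` ?U. of_int (local_weight A x u) *\<^sub>R g u)"
    unfolding img by (simp add: local_sum_def)
  also have "\<dots> = (\<Sum>u\<in>?U. of_int (local_weight A x (- u)) *\<^sub>R g (- u))"
    by (subst sum.reindex) (auto simp: inj_on_def)
  also have "\<dots> = (\<Sum>u\<in>?U. - (of_int (local_weight A x u) *\<^sub>R g u))"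
    by (rule sum.cong) (auto simp: lw)
  also have "\<dots> = - local_sum A x T g" by (simp add: local_sum_def sum_negf)
  finally have "local_sum A x T g = - local_sum A x T g" .
  then have "2 *\<^sub>R local_sum A x T g = 0" by (metis scaleR_2 add.left_inverse)
  then show ?thesis by simp
qed

end

subsection \<open>Transfer along generic equality\<close>

text \<open>Affine hulls are taken because \<open>F\<close> will contain both exceptional affine
  subspaces and cells of a complex.\<close>

definition generic_in :: "(real^'n) set set \<Rightarrow> (real^'n) set \<Rightarrow> real^'n \<Rightarrow> bool" where
  "generic_in F \<tau> x \<longleftrightarrow> x \<in> rel_interior \<tau> \<and> (\<forall>S\<in>F. x \<in> affine hull S \<longrightarrow> \<tau> \<subseteq> affine hull S)"

lemma generic_in_exists:
  fixes \<tau> :: "(real^'n) set"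
  assumes "convex \<tau>" "\<tau> \<noteq> {}" "finite F"
  shows "\<exists>x. generic_in F \<tau> x"
proof -
  have "\<exists>x\<in>rel_interior \<tau>. \<forall>T\<in>{affine hull S | S. S \<in> F \<and> \<not> \<tau> \<subseteq> affine hull S}. x \<notin> T"
    by (rule generic_point_exists[OF assms(1,2)]) (use assms(3) in auto)
  then show ?thesis unfolding generic_in_def by auto
qed

lemma generic_in_mono: "generic_in F \<tau> x \<Longrightarrow> G \<subseteq> F \<Longrightarrow> generic_in G \<tau> x"
  unfolding generic_in_def by auto

text \<open>Exceptional subspaces that miss \<open>x\<close> are avoided nearby. One through
  \<open>x\<close> contains \<open>\<tau>\<close> by genericity, hence is its affine hull by
  dimension, and the ray leaves it at once because \<open>u\<close> is orthogonal to
  \<open>V_\<tau>\<close>.\<close>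

lemma local_weight_generic:
  fixes A B :: "'n::finite weighted_complex"
  assumes A: "weighted_polyhedral_complex A" and B: "weighted_polyhedral_complex B"
    and F: "finite F" "\<forall>S\<in>F. affine S \<and> aff_dim S < dimension A"
    and pw: "\<forall>x. (\<forall>S\<in>F. x \<notin> S) \<longrightarrow> point_weight A x = point_weight B x"
    and tau: "aff_dim \<tau> = dimension A - 1" and x: "generic_in F \<tau> x"
    and u: "u \<noteq> 0" "\<And>t. t \<in> dir_space \<tau> \<Longrightarrow> u \<bullet> t = 0"
  shows "local_weight A x u = local_weight B x u"
proof -
  have xt: "x \<in> \<tau>" using x rel_interior_subset by (auto simp: generic_in_def)
  have "\<forall>\<^sub>F t in at_right (0::real). \<forall>S\<in>F. x + t *\<^sub>R u \<notin> S"
  proof (rule eventually_ball_finite[OF F(1)], rule ballI)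
    fix S assume S: "S \<in> F"
    then have aff: "affine S" "aff_dim S < dimension A" using F(2) by auto
    show "\<forall>\<^sub>F t in at_right (0::real). x + t *\<^sub>R u \<notin> S"
    proof (cases "x \<in> S")
      case False
      have "((\<lambda>t. x + t *\<^sub>R u) \<longlongrightarrow> x + 0 *\<^sub>R u) (at_right 0)" by (intro tendsto_intros)
      moreover have "open (- S)" using affine_closed[OF aff(1)] by (simp add: open_Compl)
      ultimately have "\<forall>\<^sub>F t in at_right 0. x + t *\<^sub>R u \<in> - S"
        using False by (intro topological_tendstoD) auto
      then show ?thesis by simp
    next
      case True
      then have "\<tau> \<subseteq> affine hull S" using x S hull_inc[OF True, of affine] by (auto simp: generic_in_def)
      moreover have "aff_dim S \<le> aff_dim \<tau>" using aff(2) tau by simp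
      ultimately have "affine hull \<tau> = affine hull S" by (rule affine_hull_eq_if_subset)
      then have hull: "affine hull \<tau> = S" using aff(1) by (simp add: affine_hull_eq)
      have "x + t *\<^sub>R u \<notin> S" if "t > 0" for t
      proof
        assume "x + t *\<^sub>R u \<in> S"
        then have "t *\<^sub>R u \<in> dir_space \<tau>"
          unfolding hull[symmetric] mem_affine_hull_iff_dir_space[OF xt] by simp
        then have "u \<bullet> (t *\<^sub>R u) = 0" by (rule u(2))
        then show False using u(1) that by simp
      qed
      then show ?thesis using eventually_at_right_less[of "0::real"] by (auto elim: eventually_mono)
    qed
  qed
  then have "\<forall>\<^sub>F t in at_right (0::real). local_weight A x u = local_weight B x u"
    using weighted_polyhedral_complex.eventually_local_weight[OF A, of x u]
      weighted_polyhedral_complex.eventually_local_weight[OF B, of x u]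
    by eventually_elim (use pw in auto)
  then show ?thesis by simp
qed

lemma local_sum_generic:
  fixes A B :: "'n::finite weighted_complex"
  assumes "weighted_polyhedral_complex A" "weighted_polyhedral_complex B"
    and "finite F" "\<forall>S\<in>F. affine S \<and> aff_dim S < dimension A"
    and "\<forall>x. (\<forall>S\<in>F. x \<notin> S) \<longrightarrow> point_weight A x = point_weight B x"
    and "aff_dim \<tau> = dimension A - 1" "generic_in F \<tau> x"
  shows "local_sum A x (dir_space \<tau>) g = local_sum B x (dir_space \<tau>) g"
proof -
  have eq: "local_weight A x u = local_weight B x u" if "primitive_mod (dir_space \<tau>) u" for u
    by (rule local_weight_generic[OF assms])
      (use that primitive_mod_orthogonal[OF that subspace_dir_space] in \<open>auto simp: primitive_mod_def\<close>)
  show ?thesis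
    unfolding local_sum_def by (rule sum.cong) (auto simp: eq)
qed

context weighted_polyhedral_complex
begin

text \<open>If \<open>x\<close> lies on a lower cell, take the smallest face through
  \<open>x\<close>. By genericity its affine hull contains \<open>\<tau>\<close>, so it has the
  dimension of \<open>\<tau>\<close> and the hulls coincide; still smaller cells cannot pass through
  \<open>x\<close>.\<close>

lemma generic_cell_cases:
  assumes x: "generic_in F \<tau> x" and F: "cells A \<subseteq> F" and tau: "aff_dim \<tau> = dimension A - 1"
  obtains (top) "\<And>\<eta>. \<eta> \<in> cells A \<Longrightarrow> x \<in> \<eta> \<Longrightarrow> aff_dim \<eta> \<ge> dimension A"
  | (codim1) \<eta> where "\<eta> \<in> cells A" "aff_dim \<eta> = dimension A - 1" "x \<in> rel_interior \<eta>"
      "dir_space \<eta> = dir_space \<tau>"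
proof (cases "\<forall>\<eta>\<in>cells A. x \<in> \<eta> \<longrightarrow> aff_dim \<eta> \<ge> dimension A")
  case True
  then show thesis using top by auto
next
  case False
  then obtain \<eta> where \<eta>: "\<eta> \<in> cells A" "x \<in> \<eta>" "aff_dim \<eta> < dimension A" by auto
  obtain \<rho> where \<rho>: "\<rho> \<in> cells A" "\<rho> face_of \<eta>" "x \<in> rel_interior \<rho>"
    using complex_point_in_rel_interior[OF complex \<eta>(1,2)] .
  have "aff_dim \<rho> \<le> aff_dim \<eta>" using face_of_imp_subset[OF \<rho>(2)] by (rule aff_dim_subset)
  then have le: "aff_dim \<rho> \<le> aff_dim \<tau>" using \<eta> tau by simp
  have "x \<in> affine hull \<rho>" using hull_inc[OF subsetD[OF rel_interior_subset \<rho>(3)]] .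
  then have sub: "\<tau> \<subseteq> affine hull \<rho>" using x \<rho>(1) F by (auto simp: generic_in_def)
  have hull: "affine hull \<tau> = affine hull \<rho>" using affine_hull_eq_if_subset[OF sub le] .
  then have "aff_dim \<rho> = dimension A - 1" using tau by (metis aff_dim_affine_hull)
  moreover have "dir_space \<rho> = dir_space \<tau>" using hull by (metis dir_space_affine_hull)
  ultimately show thesis using codim1 \<rho> by auto
qed

lemma orth_proj_normal_sum:
  assumes "\<tau> \<in> cells A" "aff_dim \<tau> = dimension A - 1" "x \<in> rel_interior \<tau>"
  shows "orth_proj (dir_space \<tau>) (normal_sum A \<tau>) = local_sum A x (dir_space \<tau>) (\<lambda>u. u)"
proof -
  have lin: "linear (orth_proj (dir_space \<tau>))" by (rule linear_orth_proj[OF subspace_dir_space])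
  show ?thesis
    unfolding local_sum_codim1[OF assms] normal_sum_def
    by (simp add: linear_sum[OF lin] linear_scale[OF lin])
qed

end

lemma generically_equalE:
  assumes "generically_equal A B"
  obtains F where "dimension A = dimension B" "finite F" "\<forall>S\<in>F. affine S \<and> aff_dim S < dimension A"
    "\<forall>x. (\<forall>S\<in>F. x \<notin> S) \<longrightarrow> point_weight A x = point_weight B x"
proof -
  note * = assms[unfolded generically_equal_def]
  from conjunct2[OF *] show thesis by (elim exE conjE) (rule that[OF conjunct1[OF *]])
qed

text \<open>At a generic point of \<open>\<tau>\<close> the local sum of \<open>B\<close> vanishes,
  by balancing of \<open>B\<close> or by reflection, and \<open>A\<close> has the same local sum.
  Serves for common refinements, for the fan as a subdivision of the whole space, and for divisors
  of arbitrary representatives.\<close>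

lemma balanced_transfer:
  fixes A B :: "'n::finite weighted_complex"
  assumes A: "weighted_polyhedral_complex A" and B: "tropical_complex B"
    and gen: "generically_equal A B"
    and tau: "\<tau> \<in> cells_of_dim (dimension A - 1) (cells A)"
  shows "normal_sum A \<tau> \<in> dir_space \<tau>"
proof -
  interpret A: weighted_polyhedral_complex A by fact
  interpret B: weighted_polyhedral_complex B
    using B by unfold_locales (simp add: tropical_complex_def)
  have bal: "normal_sum B \<eta> \<in> dir_space \<eta>" if "\<eta> \<in> cells B" "aff_dim \<eta> = dimension B - 1" for \<eta>
    using B that by (auto simp: tropical_complex_def cells_of_dim_def)
  obtain F where dim: "dimension A = dimension B" and F: "finite F"
      "\<forall>S\<in>F. affine S \<and> aff_dim S < dimension A"
      "\<forall>x. (\<forall>S\<in>F. x \<notin> S) \<longrightarrow> point_weight A x = point_weight B x"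
    by (rule generically_equalE[OF gen]) (rule that)
  have t: "\<tau> \<in> cells A" "aff_dim \<tau> = dimension A - 1" using tau by (auto simp: cells_of_dim_def)
  obtain x where x: "generic_in (F \<union> cells B) \<tau> x"
    using generic_in_exists[of \<tau> "F \<union> cells B"] complex_convex[OF A.complex t(1)]
      complex_nonempty[OF A.complex t(1)] F(1) complex_finite[OF B.complex] by auto
  have xr: "x \<in> rel_interior \<tau>" using x by (simp add: generic_in_def)
  have xF: "generic_in F \<tau> x" using x by (rule generic_in_mono) auto
  have "local_sum B x (dir_space \<tau>) (\<lambda>u. u) = 0"
  proof (rule B.generic_cell_cases[OF x])
    show "cells B \<subseteq> F \<union> cells B" by auto
    show "aff_dim \<tau> = dimension B - 1" using t dim by simp
  next
    assume "\<And>\<eta>. \<eta> \<in> cells B \<Longrightarrow> x \<in> \<eta> \<Longrightarrow> dimension B \<le> aff_dim \<eta>"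
    then show ?thesis by (rule B.local_sum_top) (auto intro: subspace_dir_space)
  next
    fix \<eta> assume \<eta>: "\<eta> \<in> cells B" "aff_dim \<eta> = dimension B - 1" "x \<in> rel_interior \<eta>"
        "dir_space \<eta> = dir_space \<tau>"
    show ?thesis
      using orth_proj_zero_iff[OF subspace_dir_space, THEN iffD2, OF bal[OF \<eta>(1,2)]]
        B.orth_proj_normal_sum[OF \<eta>(1-3)]
      unfolding \<eta>(4) by simp
  qed
  then have "orth_proj (dir_space \<tau>) (normal_sum A \<tau>) = 0"
    using local_sum_generic[OF A B.weighted_polyhedral_complex_axioms F t(2) xF]
      A.orth_proj_normal_sum[OF t xr] by metis
  then show ?thesis by (simp add: orth_proj_zero_iff subspace_dir_space)
qed

subsection \<open>Refinements and generic equality\<close>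

lemma tropical_complex_imp_wpc: "tropical_complex A \<Longrightarrow> weighted_polyhedral_complex A"
  by (simp add: tropical_complex_def weighted_polyhedral_complex_def)

context weighted_polyhedral_complex
begin

lemma off_low_cells_rel_interior:
  assumes off: "\<And>\<tau>. \<tau> \<in> cells A \<Longrightarrow> aff_dim \<tau> < dimension A \<Longrightarrow> x \<notin> affine hull \<tau>"
    and s: "\<sigma> \<in> max_cells A" "x \<in> \<sigma>"
  shows "x \<in> rel_interior \<sigma>"
proof -
  have sc: "\<sigma> \<in> cells A" "aff_dim \<sigma> = dimension A" using s by (auto simp: max_cells_iff)
  obtain \<rho> where \<rho>: "\<rho> \<in> cells A" "\<rho> face_of \<sigma>" "x \<in> rel_interior \<rho>"
    using complex_point_in_rel_interior[OF complex sc(1) s(2)] .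
  have "x \<in> affine hull \<rho>" using hull_inc[OF subsetD[OF rel_interior_subset \<rho>(3)]] .
  then have "\<not> aff_dim \<rho> < dimension A" using off \<rho> by auto
  then have "\<rho> = \<sigma>" using face_of_aff_dim_lt[OF complex_convex[OF complex sc(1)] \<rho>(2)] sc by auto
  then show ?thesis using \<rho> by simp
qed

lemma off_low_cells_point_weight:
  assumes "\<And>\<tau>. \<tau> \<in> cells A \<Longrightarrow> aff_dim \<tau> < dimension A \<Longrightarrow> x \<notin> affine hull \<tau>"
    and "\<sigma> \<in> max_cells A" "x \<in> \<sigma>"
  shows "point_weight A x = weight A \<sigma>"
  by (rule point_weight_rel_interior[OF assms(2) off_low_cells_rel_interior[OF assms]])

end

text \<open>Exceptional are the affine hulls of the lower-dimensional cells of both complexes;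
  elsewhere a point of a maximal cell is relatively interior to it. Stated for polyhedral complexes
  rather than for \<open>refines\<close>, so that it applies before \<open>B\<close> is known to be
  balanced.\<close>

lemma generically_equal_if_refined:
  fixes A B :: "'n::finite weighted_complex"
  assumes A: "weighted_polyhedral_complex A" and B: "weighted_polyhedral_complex B"
    and dim: "dimension B = dimension A"
    and supp: "\<Union>(supp_cells B) = \<Union>(supp_cells A)"
    and ref: "\<And>\<rho>. \<rho> \<in> supp_cells B \<Longrightarrow> \<exists>\<sigma>\<in>supp_cells A. \<rho> \<subseteq> \<sigma> \<and> weight B \<rho> = weight A \<sigma>"
  shows "generically_equal B A"
proof -
  interpret A: weighted_polyhedral_complex A by fact
  interpret B: weighted_polyhedral_complex B by fact
  define F where "F = (\<lambda>\<tau>. affine hull \<tau>) ` {\<tau> \<in> cells A \<union> cells B. aff_dim \<tau> < dimension A}"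
  have pw: "point_weight B x = point_weight A x" if off: "\<forall>S\<in>F. x \<notin> S" for x
  proof -
    have offA: "x \<notin> affine hull \<tau>" if "\<tau> \<in> cells A" "aff_dim \<tau> < dimension A" for \<tau>
      using off that unfolding F_def by auto
    have offB: "x \<notin> affine hull \<tau>" if "\<tau> \<in> cells B" "aff_dim \<tau> < dimension B" for \<tau>
      using off that dim unfolding F_def by auto
    show ?thesis
    proof (cases "x \<in> \<Union>(supp_cells B)")
      case True
      then obtain \<rho> where \<rho>: "\<rho> \<in> supp_cells B" "x \<in> \<rho>" by auto
      obtain \<sigma> where \<sigma>: "\<sigma> \<in> supp_cells A" "\<rho> \<subseteq> \<sigma>" "weight B \<rho> = weight A \<sigma>" using ref[OF \<rho>(1)] by auto
      have "point_weight B x = weight B \<rho>"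
        by (rule B.off_low_cells_point_weight[OF offB]) (use \<rho> in \<open>auto simp: supp_cells_def\<close>)
      moreover have "point_weight A x = weight A \<sigma>"
        by (rule A.off_low_cells_point_weight[OF offA]) (use \<rho> \<sigma> in \<open>auto simp: supp_cells_def\<close>)
      ultimately show ?thesis using \<sigma> by simp
    next
      case False
      have "point_weight B x = 0"
      proof (rule ccontr)
        assume "point_weight B x \<noteq> 0"
        then obtain \<rho> where "\<rho> \<in> supp_cells B" "x \<in> rel_interior \<rho>" by (rule B.point_weight_nonzero)
        then show False using False rel_interior_subset[of \<rho>] by auto
      qed
      moreover have "point_weight A x = 0"
      proof (rule ccontr)
        assume "point_weight A x \<noteq> 0"
        then obtain \<rho> where "\<rho> \<in> supp_cells A" "x \<in> rel_interior \<rho>" by (rule A.point_weight_nonzero)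
        then show False using False supp rel_interior_subset[of \<rho>] by auto
      qed
      ultimately show ?thesis by simp
    qed
  qed
  have "finite F" unfolding F_def using complex_finite[OF A.complex] complex_finite[OF B.complex] by auto
  moreover have "\<forall>S\<in>F. affine S \<and> aff_dim S < dimension B"
    unfolding F_def using dim by (auto simp: affine_affine_hull)
  ultimately show ?thesis
    unfolding generically_equal_def using dim pw by (intro conjI exI[of _ F]) auto
qed

lemma refines_imp_generically_equal:
  assumes "refines B A"
  shows "generically_equal B A"
  by (rule generically_equal_if_refined)
    (use assms in \<open>auto simp: refines_def tropical_complex_imp_wpc\<close>)

lemma equivclp_refines_imp:
  assumes "equivclp refines A B" "tropical_complex A"
  shows "generically_equal A B"
  using assms(1)
proof (induction rule: equivclp_induct)
  case base
  show ?case unfolding generically_equal_def by (intro conjI exI[of _ "{}"]) auto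
next
  case (step y z)
  then have "generically_equal y z"
    using refines_imp_generically_equal generically_equal_sym by blast
  then show ?case using step.IH generically_equal_trans by blast
qed

text \<open>Keeping only intersections of full dimension and their faces makes the complex pure. On
  maximal cells the choice in the weight is unambiguous by \<open>same_cell_if_full\<close>.\<close>

definition common_refinement :: "'n::finite weighted_complex \<Rightarrow> 'n weighted_complex \<Rightarrow> 'n weighted_complex" where
  "common_refinement A B = WComplex (dimension A)
     {\<eta>. \<eta> \<noteq> {} \<and> (\<exists>\<sigma>\<in>supp_cells A. \<exists>\<rho>\<in>supp_cells B. aff_dim (\<sigma> \<inter> \<rho>) = dimension A \<and> \<eta> face_of (\<sigma> \<inter> \<rho>))}
     (\<lambda>\<mu>. weight A (SOME \<sigma>. \<sigma> \<in> supp_cells A \<and> \<mu> \<subseteq> \<sigma>))"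

text \<open>Intersect the smallest faces of \<open>\<sigma>\<close> and of \<open>\<rho>\<close>
  through a relatively interior point of \<open>\<eta>\<close>. The point is relatively interior to
  the intersection too, and two faces sharing a relatively interior point are equal.\<close>

lemma face_of_Int_complexes:
  fixes X Y :: "(real^'n) set set"
  assumes X: "polyhedral_complex X" and Y: "polyhedral_complex Y"
    and s: "\<sigma> \<in> X" "\<rho> \<in> Y" and eta: "\<eta> face_of (\<sigma> \<inter> \<rho>)" "\<eta> \<noteq> {}"
  obtains \<sigma>' \<rho>' where "\<sigma>' \<in> X" "\<rho>' \<in> Y" "\<sigma>' face_of \<sigma>" "\<rho>' face_of \<rho>" "\<eta> = \<sigma>' \<inter> \<rho>'"
proof -
  obtain x where x: "x \<in> rel_interior \<eta>"
    using eta rel_interior_eq_empty[OF face_of_imp_convex[OF eta(1)]] by auto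
  have "x \<in> \<sigma> \<inter> \<rho>" using x rel_interior_subset[of \<eta>] face_of_imp_subset[OF eta(1)] by auto
  then have xs: "x \<in> \<sigma>" "x \<in> \<rho>" by auto
  obtain \<sigma>' where \<sigma>': "\<sigma>' \<in> X" "\<sigma>' face_of \<sigma>" "x \<in> rel_interior \<sigma>'"
    using complex_point_in_rel_interior[OF X s(1) xs(1)] .
  obtain \<rho>' where \<rho>': "\<rho>' \<in> Y" "\<rho>' face_of \<rho>" "x \<in> rel_interior \<rho>'"
    using complex_point_in_rel_interior[OF Y s(2) xs(2)] .
  have "rel_interior (\<sigma>' \<inter> \<rho>') = rel_interior \<sigma>' \<inter> rel_interior \<rho>'"
    by (rule convex_rel_interior_inter_two)
      (use \<sigma>' \<rho>' complex_convex[OF X] complex_convex[OF Y] in auto)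
  then have xi: "x \<in> rel_interior (\<sigma>' \<inter> \<rho>')" using \<sigma>' \<rho>' by simp
  have "(\<sigma>' \<inter> \<rho>') face_of (\<sigma> \<inter> \<rho>)" using \<sigma>' \<rho>' by (intro face_of_Int_Int)
  then have "\<eta> = \<sigma>' \<inter> \<rho>'" using face_of_eq[OF eta(1)] x xi by auto
  then show thesis using that \<sigma>' \<rho>' by auto
qed

locale generically_equal_tropical =
  fixes A B :: "'n::finite weighted_complex"
  assumes tropA: "tropical_complex A" and tropB: "tropical_complex B"
    and gen: "generically_equal A B"
begin

sublocale A: weighted_polyhedral_complex A by (rule tropical_complex_imp_wpc[OF tropA])
sublocale B: weighted_polyhedral_complex B by (rule tropical_complex_imp_wpc[OF tropB])

abbreviation "C \<equiv> common_refinement A B"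

lemma dim_eq: "dimension A = dimension B"
  using gen by (simp add: generically_equal_def)

lemma common_refinement_cell:
  assumes "\<eta> \<in> cells C"
  obtains \<sigma> \<rho> \<sigma>' \<rho>' where "\<sigma> \<in> supp_cells A" "\<rho> \<in> supp_cells B" "aff_dim (\<sigma> \<inter> \<rho>) = dimension A"
    "\<eta> face_of (\<sigma> \<inter> \<rho>)" "\<sigma>' \<in> cells A" "\<rho>' \<in> cells B" "\<sigma>' face_of \<sigma>" "\<rho>' face_of \<rho>" "\<eta> = \<sigma>' \<inter> \<rho>'"
    "\<eta> \<noteq> {}"
proof -
  obtain \<sigma> \<rho> where s: "\<eta> \<noteq> {}" "\<sigma> \<in> supp_cells A" "\<rho> \<in> supp_cells B" "aff_dim (\<sigma> \<inter> \<rho>) = dimension A"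
      "\<eta> face_of (\<sigma> \<inter> \<rho>)"
    using assms unfolding common_refinement_def by auto
  then have "\<sigma> \<in> cells A" "\<rho> \<in> cells B" by (auto simp: supp_cells_iff)
  from face_of_Int_complexes[OF A.complex B.complex this s(5,1)] s that show thesis by metis
qed

lemma common_refinement_complex: "polyhedral_complex (cells C)"
  unfolding polyhedral_complex_def
proof (intro conjI ballI allI impI)
  have "cells C \<subseteq> (\<lambda>(\<sigma>, \<rho>). \<sigma> \<inter> \<rho>) ` (cells A \<times> cells B)"
  proof
    fix \<eta> assume "\<eta> \<in> cells C"
    then obtain \<sigma>' \<rho>' where "\<sigma>' \<in> cells A" "\<rho>' \<in> cells B" "\<eta> = \<sigma>' \<inter> \<rho>'"
      by (rule common_refinement_cell)
    then show "\<eta> \<in> (\<lambda>(\<sigma>, \<rho>). \<sigma> \<inter> \<rho>) ` (cells A \<times> cells B)" by auto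
  qed
  then show "finite (cells C)"
    by (rule finite_subset) (intro finite_imageI finite_SigmaI complex_finite A.complex B.complex)
next
  fix \<eta> assume "\<eta> \<in> cells C"
  then obtain \<sigma>' \<rho>' where "\<sigma>' \<in> cells A" "\<rho>' \<in> cells B" "\<eta> = \<sigma>' \<inter> \<rho>'" "\<eta> \<noteq> {}"
    by (rule common_refinement_cell)
  then show "rational_polyhedron \<eta>" "\<eta> \<noteq> {}"
    using rational_polyhedron_Int complex_rational A.complex B.complex by auto
next
  fix \<eta> \<kappa> assume e: "\<eta> \<in> cells C" and k: "\<kappa> face_of \<eta> \<and> \<kappa> \<noteq> {}"
  obtain \<sigma> \<rho> where s: "\<sigma> \<in> supp_cells A" "\<rho> \<in> supp_cells B" "aff_dim (\<sigma> \<inter> \<rho>) = dimension A"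
      "\<eta> face_of (\<sigma> \<inter> \<rho>)"
    using e by (rule common_refinement_cell)
  have "\<kappa> face_of (\<sigma> \<inter> \<rho>)" using face_of_trans[of \<kappa> \<eta>] s k by auto
  then show "\<kappa> \<in> cells C" using s k unfolding common_refinement_def by auto
next
  fix \<eta> \<kappa> assume e: "\<eta> \<in> cells C" and k: "\<kappa> \<in> cells C"
  obtain \<sigma> \<rho> where s: "\<sigma> \<in> cells A" "\<rho> \<in> cells B" "\<eta> = \<sigma> \<inter> \<rho>"
    using e by (rule common_refinement_cell)
  obtain \<sigma>' \<rho>' where s': "\<sigma>' \<in> cells A" "\<rho>' \<in> cells B" "\<kappa> = \<sigma>' \<inter> \<rho>'"
    using k by (rule common_refinement_cell)
  have eq: "\<eta> \<inter> \<kappa> = (\<sigma> \<inter> \<sigma>') \<inter> (\<rho> \<inter> \<rho>')" using s s' by auto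
  have "((\<sigma> \<inter> \<sigma>') \<inter> (\<rho> \<inter> \<rho>')) face_of (\<sigma> \<inter> \<rho>)"
    using complex_Int[OF A.complex s(1) s'(1)] complex_Int[OF B.complex s(2) s'(2)]
    by (intro face_of_Int_Int) auto
  then show "(\<eta> \<inter> \<kappa>) face_of \<eta>" using eq s(3) by simp
  have "((\<sigma> \<inter> \<sigma>') \<inter> (\<rho> \<inter> \<rho>')) face_of (\<sigma>' \<inter> \<rho>')"
    using complex_Int[OF A.complex s(1) s'(1)] complex_Int[OF B.complex s(2) s'(2)]
    by (intro face_of_Int_Int) auto
  then show "(\<eta> \<inter> \<kappa>) face_of \<kappa>" using eq s'(3) by simp
qed

lemma common_refinement_max_cell_iff:
  "\<eta> \<in> max_cells C \<longleftrightarrow>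
     (\<exists>\<sigma>\<in>supp_cells A. \<exists>\<rho>\<in>supp_cells B. aff_dim (\<sigma> \<inter> \<rho>) = dimension A \<and> \<eta> = \<sigma> \<inter> \<rho>)"
proof
  assume eta: "\<eta> \<in> max_cells C"
  then have "\<eta> \<in> cells C" "aff_dim \<eta> = dimension A" by (auto simp: max_cells_iff common_refinement_def)
  moreover from this obtain \<sigma> \<rho> where s: "\<sigma> \<in> supp_cells A" "\<rho> \<in> supp_cells B"
      "aff_dim (\<sigma> \<inter> \<rho>) = dimension A" "\<eta> face_of (\<sigma> \<inter> \<rho>)"
    by (meson common_refinement_cell)
  have "convex (\<sigma> \<inter> \<rho>)"
    using s complex_convex[OF A.complex] complex_convex[OF B.complex]
    by (intro convex_Int) (auto simp: supp_cells_iff)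
  ultimately have "\<eta> = \<sigma> \<inter> \<rho>" using face_of_aff_dim_lt[OF _ s(4)] s(3) by force
  then show "\<exists>\<sigma>\<in>supp_cells A. \<exists>\<rho>\<in>supp_cells B. aff_dim (\<sigma> \<inter> \<rho>) = dimension A \<and> \<eta> = \<sigma> \<inter> \<rho>"
    using s by auto
next
  assume "\<exists>\<sigma>\<in>supp_cells A. \<exists>\<rho>\<in>supp_cells B. aff_dim (\<sigma> \<inter> \<rho>) = dimension A \<and> \<eta> = \<sigma> \<inter> \<rho>"
  then obtain \<sigma> \<rho> where s: "\<sigma> \<in> supp_cells A" "\<rho> \<in> supp_cells B"
      "aff_dim (\<sigma> \<inter> \<rho>) = dimension A" "\<eta> = \<sigma> \<inter> \<rho>" by auto
  have cells: "\<sigma> \<in> cells A" "\<rho> \<in> cells B" using s by (auto simp: supp_cells_iff)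
  have conv: "convex (\<sigma> \<inter> \<rho>)"
    using cells complex_convex[OF A.complex] complex_convex[OF B.complex] by (intro convex_Int) auto
  have "\<eta> \<noteq> {}"
  proof
    assume "\<eta> = {}"
    then have "aff_dim \<sigma> = -1" using s by (simp add: supp_cells_iff)
    then show False using complex_nonempty[OF A.complex cells(1)] aff_dim_empty by blast
  qed
  then show "\<eta> \<in> max_cells C"
    using s face_of_refl[OF conv] by (auto simp: max_cells_iff common_refinement_def)
qed

lemma same_cell_if_full:
  assumes "\<sigma> \<in> supp_cells A" "\<sigma>' \<in> supp_cells A" "\<mu> \<subseteq> \<sigma>" "\<mu> \<subseteq> \<sigma>'" "aff_dim \<mu> = dimension A"
  shows "\<sigma> = \<sigma>'"
proof -
  have c: "\<sigma> \<in> cells A" "\<sigma>' \<in> cells A" "aff_dim \<sigma> = dimension A" "aff_dim \<sigma>' = dimension A"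
    using assms by (auto simp: supp_cells_iff)
  have "aff_dim (\<sigma> \<inter> \<sigma>') \<ge> dimension A" using aff_dim_subset[of \<mu> "\<sigma> \<inter> \<sigma>'"] assms by auto
  then have "\<sigma> \<inter> \<sigma>' = \<sigma>" "\<sigma> \<inter> \<sigma>' = \<sigma>'"
    using complex_Int[OF A.complex c(1,2)] face_of_aff_dim_lt complex_convex[OF A.complex] c
    by (metis not_less)+
  then show ?thesis by simp
qed

text \<open>The second equation is where generic equality enters: a generic point of the
  intersection is relatively interior to both cells, because all dimensions agree, and there the
  point weights coincide.\<close>

lemma weight_common_refinement:
  assumes "\<sigma> \<in> supp_cells A" "\<rho> \<in> supp_cells B" "aff_dim (\<sigma> \<inter> \<rho>) = dimension A"
  shows "weight C (\<sigma> \<inter> \<rho>) = weight A \<sigma>" "weight C (\<sigma> \<inter> \<rho>) = weight B \<rho>"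
proof -
  have "(SOME \<sigma>'. \<sigma>' \<in> supp_cells A \<and> \<sigma> \<inter> \<rho> \<subseteq> \<sigma>') = \<sigma>"
    by (rule some_equality) (use assms same_cell_if_full[of _ _ "\<sigma> \<inter> \<rho>"] in auto)
  then show 1: "weight C (\<sigma> \<inter> \<rho>) = weight A \<sigma>" by (simp add: common_refinement_def)
  have cells: "\<sigma> \<in> max_cells A" "\<rho> \<in> max_cells B" "\<sigma> \<in> cells A" "\<rho> \<in> cells B"
    using assms by (auto simp: supp_cells_def max_cells_iff)
  have conv: "convex (\<sigma> \<inter> \<rho>)"
    using cells complex_convex[OF A.complex] complex_convex[OF B.complex] by (intro convex_Int) auto
  have dims: "aff_dim \<sigma> = dimension A" "aff_dim \<rho> = dimension A"
    using assms dim_eq by (auto simp: supp_cells_iff)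
  have ne: "\<sigma> \<inter> \<rho> \<noteq> {}"
    using complex_nonempty[OF A.complex cells(3)] dims assms(3) aff_dim_empty by metis
  obtain F where F: "finite F" "\<forall>S\<in>F. affine S \<and> aff_dim S < dimension A"
      "\<forall>x. (\<forall>S\<in>F. x \<notin> S) \<longrightarrow> point_weight A x = point_weight B x"
    by (rule generically_equalE[OF gen]) (rule that)
  obtain x where x: "x \<in> rel_interior (\<sigma> \<inter> \<rho>)" "\<forall>S\<in>F. x \<notin> S"
  proof -
    have "affine S \<and> \<not> \<sigma> \<inter> \<rho> \<subseteq> S" if "S \<in> F" for S
      using F(2) that assms(3) aff_dim_subset[of "\<sigma> \<inter> \<rho>" S] by auto
    from generic_point_exists[OF conv ne F(1) this] show thesis using that by auto
  qed
  have "affine hull (\<sigma> \<inter> \<rho>) = affine hull \<sigma>"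
    by (rule affine_hull_eq_if_subset) (use dims assms(3) hull_subset[of \<sigma> affine] in auto)
  then have "x \<in> rel_interior \<sigma>" using subset_rel_interior[of "\<sigma> \<inter> \<rho>" \<sigma>] x by auto
  moreover have "affine hull (\<sigma> \<inter> \<rho>) = affine hull \<rho>"
    by (rule affine_hull_eq_if_subset) (use dims assms(3) hull_subset[of \<rho> affine] in auto)
  then have "x \<in> rel_interior \<rho>" using subset_rel_interior[of "\<sigma> \<inter> \<rho>" \<rho>] x by auto
  ultimately have "weight A \<sigma> = weight B \<rho>"
    using A.point_weight_rel_interior[OF cells(1)] B.point_weight_rel_interior[OF cells(2)] F(3) x(2)
    by metis
  then show "weight C (\<sigma> \<inter> \<rho>) = weight B \<rho>" using 1 by simp
qed

lemma supp_common_refinement: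
  "supp_cells C = {\<sigma> \<inter> \<rho> | \<sigma> \<rho>. \<sigma> \<in> supp_cells A \<and> \<rho> \<in> supp_cells B \<and> aff_dim (\<sigma> \<inter> \<rho>) = dimension A}"
proof -
  have "weight C (\<sigma> \<inter> \<rho>) \<noteq> 0" if "\<sigma> \<in> supp_cells A" "\<rho> \<in> supp_cells B" "aff_dim (\<sigma> \<inter> \<rho>) = dimension A" for \<sigma> \<rho>
    using weight_common_refinement(1)[OF that] that(1) by (simp add: supp_cells_def)
  then show ?thesis
    unfolding supp_cells_def[of C] using common_refinement_max_cell_iff by auto
qed

text \<open>A generic point of \<open>\<sigma>\<close> has nonzero weight in \<open>A\<close>, hence
  in \<open>B\<close>, so it lies in some \<open>\<rho>\<close>; avoiding the small hulls
  \<open>affine hull (\<sigma> \<inter> \<rho>)\<close> forces full dimension of the intersection.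
  Density and closedness of the finite union give the rest of \<open>\<sigma>\<close>.\<close>

lemma supp_subset_common_refinement: "\<Union>(supp_cells A) \<subseteq> \<Union>(supp_cells C)"
proof
  fix y assume "y \<in> \<Union>(supp_cells A)"
  then obtain \<sigma> where s: "\<sigma> \<in> supp_cells A" "y \<in> \<sigma>" by auto
  have c: "\<sigma> \<in> cells A" "\<sigma> \<in> max_cells A" "aff_dim \<sigma> = dimension A" "weight A \<sigma> \<noteq> 0"
    using s by (auto simp: supp_cells_iff max_cells_iff)
  have conv: "convex \<sigma>" using complex_convex[OF A.complex c(1)] .
  obtain F where F: "finite F" "\<forall>S\<in>F. affine S \<and> aff_dim S < dimension A"
      "\<forall>x. (\<forall>S\<in>F. x \<notin> S) \<longrightarrow> point_weight A x = point_weight B x"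
    by (rule generically_equalE[OF gen]) (rule that)
  define G where "G = F \<union> (\<lambda>\<rho>. affine hull (\<sigma> \<inter> \<rho>)) ` {\<rho> \<in> supp_cells B. aff_dim (\<sigma> \<inter> \<rho>) < dimension A}"
  have fB: "finite (supp_cells B)" using B.finite_max_cells by (simp add: supp_cells_def)
  have G: "finite G" "\<And>S. S \<in> G \<Longrightarrow> affine S \<and> \<not> \<sigma> \<subseteq> S"
  proof -
    show "finite G" using F(1) fB by (auto simp: G_def)
    fix S assume "S \<in> G"
    then have "affine S" "aff_dim S < dimension A" using F(2) by (auto simp: G_def affine_affine_hull)
    then show "affine S \<and> \<not> \<sigma> \<subseteq> S" using aff_dim_subset[of \<sigma> S] c by auto
  qed
  have "{x \<in> rel_interior \<sigma>. \<forall>S\<in>G. x \<notin> S} \<subseteq> \<Union>(supp_cells C)"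
  proof
    fix x assume "x \<in> {x \<in> rel_interior \<sigma>. \<forall>S\<in>G. x \<notin> S}"
    then have x: "x \<in> rel_interior \<sigma>" "\<forall>S\<in>G. x \<notin> S" by auto
    have "point_weight A x = weight A \<sigma>" using A.point_weight_rel_interior[OF c(2) x(1)] .
    then have "point_weight B x \<noteq> 0" using F(3) x(2) c(4) unfolding G_def by auto
    then obtain \<rho> where \<rho>: "\<rho> \<in> supp_cells B" "x \<in> rel_interior \<rho>" by (rule B.point_weight_nonzero)
    have xi: "x \<in> \<sigma> \<inter> \<rho>" using x(1) \<rho>(2) rel_interior_subset by auto
    then have "x \<in> affine hull (\<sigma> \<inter> \<rho>)" by (rule hull_inc)
    then have "\<not> aff_dim (\<sigma> \<inter> \<rho>) < dimension A" using x(2) \<rho>(1) unfolding G_def by auto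
    moreover have "aff_dim (\<sigma> \<inter> \<rho>) \<le> dimension A" using aff_dim_subset[of "\<sigma> \<inter> \<rho>" \<sigma>] c by auto
    ultimately have "\<sigma> \<inter> \<rho> \<in> supp_cells C" using s \<rho> unfolding supp_common_refinement by auto
    then show "x \<in> \<Union>(supp_cells C)" using xi by blast
  qed
  moreover have "closed (\<Union>(supp_cells C))"
  proof (rule closed_Union)
    show "finite (supp_cells C)"
      by (rule finite_subset[OF _ complex_finite[OF common_refinement_complex]]) (auto simp: supp_cells_iff)
    show "\<forall>T\<in>supp_cells C. closed T"
      using complex_closed[OF common_refinement_complex] by (auto simp: supp_cells_iff)
  qed
  ultimately have "closure {x \<in> rel_interior \<sigma>. \<forall>S\<in>G. x \<notin> S} \<subseteq> \<Union>(supp_cells C)"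
    by (rule closure_minimal)
  then show "y \<in> \<Union>(supp_cells C)" using generic_points_dense[OF conv G] s(2) by auto
qed

lemma common_refinement_refinesA:
  "dimension C = dimension A" "\<Union>(supp_cells C) = \<Union>(supp_cells A)"
  "\<kappa> \<in> supp_cells C \<Longrightarrow> \<exists>\<sigma>\<in>supp_cells A. \<kappa> \<subseteq> \<sigma> \<and> weight C \<kappa> = weight A \<sigma>"
proof -
  show "dimension C = dimension A" by (simp add: common_refinement_def)
  show "\<Union>(supp_cells C) = \<Union>(supp_cells A)"
    using supp_subset_common_refinement unfolding supp_common_refinement by auto
  show "\<exists>\<sigma>\<in>supp_cells A. \<kappa> \<subseteq> \<sigma> \<and> weight C \<kappa> = weight A \<sigma>" if "\<kappa> \<in> supp_cells C"
    using that weight_common_refinement unfolding supp_common_refinement by blast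
qed

lemma tropical_common_refinement: "tropical_complex C"
  unfolding tropical_complex_def
proof (intro conjI ballI)
  show "polyhedral_complex (cells C)" by (rule common_refinement_complex)
  fix \<eta> assume "\<eta> \<in> cells C"
  then obtain \<sigma> \<rho> where s: "\<sigma> \<in> supp_cells A" "\<rho> \<in> supp_cells B" "aff_dim (\<sigma> \<inter> \<rho>) = dimension A"
      "\<eta> face_of (\<sigma> \<inter> \<rho>)" by (rule common_refinement_cell)
  have "\<sigma> \<inter> \<rho> \<in> max_cells C" unfolding common_refinement_max_cell_iff using s by auto
  with face_of_imp_subset[OF s(4)] show "\<exists>\<sigma>\<in>max_cells C. \<eta> \<subseteq> \<sigma>" by (rule rev_bexI[rotated])
next
  fix \<tau> assume t: "\<tau> \<in> cells_of_dim (dimension C - 1) (cells C)"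
  have C: "weighted_polyhedral_complex C"
    by unfold_locales (rule common_refinement_complex)
  have "generically_equal C A"
    by (rule generically_equal_if_refined[OF A.weighted_polyhedral_complex_axioms C
          common_refinement_refinesA])
  from balanced_transfer[OF C tropA this t] show "normal_sum C \<tau> \<in> dir_space \<tau>" .
qed

lemma refines_common_refinementA: "refines C A"
  unfolding refines_def
  by (intro conjI ballI tropA tropical_common_refinement common_refinement_refinesA)

end

lemma equivclp_refines_if_generically_equal:
  assumes "tropical_complex A" "tropical_complex B" "generically_equal A B"
  shows "equivclp refines A B"
proof -
  interpret AB: generically_equal_tropical A B using assms by unfold_locales
  interpret BA: generically_equal_tropical B A
    using assms generically_equal_sym by unfold_locales auto
  have eq: "\<sigma> \<inter> \<rho> = \<rho> \<inter> \<sigma>" for \<sigma> \<rho> :: "(real^'a) set" by auto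
  have dim: "dimension B = dimension A" using AB.dim_eq by simp
  \<comment> \<open>The weights of the construction are taken from its first argument, so the
    support of \<open>B\<close> is treated through the instance with exchanged roles, which has the
    same support cells.\<close>
  have swap: "supp_cells BA.C = supp_cells AB.C"
    unfolding AB.supp_common_refinement BA.supp_common_refinement dim by auto (metis Int_commute)+
  have "refines AB.C B"
    unfolding refines_def
  proof (intro conjI ballI)
    show "tropical_complex B" "tropical_complex AB.C" by (fact, rule AB.tropical_common_refinement)
    show "dimension AB.C = dimension B" using dim AB.common_refinement_refinesA(1) by simp
    show "\<Union>(supp_cells AB.C) = \<Union>(supp_cells B)"
      using BA.common_refinement_refinesA(2) swap by simp
    show "\<exists>\<sigma>\<in>supp_cells B. \<kappa> \<subseteq> \<sigma> \<and> weight AB.C \<kappa> = weight B \<sigma>" if "\<kappa> \<in> supp_cells AB.C" for \<kappa>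
      using that AB.weight_common_refinement(2) unfolding AB.supp_common_refinement by auto
  qed
  then have "equivclp refines AB.C B" by (rule r_into_equivclp)
  moreover have "equivclp refines A AB.C"
    using AB.refines_common_refinementA by (meson converse_r_into_equivclp)
  ultimately show ?thesis by (rule equivclp_trans[rotated])
qed

text \<open>Replaces the generated equivalence relation by generic equality, the form in which
  cycles are handled from here on.\<close>

lemma cycle_of_iff:
  assumes "tropical_complex A"
  shows "B \<in> cycle_of A \<longleftrightarrow> tropical_complex B \<and> generically_equal A B"
  using assms equivclp_refines_imp equivclp_refines_if_generically_equal
  by (auto simp: cycle_of_def)

lemma cycle_of_eq:
  assumes "tropical_complex A" "tropical_complex B" "generically_equal A B"
  shows "cycle_of A = cycle_of B"
  using assms cycle_of_iff generically_equal_trans generically_equal_sym by blast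

subsection \<open>Divisors of rational functions\<close>

lemma linear_eq_on_dir_space:
  assumes "linear l" "linear l'" "\<And>x. x \<in> S \<Longrightarrow> l x + c = l' x + (c'::real)" "v \<in> dir_space S"
  shows "l v = l' v"
proof -
  have "linear (\<lambda>x. l x - l' x)" using assms(1,2) by (rule linear_compose_sub)
  then have "subspace {x. l x - l' x = 0}" by (rule linear_subspace_kernel)
  then have "dir_space S \<subseteq> {x. l x - l' x = 0}"
    unfolding dir_space_def
  proof (rule span_minimal[rotated], clarify)
    fix x y assume "x \<in> S" "y \<in> S"
    then have "l x + c = l' x + c'" "l y + c = l' y + c'" using assms(3) by auto
    then show "l (x - y) - l' (x - y) = 0"
      by (simp add: linear_diff[OF assms(1)] linear_diff[OF assms(2)])
  qed
  then show ?thesis using assms(4) by auto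
qed

lemma linear_part_spec:
  assumes "linear l" "\<And>x. x \<in> S \<Longrightarrow> \<phi> x = l x + c"
  obtains d where "linear (linear_part \<phi> S)" "\<And>x. x \<in> S \<Longrightarrow> \<phi> x = linear_part \<phi> S x + d"
proof -
  have "\<exists>l. linear l \<and> (\<exists>c. \<forall>x\<in>S. \<phi> x = l x + c)" using assms by blast
  from someI_ex[OF this] have "linear (linear_part \<phi> S) \<and> (\<exists>c. \<forall>x\<in>S. \<phi> x = linear_part \<phi> S x + c)"
    unfolding linear_part_def .
  then show thesis using that by auto
qed

lemma linear_part_eq:
  assumes "linear l" "\<And>x. x \<in> S \<Longrightarrow> \<phi> x = l x + c" "v \<in> dir_space S"
  shows "linear_part \<phi> S v = l v"
proof -
  obtain d where d: "linear (linear_part \<phi> S)" "\<And>x. x \<in> S \<Longrightarrow> \<phi> x = linear_part \<phi> S x + d"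
    using linear_part_spec[OF assms(1,2)] by auto
  show ?thesis
    by (rule linear_eq_on_dir_space[OF d(1) assms(1) _ assms(3), of d c]) (use d assms(2) in auto)
qed

lemma int_affine_on_cellsE:
  assumes "int_affine_on_cells \<phi> A" "\<sigma> \<in> cells A"
  obtains l c where "linear l" "\<And>y. y \<in> \<sigma> \<Longrightarrow> \<phi> y = l y + c"
proof -
  have "\<exists>l c. int_form_on \<sigma> l \<and> (\<forall>x\<in>\<sigma>. \<phi> x = l x + c)"
    using assms by (simp add: int_affine_on_cells_def)
  then show thesis using that by (auto simp: int_form_on_def)
qed

text \<open>A substitute for \<open>linear_part\<close> that refers to no cell, hence is common to
  all complexes on which \<open>\<phi>\<close> is affine. The equality is exact on an initial piece
  of the ray because \<open>\<phi>\<close> is piecewise affine.\<close>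

definition right_derivative :: "(real^'n \<Rightarrow> real) \<Rightarrow> real^'n \<Rightarrow> real^'n \<Rightarrow> real" where
  "right_derivative \<phi> x u = (THE c. \<forall>\<^sub>F t in at_right 0. \<phi> (x + t *\<^sub>R u) = \<phi> x + t * c)"

lemma right_derivative_eq:
  assumes "\<forall>\<^sub>F t in at_right 0. \<phi> (x + t *\<^sub>R u) = \<phi> x + t * c"
  shows "right_derivative \<phi> x u = c"
  unfolding right_derivative_def
proof (rule the_equality)
  show "\<forall>\<^sub>F t in at_right 0. \<phi> (x + t *\<^sub>R u) = \<phi> x + t * c" by (rule assms)
next
  fix c' assume "\<forall>\<^sub>F t in at_right 0. \<phi> (x + t *\<^sub>R u) = \<phi> x + t * c'"
  with assms have "\<forall>\<^sub>F t in at_right (0::real). t * c = t * c' \<and> t > 0"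
    using eventually_at_right_less[of "0::real"] by eventually_elim auto
  then obtain t :: real where "t * c = t * c'" "t > 0"
    using eventually_happens[of _ "at_right (0::real)"] trivial_limit_at_right_real by blast
  then show "c' = c" by simp
qed

context weighted_polyhedral_complex
begin

lemma right_derivative_local_cell:
  assumes "\<sigma> \<in> local_cells A x u" "linear l" "\<And>y. y \<in> \<sigma> \<Longrightarrow> \<phi> y = l y + c"
  shows "right_derivative \<phi> x u = l u"
proof (rule right_derivative_eq)
  have xs: "x \<in> \<sigma>" by (rule local_cell_contains[OF assms(1)])
  have "\<forall>\<^sub>F t in at_right 0. x + t *\<^sub>R u \<in> rel_interior \<sigma>"
    using assms(1) by (simp add: local_cells_def)
  then show "\<forall>\<^sub>F t in at_right 0. \<phi> (x + t *\<^sub>R u) = \<phi> x + t * l u"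
  proof eventually_elim
    case (elim t)
    then have "x + t *\<^sub>R u \<in> \<sigma>" using rel_interior_subset by auto
    then show ?case
      using assms(3) xs by (simp add: linear_add[OF assms(2)] linear_scale[OF assms(2)])
  qed
qed

text \<open>Split each normal vector into its projection and a part in \<open>V_\<tau>\<close>,
  where all linear parts agree with that of \<open>\<tau>\<close>. By balancing the second parts add
  up to the normal sum, so their contribution is exactly the subtracted term of the divisor
  weight.\<close>

lemma divisor_weight_eq_local_sum:
  assumes t: "\<tau> \<in> cells A" "aff_dim \<tau> = dimension A - 1" "x \<in> rel_interior \<tau>"
    and bal: "normal_sum A \<tau> \<in> dir_space \<tau>"
    and phi: "int_affine_on_cells \<phi> A"
  shows "divisor_weight \<phi> A \<tau> = \<lfloor>local_sum A x (dir_space \<tau>) (right_derivative \<phi> x)\<rfloor>"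
proof -
  let ?T = "dir_space \<tau>"
  let ?n = "\<lambda>\<sigma>. normal_vec \<sigma> \<tau>"
  let ?p = "orth_proj ?T"
  note sT = subspace_dir_space[of \<tau>]
  obtain lt ct where lt: "linear lt" "\<And>y. y \<in> \<tau> \<Longrightarrow> \<phi> y = lt y + ct"
    by (rule int_affine_on_cellsE[OF phi t(1)]) (rule that)
  have lpt: "linear_part \<phi> \<tau> v = lt v" if "v \<in> ?T" for v
    using linear_part_eq[OF lt that] .
  have summand: "linear_part \<phi> \<sigma> (?n \<sigma>) = right_derivative \<phi> x (?p (?n \<sigma>)) + lt (?n \<sigma> - ?p (?n \<sigma>))"
    if adj: "\<sigma> \<in> adjacent_cells A \<tau>" for \<sigma>
  proof -
    have s: "\<sigma> \<in> cells A" "\<tau> facet_of \<sigma>" using adj by (auto simp: adjacent_cells_def max_cells_iff)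
    have sub: "\<tau> \<subseteq> \<sigma>" using facet_of_imp_subset[OF s(2)] .
    obtain l c where l: "linear l" "\<And>y. y \<in> \<sigma> \<Longrightarrow> \<phi> y = l y + c"
      by (rule int_affine_on_cellsE[OF phi s(1)]) (rule that)
    have rep: "represents_normal \<sigma> \<tau> (?n \<sigma>)"
      by (rule represents_normal_normal_vec[OF complex s(1) t(1) s(2)])
    then have nV: "?n \<sigma> \<in> dir_space \<sigma>" by (simp add: represents_normal_def dir_lattice_def)
    have loc: "\<sigma> \<in> local_cells A x (?p (?n \<sigma>))"
      by (rule normal_direction_local_cell[OF adj rep t(3)])
    have "linear_part \<phi> \<sigma> (?n \<sigma>) = l (?n \<sigma>)" using linear_part_eq[OF l nV] .
    also have "\<dots> = l (?p (?n \<sigma>)) + l (?n \<sigma> - ?p (?n \<sigma>))" by (simp add: linear_diff[OF l(1)])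
    also have "l (?p (?n \<sigma>)) = right_derivative \<phi> x (?p (?n \<sigma>))"
      using right_derivative_local_cell[OF loc l] by simp
    also have "l (?n \<sigma> - ?p (?n \<sigma>)) = lt (?n \<sigma> - ?p (?n \<sigma>))"
      by (rule linear_eq_on_dir_space[OF l(1) lt(1) _ orth_proj_diff[OF sT], of c ct])
        (use l(2) lt(2) sub in fastforce)
    finally show ?thesis .
  qed
  have lin: "linear ?p" by (rule linear_orth_proj[OF sT])
  have sumT: "(\<Sum>\<sigma>\<in>adjacent_cells A \<tau>. of_int (weight A \<sigma>) * lt (?n \<sigma> - ?p (?n \<sigma>)))
      = lt (normal_sum A \<tau> - ?p (normal_sum A \<tau>))"
    unfolding normal_sum_def
    by (simp add: linear_sum[OF lin] linear_scale[OF lin] sum_subtractf[symmetric]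
        linear_sum[OF lt(1)] scaleR_diff_right[symmetric] linear_scale[OF lt(1)])
  have pz: "?p (normal_sum A \<tau>) = 0" using bal by (simp add: orth_proj_zero_iff sT)
  have "(\<Sum>\<sigma>\<in>adjacent_cells A \<tau>. of_int (weight A \<sigma>) * linear_part \<phi> \<sigma> (?n \<sigma>))
      = (\<Sum>\<sigma>\<in>adjacent_cells A \<tau>. of_int (weight A \<sigma>) * right_derivative \<phi> x (?p (?n \<sigma>)))
       + (\<Sum>\<sigma>\<in>adjacent_cells A \<tau>. of_int (weight A \<sigma>) * lt (?n \<sigma> - ?p (?n \<sigma>)))"
    unfolding sum.distrib[symmetric] by (rule sum.cong) (auto simp: summand algebra_simps)
  also have "\<dots> = local_sum A x ?T (right_derivative \<phi> x) + linear_part \<phi> \<tau> (normal_sum A \<tau>)"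
    unfolding sumT local_sum_codim1[OF t] using pz lpt[OF bal] by simp
  finally show ?thesis unfolding divisor_weight_def by simp
qed

end

section \<open>Divisor complexes and their independence of the representative\<close>

lemma max_cells_divisor_complex:
  "\<tau> \<in> max_cells (divisor_complex \<phi> A) \<longleftrightarrow> \<tau> \<in> cells A \<and> aff_dim \<tau> = dimension A - 1"
  by (auto simp: max_cells_iff divisor_complex_def)

lemma divisor_complex_polyhedral:
  assumes "tropical_complex A"
  shows "polyhedral_complex (cells (divisor_complex \<phi> A))"
proof -
  have X: "polyhedral_complex (cells A)" using assms by (simp add: tropical_complex_def)
  have face: "\<tau> \<in> cells A - max_cells A"
    if s: "\<sigma> \<in> cells A - max_cells A" "\<tau> face_of \<sigma>" "\<tau> \<noteq> {}" for \<sigma> \<tau>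
  proof
    show "\<tau> \<in> cells A" using complex_face[OF X] s by auto
    show "\<tau> \<notin> max_cells A"
    proof
      assume t: "\<tau> \<in> max_cells A"
      obtain \<rho> where r: "\<rho> \<in> max_cells A" "\<sigma> \<subseteq> \<rho>" using assms s(1) by (auto simp: tropical_complex_def)
      have "aff_dim \<tau> \<le> aff_dim \<sigma>" "aff_dim \<sigma> \<le> aff_dim \<rho>"
        using face_of_imp_subset[OF s(2)] r by (auto intro: aff_dim_subset)
      then show False using t r s by (auto simp: max_cells_iff)
    qed
  qed
  then show ?thesis
    unfolding divisor_complex_def weighted_complex.sel by (rule polyhedral_subcomplex[OF X Diff_subset])
qed

lemma divisor_complex_pure:
  assumes "tropical_complex A" "\<tau> \<in> cells (divisor_complex \<phi> A)"
  shows "\<exists>\<sigma>\<in>max_cells (divisor_complex \<phi> A). \<tau> \<subseteq> \<sigma>"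
proof -
  have X: "polyhedral_complex (cells A)" using assms by (simp add: tropical_complex_def)
  have t: "\<tau> \<in> cells A" "\<tau> \<notin> max_cells A" using assms(2) by (auto simp: divisor_complex_def)
  obtain \<rho> where r: "\<rho> \<in> max_cells A" "\<tau> \<subseteq> \<rho>" using assms(1) t(1) by (auto simp: tropical_complex_def)
  have rc: "\<rho> \<in> cells A" "aff_dim \<rho> = dimension A" using r by (auto simp: max_cells_iff)
  obtain F where F: "F facet_of \<rho>" "\<tau> \<subseteq> F"
    by (rule face_of_polyhedron_subset_facet[OF complex_polyhedron[OF X rc(1)]
          complex_subset_imp_face[OF X t(1) rc(1) r(2)] complex_nonempty[OF X t(1)]])
      (use r t in auto)
  have "F \<noteq> {}" "aff_dim F = dimension A - 1" using F(1) rc by (auto simp: facet_of_def)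
  moreover have "F \<in> cells A"
    using complex_face[OF X rc(1) facet_of_imp_face_of[OF F(1)]] calculation by auto
  ultimately show ?thesis using F(2) by (auto simp: max_cells_divisor_complex)
qed

text \<open>At a point off \<open>H\<close> that is relatively interior to a codimension one cell,
  both divisor weights are the same local sum. If the other complex has no lower cell through the
  point, \<open>\<phi>\<close> is affine across it along each local direction, and both its local
  sum and its divisor weight vanish.\<close>

lemma divisor_generically_equal:
  fixes A B :: "'n::finite weighted_complex"
  assumes A: "tropical_complex A" and B: "tropical_complex B"
    and gen: "generically_equal A B"
    and phi: "int_affine_on_cells \<phi> A" "int_affine_on_cells \<phi> B"
  shows "generically_equal (divisor_complex \<phi> A) (divisor_complex \<phi> B)"
proof -
  obtain F where dim: "dimension A = dimension B" and F: "finite F"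
      "\<forall>S\<in>F. affine S \<and> aff_dim S < dimension A"
      "\<forall>x. (\<forall>S\<in>F. x \<notin> S) \<longrightarrow> point_weight A x = point_weight B x"
    by (rule generically_equalE[OF gen]) (rule that)
  define G where "G = F \<union> cells A \<union> cells B"
  define D where "D = {\<tau> \<in> cells A \<union> cells B. aff_dim \<tau> = dimension A - 1}"
  \<comment> \<open>Points of a codimension one cell that fail to be generic for \<open>G\<close>
    lie in one of these sets, whose dimension is at most \<open>dimension A - 2\<close>.\<close>
  define H where "H = {affine hull \<tau> \<inter> affine hull S | \<tau> S. \<tau> \<in> D \<and> S \<in> G \<and> \<not> \<tau> \<subseteq> affine hull S}"
  have XA: "polyhedral_complex (cells A)" and XB: "polyhedral_complex (cells B)"
    using A B by (simp_all add: tropical_complex_def)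
  have fin: "finite D" "finite G"
    using F(1) complex_finite[OF XA] complex_finite[OF XB] by (auto simp: D_def G_def)
  have "H \<subseteq> (\<lambda>(\<tau>, S). affine hull \<tau> \<inter> affine hull S) ` (D \<times> G)" by (auto simp: H_def)
  then have finH: "finite H" by (rule finite_subset) (use fin in auto)
  have H: "affine S \<and> aff_dim S < dimension A - 1" if "S \<in> H" for S
  proof -
    obtain \<tau> T where tT: "S = affine hull \<tau> \<inter> affine hull T" "\<tau> \<in> D" "\<not> \<tau> \<subseteq> affine hull T"
      using \<open>S \<in> H\<close> unfolding H_def by auto
    have aff: "affine S" unfolding tT by (intro affine_Int affine_affine_hull)
    have "S \<noteq> affine hull \<tau>" using tT hull_subset[of \<tau> affine] by auto
    then have "S \<subset> affine hull \<tau>" using tT by auto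
    then have "affine hull S \<subset> affine hull (affine hull \<tau>)" using affine_hull_eq[THEN iffD2, OF aff] by (simp only: hull_hull)
    then have "aff_dim S < aff_dim (affine hull \<tau>)" by (rule aff_dim_psubset)
    then show ?thesis using aff tT by (simp add: D_def)
  qed
  \<comment> \<open>Stated for a pair \<open>P\<close>, \<open>Q\<close> because it is applied in
    both orders: the codimension one cell through \<open>x\<close> may belong to either
    complex.\<close>
  have one: "point_weight (divisor_complex \<phi> P) x = point_weight (divisor_complex \<phi> Q) x"
    if P: "tropical_complex P" and Q: "tropical_complex Q" and dimP: "dimension P = dimension A"
      and dimQ: "dimension Q = dimension A"
      and pw: "\<forall>x. (\<forall>S\<in>F. x \<notin> S) \<longrightarrow> point_weight P x = point_weight Q x"
      and phiP: "int_affine_on_cells \<phi> P" and phiQ: "int_affine_on_cells \<phi> Q"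
      and sub: "cells P \<subseteq> cells A \<union> cells B" "cells Q \<subseteq> cells A \<union> cells B"
      and off: "\<forall>S\<in>H. x \<notin> S"
      and t: "\<tau> \<in> max_cells (divisor_complex \<phi> P)" "x \<in> rel_interior \<tau>" for P Q \<tau> x
  proof -
    interpret P: weighted_polyhedral_complex P by (rule tropical_complex_imp_wpc[OF P])
    interpret Q: weighted_polyhedral_complex Q by (rule tropical_complex_imp_wpc[OF Q])
    interpret DP: weighted_polyhedral_complex "divisor_complex \<phi> P"
      by unfold_locales (rule divisor_complex_polyhedral[OF P])
    interpret DQ: weighted_polyhedral_complex "divisor_complex \<phi> Q"
      by unfold_locales (rule divisor_complex_polyhedral[OF Q])
    have balP: "normal_sum P \<eta> \<in> dir_space \<eta>" if "\<eta> \<in> cells P" "aff_dim \<eta> = dimension P - 1" for \<eta>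
      using P that by (auto simp: tropical_complex_def cells_of_dim_def)
    have balQ: "normal_sum Q \<eta> \<in> dir_space \<eta>" if "\<eta> \<in> cells Q" "aff_dim \<eta> = dimension Q - 1" for \<eta>
      using Q that by (auto simp: tropical_complex_def cells_of_dim_def)
    have tc: "\<tau> \<in> cells P" "aff_dim \<tau> = dimension P - 1" using t by (auto simp: max_cells_divisor_complex)
    have tD: "\<tau> \<in> D" using tc sub dimP by (auto simp: D_def)
    have xhull: "x \<in> affine hull \<tau>" using hull_inc[OF subsetD[OF rel_interior_subset t(2)]] .
    have xG: "generic_in G \<tau> x"
      unfolding generic_in_def
    proof (intro conjI ballI impI t(2))
      fix S assume S: "S \<in> G" "x \<in> affine hull S"
      show "\<tau> \<subseteq> affine hull S"
      proof (rule ccontr)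
        assume "\<not> \<tau> \<subseteq> affine hull S"
        then have "affine hull \<tau> \<inter> affine hull S \<in> H" using S tD unfolding H_def by auto
        then show False using off xhull S by auto
      qed
    qed
    let ?I = "\<lambda>R. \<lfloor>local_sum R x (dir_space \<tau>) (right_derivative \<phi> x)\<rfloor>"
    have "point_weight (divisor_complex \<phi> P) x = divisor_weight \<phi> P \<tau>"
      using DP.point_weight_rel_interior[OF t] by (simp add: divisor_complex_def)
    also have "\<dots> = ?I P"
      by (rule P.divisor_weight_eq_local_sum[OF tc t(2) balP[OF tc] phiP])
    also have "\<dots> = ?I Q"
    proof -
      have "generic_in F \<tau> x" by (rule generic_in_mono[OF xG]) (auto simp: G_def)
      from local_sum_generic[OF P.weighted_polyhedral_complex_axioms Q.weighted_polyhedral_complex_axioms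
          F(1) _ pw tc(2) this, where g = "right_derivative \<phi> x"] F(2) dimP
      show ?thesis by simp
    qed
    also have "\<dots> = point_weight (divisor_complex \<phi> Q) x"
    proof (rule Q.generic_cell_cases[OF xG])
      show "cells Q \<subseteq> G" using sub by (auto simp: G_def)
      show "aff_dim \<tau> = dimension Q - 1" using tc dimP dimQ by simp
    next
      assume low: "\<And>\<eta>. \<eta> \<in> cells Q \<Longrightarrow> x \<in> \<eta> \<Longrightarrow> dimension Q \<le> aff_dim \<eta>"
      have "local_sum Q x (dir_space \<tau>) (right_derivative \<phi> x) = 0"
      proof (rule Q.local_sum_top[OF low subspace_dir_space])
        fix u \<sigma> assume s: "\<sigma> \<in> local_cells Q x u"
        then have "\<sigma> \<in> cells Q" by (simp add: local_cells_def max_cells_iff)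
        then obtain l c where l: "linear l" "\<And>y. y \<in> \<sigma> \<Longrightarrow> \<phi> y = l y + c"
          by (rule int_affine_on_cellsE[OF phiQ]) (rule that)
        have s': "\<sigma> \<in> local_cells Q x (- u)" by (rule Q.local_cell_minus[OF low s])
        show "right_derivative \<phi> x (- u) = - right_derivative \<phi> x u"
          using Q.right_derivative_local_cell[OF s l] Q.right_derivative_local_cell[OF s' l]
          by (simp add: linear_neg[OF l(1)])
      qed
      moreover have "point_weight (divisor_complex \<phi> Q) x = 0"
      proof (rule ccontr)
        assume "point_weight (divisor_complex \<phi> Q) x \<noteq> 0"
        then obtain \<eta> where "\<eta> \<in> supp_cells (divisor_complex \<phi> Q)" "x \<in> rel_interior \<eta>"
          by (rule DQ.point_weight_nonzero)
        then have "\<eta> \<in> cells Q" "aff_dim \<eta> = dimension Q - 1" "x \<in> \<eta>"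
          using max_cells_divisor_complex[of \<eta> \<phi> Q] rel_interior_subset[of \<eta>] by (auto simp: supp_cells_def)
        then show False using low by force
      qed
      ultimately show ?thesis by simp
    next
      fix \<eta> assume e: "\<eta> \<in> cells Q" "aff_dim \<eta> = dimension Q - 1" "x \<in> rel_interior \<eta>"
          "dir_space \<eta> = dir_space \<tau>"
      have "\<eta> \<in> max_cells (divisor_complex \<phi> Q)" using e by (simp add: max_cells_divisor_complex)
      then have "point_weight (divisor_complex \<phi> Q) x = divisor_weight \<phi> Q \<eta>"
        using DQ.point_weight_rel_interior[OF _ e(3)] by (simp add: divisor_complex_def)
      also have "\<dots> = \<lfloor>local_sum Q x (dir_space \<eta>) (right_derivative \<phi> x)\<rfloor>"
        by (rule Q.divisor_weight_eq_local_sum[OF e(1-3) balQ[OF e(1,2)] phiQ])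
      finally show ?thesis unfolding e(4) ..
    qed
    finally show ?thesis .
  qed
  have "point_weight (divisor_complex \<phi> A) x = point_weight (divisor_complex \<phi> B) x"
    if off: "\<forall>S\<in>H. x \<notin> S" for x
  proof (cases "\<exists>\<tau>\<in>max_cells (divisor_complex \<phi> A). x \<in> rel_interior \<tau>")
    case True
    then obtain \<tau> where "\<tau> \<in> max_cells (divisor_complex \<phi> A)" "x \<in> rel_interior \<tau>" by auto
    then show ?thesis
      by (intro one[OF A B _ _ F(3) phi _ _ off]) (use dim in auto)
  next
    case notA: False
    show ?thesis
    proof (cases "\<exists>\<tau>\<in>max_cells (divisor_complex \<phi> B). x \<in> rel_interior \<tau>")
      case True
      have pw': "\<forall>x. (\<forall>S\<in>F. x \<notin> S) \<longrightarrow> point_weight B x = point_weight A x" using F(3) by simp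
      obtain \<tau> where "\<tau> \<in> max_cells (divisor_complex \<phi> B)" "x \<in> rel_interior \<tau>" using True by auto
      then have "point_weight (divisor_complex \<phi> B) x = point_weight (divisor_complex \<phi> A) x"
        by (intro one[OF B A _ _ pw' phi(2,1) _ _ off]) (use dim in auto)
      then show ?thesis by simp
    next
      case False
      have empty: "{\<tau> \<in> max_cells (divisor_complex \<phi> A). x \<in> rel_interior \<tau>} = {}"
        "{\<tau> \<in> max_cells (divisor_complex \<phi> B). x \<in> rel_interior \<tau>} = {}" using notA False by auto
      show ?thesis unfolding point_weight_def empty by (simp only: sum.empty)
    qed
  qed
  then show ?thesis
    unfolding generically_equal_def
    using finH H dim by (intro conjI exI[of _ H]) (auto simp: divisor_complex_def)
qed

text \<open>The divisor of an arbitrary representative inherits its balancing condition from \<open>K\<close>; so the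
  general fact that divisors are balanced is not needed.\<close>

lemma cycle_of_divisor_eq:
  assumes A: "tropical_complex A" and B: "tropical_complex B"
    and gen: "generically_equal A B"
    and phi: "int_affine_on_cells \<phi> A" "int_affine_on_cells \<phi> B"
    and K: "tropical_complex K" "generically_equal (divisor_complex \<phi> B) K"
  shows "cycle_of (divisor_complex \<phi> A) = cycle_of K"
proof (rule cycle_of_eq)
  show gen': "generically_equal (divisor_complex \<phi> A) K"
    using divisor_generically_equal[OF A B gen phi] K(2) generically_equal_trans by blast
  have wpc: "weighted_polyhedral_complex (divisor_complex \<phi> A)"
    by unfold_locales (rule divisor_complex_polyhedral[OF A])
  show "tropical_complex (divisor_complex \<phi> A)"
    unfolding tropical_complex_def
    using divisor_complex_polyhedral[OF A] divisor_complex_pure[OF A] balanced_transfer[OF wpc K(1) gen']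
    by blast
qed (rule K)

subsection \<open>Cones generated by part of a lattice basis\<close>

context
  fixes B :: "(real^'n) set"
  assumes B: "lattice_basis B"
begin

lemma lattice_basis_finite: "finite B"
  using B by (simp add: lattice_basis_def)

lemma lattice_basis_independent: "independent B"
  using B by (simp add: lattice_basis_def)

lemma lattice_basis_subset: "B \<subseteq> int_lattice"
  using B by (simp add: lattice_basis_def)

lemma lattice_basis_span: "span B = UNIV"
proof -
  have "int_lattice \<subseteq> span B"
  proof
    fix x :: "real^'n" assume "x \<in> int_lattice"
    then obtain a :: "real^'n \<Rightarrow> int" where "x = (\<Sum>v\<in>B. of_int (a v) *\<^sub>R v)"
      using B unfolding lattice_basis_def by auto
    then show "x \<in> span B" by (auto intro: span_sum span_scale span_base)
  qed
  then have "Basis \<subseteq> span B" using Basis_subset_int_lattice by auto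
  then have "span Basis \<subseteq> span B" by (rule span_minimal) simp
  then show ?thesis by auto
qed

lemma card_lattice_basis: "card B = CARD('n)"
proof -
  have "card B = dim (span B)" using lattice_basis_independent by (simp add: dim_eq_card_independent)
  then show ?thesis by (simp only: lattice_basis_span) simp
qed

lemma linear_coordinate: "linear (\<lambda>x. representation B x v)"
  by (rule linearI)
    (simp_all add: representation_add representation_scale lattice_basis_independent lattice_basis_span)

lemma coordinate_sum: "(\<Sum>v\<in>B. representation B x v *\<^sub>R v) = x"
  by (rule sum_representation_eq)
    (simp_all add: lattice_basis_independent lattice_basis_span lattice_basis_finite)

lemma coordinate_basis: "w \<in> B \<Longrightarrow> representation B w v = (if v = w then 1 else 0)"
  by (simp add: representation_basis lattice_basis_independent)

lemma coordinate_combination: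
  assumes "S \<subseteq> B"
  shows "representation B (\<Sum>w\<in>S. a w *\<^sub>R w) v = (if v \<in> S then a v else 0)"
proof -
  have fin: "finite S" using assms lattice_basis_finite finite_subset by blast
  have "representation B (\<Sum>w\<in>S. a w *\<^sub>R w) v = (\<Sum>w\<in>S. a w * representation B w v)"
    by (simp add: linear_sum[OF linear_coordinate] linear_scale[OF linear_coordinate])
  also have "\<dots> = (\<Sum>w\<in>S. if v = w then a w else 0)"
    by (rule sum.cong) (use assms in \<open>auto simp: coordinate_basis\<close>)
  also have "\<dots> = (if v \<in> S then a v else 0)" using fin by simp
  finally show ?thesis .
qed

lemma coordinate_int:
  assumes "x \<in> int_lattice"
  shows "representation B x v \<in> \<int>"
proof -
  obtain a :: "real^'n \<Rightarrow> int" where a: "x = (\<Sum>v\<in>B. of_int (a v) *\<^sub>R v)"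
    using B assms unfolding lattice_basis_def by auto
  show ?thesis unfolding a by (subst coordinate_combination) auto
qed

lemma coordinate_sum_subset:
  assumes "S \<subseteq> B" "\<forall>v\<in>B - S. representation B x v = 0"
  shows "(\<Sum>v\<in>S. representation B x v *\<^sub>R v) = x"
proof -
  have "(\<Sum>v\<in>S. representation B x v *\<^sub>R v) = (\<Sum>v\<in>B. representation B x v *\<^sub>R v)"
    by (rule sum.mono_neutral_left) (use assms lattice_basis_finite in auto)
  then show ?thesis by (simp add: coordinate_sum)
qed

lemma span_iff_coordinates:
  assumes "S \<subseteq> B"
  shows "x \<in> span S \<longleftrightarrow> (\<forall>v\<in>B - S. representation B x v = 0)"
proof
  have sub: "subspace {x. \<forall>v\<in>B - S. representation B x v = 0}"
    by (auto simp: subspace_def linear_add[OF linear_coordinate] linear_scale[OF linear_coordinate]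
        linear_0[OF linear_coordinate])
  have "span S \<subseteq> {x. \<forall>v\<in>B - S. representation B x v = 0}"
    by (rule span_minimal[OF _ sub]) (use assms coordinate_basis in auto)
  then show "x \<in> span S \<Longrightarrow> \<forall>v\<in>B - S. representation B x v = 0" by auto
next
  assume "\<forall>v\<in>B - S. representation B x v = 0"
  then have "x = (\<Sum>v\<in>S. representation B x v *\<^sub>R v)" using coordinate_sum_subset[OF assms] by simp
  moreover have "(\<Sum>v\<in>S. representation B x v *\<^sub>R v) \<in> span S"
    by (intro span_sum span_scale span_base)
  ultimately show "x \<in> span S" by simp
qed

lemma cone_iff_coordinates:
  assumes "S \<subseteq> B"
  shows "x \<in> convex_cone hull S \<longleftrightarrow>
    (\<forall>v\<in>B. 0 \<le> representation B x v) \<and> (\<forall>v\<in>B - S. representation B x v = 0)"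
    (is "_ \<longleftrightarrow> ?P x")
proof
  have "convex_cone {x. ?P x}"
    by (auto simp: convex_cone_iff linear_add[OF linear_coordinate] linear_scale[OF linear_coordinate]
        linear_0[OF linear_coordinate])
  moreover have "S \<subseteq> {x. ?P x}" using assms coordinate_basis by auto
  ultimately have "convex_cone hull S \<subseteq> {x. ?P x}" by (intro hull_minimal)
  then show "x \<in> convex_cone hull S \<Longrightarrow> ?P x" by auto
next
  assume P: "?P x"
  have "(\<Sum>v\<in>S. representation B x v *\<^sub>R v) \<in> convex_cone hull S"
  proof -
    have "(\<Sum>v\<in>F. representation B x v *\<^sub>R v) \<in> convex_cone hull S" if "finite F" "F \<subseteq> S" for F
      using that
    proof (induction F)
      case empty
      then show ?case by (simp add: convex_cone_hull_contains_0)
    next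
      case (insert v F)
      have "representation B x v *\<^sub>R v \<in> convex_cone hull S"
        by (intro convex_cone_hull_mul hull_inc) (use insert.prems assms P in auto)
      then show ?case using insert by (auto intro: convex_cone_hull_add)
    qed
    then show ?thesis using finite_subset[OF assms lattice_basis_finite] by auto
  qed
  then show "x \<in> convex_cone hull S" using coordinate_sum_subset[OF assms] P by simp
qed

lemma generator_in_cone_iff:
  assumes "S \<subseteq> B" "v \<in> B"
  shows "v \<in> convex_cone hull S \<longleftrightarrow> v \<in> S"
  using assms cone_iff_coordinates[OF assms(1)] coordinate_basis[OF assms(2)] by auto

lemma dir_space_cone: "dir_space (convex_cone hull S) = span (S :: (real^'n) set)"
proof -
  have "dir_space (convex_cone hull S) = span ((\<lambda>y. y - 0) ` (convex_cone hull S))"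
    by (rule dir_space_eq_span) (rule convex_cone_hull_contains_0)
  also have "\<dots> = span (convex_cone hull S)" by simp
  also have "\<dots> = span S"
  proof
    have "convex_cone (span S)"
      by (auto simp: convex_cone_iff span_zero span_add span_scale)
    then have "convex_cone hull S \<subseteq> span S" by (intro hull_minimal span_superset)
    then show "span (convex_cone hull S) \<subseteq> span S" by (rule span_minimal) simp
    show "span S \<subseteq> span (convex_cone hull S)" by (rule span_mono) (rule hull_subset)
  qed
  finally show ?thesis .
qed

lemma aff_dim_cone:
  assumes "S \<subseteq> B"
  shows "aff_dim (convex_cone hull S) = int (card S)"
  using aff_dim_eq_dim_dir_space[OF convex_cone_hull_nonempty, of S]
    independent_mono[OF lattice_basis_independent assms]
  by (simp add: dir_space_cone dim_eq_card_independent)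

text \<open>Coordinates outside \<open>S\<close> are nonnegative at both endpoints and vanish at an
  inner point of the segment, so they vanish at both endpoints.\<close>

lemma cone_face_of_cone:
  assumes "S \<subseteq> T" "T \<subseteq> B"
  shows "(convex_cone hull S) face_of (convex_cone hull T)"
  unfolding face_of_def
proof (intro conjI ballI impI)
  have SB: "S \<subseteq> B" using assms by auto
  show "convex_cone hull S \<subseteq> convex_cone hull T" using assms(1) by (rule hull_mono)
  show "convex (convex_cone hull S)" by (rule convex_convex_cone_hull)
  fix a b x assume a: "a \<in> convex_cone hull T" and b: "b \<in> convex_cone hull T"
    and x: "x \<in> convex_cone hull S" and seg: "x \<in> open_segment a b"
  obtain u where u: "0 < u" "u < 1" "x = (1 - u) *\<^sub>R a + u *\<^sub>R b" using seg by (auto simp: in_segment)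
  have "representation B a v = 0 \<and> representation B b v = 0" if v: "v \<in> B - S" for v
  proof -
    have "0 \<le> representation B a v" "0 \<le> representation B b v"
      using a b v cone_iff_coordinates[OF assms(2)] by auto
    moreover have "(1 - u) * representation B a v + u * representation B b v = 0"
      using x v cone_iff_coordinates[OF SB]
      by (simp add: u(3) linear_add[OF linear_coordinate] linear_scale[OF linear_coordinate])
    ultimately show ?thesis using u
      by (smt (verit, best) mult_nonneg_nonneg mult_eq_0_iff)
  qed
  then show "a \<in> convex_cone hull S" "b \<in> convex_cone hull S"
    using a b cone_iff_coordinates[OF assms(2)] cone_iff_coordinates[OF SB] by auto
qed

text \<open>\<open>x + y\<close> is the midpoint of \<open>2 *\<^sub>R x\<close> and
  \<open>2 *\<^sub>R y\<close>, so the face property applies. For \<open>x = y\<close> the open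
  segment is empty, but then \<open>x + y\<close> is itself \<open>2 *\<^sub>R x\<close>.\<close>

lemma face_of_cone_summand:
  fixes \<tau> \<sigma> :: "(real^'n) set"
  assumes "\<tau> face_of \<sigma>" "conic \<sigma>" "x \<in> \<sigma>" "y \<in> \<sigma>" "x + y \<in> \<tau>"
  shows "x \<in> \<tau>"
proof -
  have con: "conic \<tau>" by (rule face_of_conic[OF assms(2,1)])
  have "2 *\<^sub>R x \<in> \<tau>"
  proof (cases "x = y")
    case True
    then show ?thesis using assms(5) by (simp add: scaleR_2)
  next
    case False
    have "x + y = (1 - 1/2) *\<^sub>R (2 *\<^sub>R x) + (1/2) *\<^sub>R (2 *\<^sub>R y)" by simp
    then have "x + y \<in> open_segment (2 *\<^sub>R x) (2 *\<^sub>R y)"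
      using False by (auto simp: in_segment intro!: exI[of _ "1/2"])
    then show ?thesis
      using face_ofD[OF assms(1) _ conicD[OF assms(2,3)] conicD[OF assms(2,4)] assms(5)] by auto
  qed
  from conicD[OF con this, of "1/2"] show ?thesis by simp
qed

text \<open>A generator with nonzero coordinate in a point of the face is, up to scaling, a summand
  of that point, hence lies in the face.\<close>

lemma face_of_cone_eq:
  assumes "S \<subseteq> B" "\<tau> face_of (convex_cone hull S)" "\<tau> \<noteq> {}"
  shows "\<tau> = convex_cone hull (S \<inter> \<tau>)"
proof
  note con = face_of_conic[OF conic_convex_cone_hull assms(2)]
  have "0 \<in> \<tau>" using assms(3) conicD[OF con, of _ 0] by auto
  then have "convex_cone \<tau>"
    using con face_of_imp_convex[OF assms(2)] by (auto simp: convex_cone_def)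
  then show "convex_cone hull (S \<inter> \<tau>) \<subseteq> \<tau>" by (intro hull_minimal) auto
  show "\<tau> \<subseteq> convex_cone hull (S \<inter> \<tau>)"
  proof
    fix x assume x: "x \<in> \<tau>"
    then have xs: "x \<in> convex_cone hull S" using face_of_imp_subset[OF assms(2)] by auto
    then have r: "\<forall>v\<in>B. 0 \<le> representation B x v" "\<forall>v\<in>B - S. representation B x v = 0"
      using cone_iff_coordinates[OF assms(1)] by auto
    have "v \<in> \<tau>" if v: "v \<in> S" "representation B x v \<noteq> 0" for v
    proof -
      let ?r = "representation B x v"
      have vB: "v \<in> B" using v assms(1) by auto
      have "?r *\<^sub>R v \<in> convex_cone hull S"
        by (intro convex_cone_hull_mul hull_inc) (use v vB r in auto)
      moreover have "x - ?r *\<^sub>R v \<in> convex_cone hull S"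
        unfolding cone_iff_coordinates[OF assms(1)] linear_diff[OF linear_coordinate]
          linear_scale[OF linear_coordinate] coordinate_basis[OF vB]
        using r v by auto
      ultimately have "?r *\<^sub>R v \<in> \<tau>"
        by (rule face_of_cone_summand[OF assms(2) conic_convex_cone_hull]) (simp add: x)
      then have "(1 / ?r) *\<^sub>R (?r *\<^sub>R v) \<in> \<tau>"
        by (rule conicD[OF con]) (use vB r in auto)
      then show ?thesis using v by simp
    qed
    then have "\<forall>v\<in>B - S \<inter> \<tau>. representation B x v = 0" using r by blast
    then show "x \<in> convex_cone hull (S \<inter> \<tau>)"
      using r cone_iff_coordinates[of "S \<inter> \<tau>"] assms(1) by auto
  qed
qed

text \<open>The coordinate of \<open>v\<close> splits off the component along \<open>v\<close>; it
  is an integer on lattice vectors and nonnegative on the larger cone.\<close>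

lemma represents_normal_cone:
  assumes "v \<in> B - S" "S \<subseteq> B"
  shows "represents_normal (convex_cone hull (insert v S)) (convex_cone hull S) v"
proof -
  have sub: "insert v S \<subseteq> B" using assms by auto
  have vL: "v \<in> int_lattice" using assms lattice_basis_subset by auto
  have split: "w - representation B w v *\<^sub>R v \<in> span S" if "w \<in> span (insert v S)" for w
    using that assms unfolding span_iff_coordinates[OF sub] span_iff_coordinates[OF assms(2)]
    by (auto simp: linear_diff[OF linear_coordinate] linear_scale[OF linear_coordinate]
        coordinate_basis)
  show ?thesis
    unfolding represents_normal_def dir_lattice_def dir_space_cone
  proof (intro conjI ballI)
    show "v \<in> int_lattice \<inter> span (insert v S)" using vL by (simp add: span_base)
    show "int_lattice \<inter> span (insert v S) = {of_int a *\<^sub>R v + w |a w. w \<in> int_lattice \<inter> span S}"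
    proof
      have "span S \<subseteq> span (insert v S)" by (rule span_mono) auto
      then show "{of_int a *\<^sub>R v + w |a w. w \<in> int_lattice \<inter> span S} \<subseteq> int_lattice \<inter> span (insert v S)"
        using vL by (auto intro!: int_lattice_add int_lattice_scale span_add span_scale intro: span_base)
      show "int_lattice \<inter> span (insert v S) \<subseteq> {of_int a *\<^sub>R v + w |a w. w \<in> int_lattice \<inter> span S}"
      proof
        fix w assume w: "w \<in> int_lattice \<inter> span (insert v S)"
        obtain a where a: "representation B w v = of_int a"
          using coordinate_int[of w v] w by (auto elim: Ints_cases)
        have "w - of_int a *\<^sub>R v \<in> int_lattice \<inter> span S"
          using w split[of w] vL a by (auto intro!: int_lattice_diff int_lattice_scale)
        moreover have "w = of_int a *\<^sub>R v + (w - of_int a *\<^sub>R v)" by simp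
        ultimately show "w \<in> {of_int a *\<^sub>R v + w |a w. w \<in> int_lattice \<inter> span S}" by blast
      qed
    qed
    fix x y assume x: "x \<in> convex_cone hull S" and y: "y \<in> convex_cone hull (insert v S)"
    have xS: "x \<in> span S" using x span_iff_coordinates[OF assms(2)] cone_iff_coordinates[OF assms(2)] by auto
    have yS: "y \<in> span (insert v S)" using y span_iff_coordinates[OF sub] cone_iff_coordinates[OF sub] by auto
    have "0 \<le> representation B y v" using y assms cone_iff_coordinates[OF sub] by auto
    moreover have "(y - representation B y v *\<^sub>R v) - x \<in> span S"
      by (rule span_diff[OF split[OF yS] xS])
    then have "y - x - representation B y v *\<^sub>R v \<in> span S" by (simp add: algebra_simps)
    ultimately show "\<exists>t\<ge>0. y - x - t *\<^sub>R v \<in> span S" by blast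
  qed
qed

end

text \<open>A ray of the cone contains just one primitive lattice vector, so the generating lattice
  basis is unique.\<close>

lemma lattice_basis_cone_subset:
  fixes B B' :: "(real^'n) set"
  assumes B: "lattice_basis B" and B': "lattice_basis B'"
    and eq: "convex_cone hull B = convex_cone hull B'"
  shows "B \<subseteq> B'"
proof
  fix b assume b: "b \<in> B"
  let ?r = "convex_cone hull {b}"
  have "?r face_of (convex_cone hull B')"
    using cone_face_of_cone[OF B, of "{b}" B] b eq by auto
  then have r: "?r = convex_cone hull (B' \<inter> ?r)"
    by (rule face_of_cone_eq[OF B' order_refl _ convex_cone_hull_nonempty])
  \<comment> \<open>The ray is generated by the vectors of \<open>B'\<close> lying on it, so its
    dimension 1 counts them.\<close>
  have "int (card (B' \<inter> ?r)) = aff_dim ?r"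
    by (subst (2) r) (simp add: aff_dim_cone[OF B'])
  also have "\<dots> = 1" using aff_dim_cone[OF B, of "{b}"] b by simp
  finally have "card (B' \<inter> ?r) = 1" by simp
  then obtain b' where b': "B' \<inter> ?r = {b'}" by (auto simp: card_1_singleton_iff)
  then have b'B: "b' \<in> B'" "b' \<in> ?r" by auto
  have "b \<in> ?r" by (simp add: hull_inc)
  then have "b \<in> convex_cone hull {b'}" using r b' by simp
  then have "\<forall>v\<in>B' - {b'}. representation B' b v = 0"
    and p: "0 \<le> representation B' b b'"
    using cone_iff_coordinates[OF B', of "{b'}" b] b'B by auto
  from coordinate_sum_subset[OF B' _ this(1)] have bb: "representation B' b b' *\<^sub>R b' = b"
    using b'B by simp
  have "\<forall>v\<in>B - {b}. representation B b' v = 0"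
    using cone_iff_coordinates[OF B, of "{b}" b'] b b'B by auto
  from coordinate_sum_subset[OF B _ this] have bb': "representation B b' b *\<^sub>R b = b'"
    using b by simp
  \<comment> \<open>\<open>b\<close> and \<open>b'\<close> are integer multiples of each other, so
    the factors multiply to 1; nonnegativity of the coordinate excludes -1.\<close>
  obtain m n :: int where mn: "representation B' b b' = of_int m" "representation B b' b = of_int n"
    using coordinate_int[OF B', of b b'] coordinate_int[OF B, of b' b]
      lattice_basis_subset[OF B] lattice_basis_subset[OF B'] b b'B
    by (auto elim!: Ints_cases)
  have "b \<noteq> 0" using b lattice_basis_independent[OF B] dependent_zero by blast
  have "(of_int m * of_int n) *\<^sub>R b = b" using bb bb' mn by (metis scaleR_scaleR)
  then have "of_int m * of_int n = (1::real)" using \<open>b \<noteq> 0\<close>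
    by (metis scaleR_cancel_right scaleR_one)
  then have "m * n = 1" by (metis of_int_eq_1_iff of_int_mult)
  moreover have "m \<ge> 0" using p mn by simp
  ultimately have "m = 1" by (metis zmult_eq_1_iff mult_eq_0_iff not_one_le_zero order.trans zero_le_one neg_0_le_iff_le)
  then show "b \<in> B'" using bb mn b'B by simp
qed

lemma cone_basis_eq:
  assumes "lattice_basis B"
  shows "cone_basis (convex_cone hull B) = B"
  unfolding cone_basis_def
proof (rule the_equality)
  show "lattice_basis B \<and> convex_cone hull B = convex_cone hull B" using assms by simp
  fix B' assume "lattice_basis B' \<and> convex_cone hull B = convex_cone hull B'"
  then show "B' = B"
    using lattice_basis_cone_subset[of B B'] lattice_basis_cone_subset[of B' B] assms by auto
qed

subsection \<open>Sums of piecewise polynomials over a complete unimodular fan\<close>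

text \<open>Along the line from an interior point \<open>z\<close> to \<open>x\<close> the
  difference is a univariate polynomial with infinitely many zeros near \<open>z\<close>, hence it
  vanishes at \<open>x\<close>.\<close>

lemma real_polynomial_eq_on_open:
  fixes p q :: "real^'n \<Rightarrow> real"
  assumes p: "real_polynomial_function p" and q: "real_polynomial_function q"
    and eq: "\<And>x. x \<in> S \<Longrightarrow> p x = q x" and z: "z \<in> interior S"
  shows "p = q"
proof
  fix x
  obtain e where e: "e > 0" "ball z e \<subseteq> S" using z mem_interior by blast
  define h where "h t = z + t *\<^sub>R (x - z)" for t :: real
  define g where "g t = p (h t) - q (h t)" for t
  have h: "polynomial_function h"
    unfolding h_def by (intro polynomial_function_add polynomial_function_const)
      (auto intro!: polynomial_function_bounded_linear bounded_linear_intros)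
  have "real_polynomial_function (p \<circ> h)" "real_polynomial_function (q \<circ> h)"
    using real_polynomial_function_compose[OF h] p q by auto
  then have "real_polynomial_function g"
    using real_polynomial_function_diff[of "p \<circ> h" "q \<circ> h"] by (simp add: g_def[abs_def] o_def)
  then obtain a n where a: "g = (\<lambda>t. \<Sum>i\<le>n. a i * t ^ i)"
    unfolding real_polynomial_function_iff_sum by auto
  \<comment> \<open>Small enough to keep \<open>h t\<close> in the ball of radius \<open>e\<close>;
    adding 1 to the norm avoids division by zero for \<open>x = z\<close>.\<close>
  define d where "d = e / (norm (x - z) + 1)"
  have d: "d > 0" using e by (simp add: d_def add_nonneg_pos)
  have zero: "g t = 0" if "t \<in> {0<..<d}" for t
  proof -
    have "dist z (h t) = t * norm (x - z)" using that by (simp add: h_def dist_norm)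
    also have "\<dots> \<le> t * (norm (x - z) + 1)" using that by (intro mult_left_mono) auto
    also have "\<dots> < d * (norm (x - z) + 1)"
      using that by (intro mult_strict_right_mono) (auto simp: add_nonneg_pos)
    also have "\<dots> = e" using norm_ge_zero[of "x - z"] by (simp add: d_def add_nonneg_eq_0_iff)
    finally have "h t \<in> S" using e(2) by auto
    then show ?thesis using eq by (simp add: g_def)
  qed
  have "infinite {0<..<d}" using d by simp
  moreover have "{0<..<d} \<subseteq> {t. (\<Sum>i\<le>n. a i * t ^ i) = 0}" using zero unfolding a by auto
  ultimately have "infinite {t. (\<Sum>i\<le>n. a i * t ^ i) = 0}" using finite_subset by blast
  then have "\<forall>i\<le>n. a i = 0" using polyfun_rootbound_finite by blast
  then have "g 1 = 0" unfolding a by simp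
  then show "p x = q x" by (simp add: g_def h_def)
qed

lemma real_polynomial_linear: "linear (l :: real^'n \<Rightarrow> real) \<Longrightarrow> real_polynomial_function l"
  by (rule real_polynomial_function.intros(1)) (simp add: linear_conv_bounded_linear)

section \<open>Cones, cofaces and poles of a complete unimodular fan\<close>

locale complete_unimodular_fan =
  fixes \<Delta> :: "(real^'n::finite) set set"
  assumes complete: "complete_fan \<Delta>" and unimodular: "unimodular_fan \<Delta>"
begin

definition max_cones :: "(real^'n) set set" where
  "max_cones = cells_of_dim (int CARD('n)) \<Delta>"

definition cofaces :: "(real^'n) set \<Rightarrow> (real^'n) set set" where
  "cofaces \<tau> = {\<rho> \<in> \<Delta>. \<tau> facet_of \<rho>}"

definition conewise_linear :: "(real^'n \<Rightarrow> real) \<Rightarrow> bool" where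
  "conewise_linear \<phi> \<longleftrightarrow> (\<forall>\<sigma>\<in>\<Delta>. \<exists>l. linear l \<and> (\<forall>x\<in>\<sigma>. \<phi> x = l x))"

definition conewise_polynomial :: "(real^'n \<Rightarrow> real) \<Rightarrow> bool" where
  "conewise_polynomial f \<longleftrightarrow> (\<forall>\<sigma>\<in>max_cones. \<exists>p. real_polynomial_function p \<and> (\<forall>x\<in>\<sigma>. p x = f x))"

text \<open>The Katz--Payne sum is a rational function, handled only through its values where no
  denominator vanishes; elsewhere division by zero gives a meaningless value.\<close>

definition off_poles :: "(real^'n) set \<Rightarrow> real^'n \<Rightarrow> bool" where
  "off_poles \<tau> x \<longleftrightarrow> (\<forall>\<sigma>\<in>{\<sigma> \<in> max_cones. \<tau> \<subseteq> \<sigma>}. \<forall>v\<in>cone_basis \<sigma> - \<tau>. representation (cone_basis \<sigma>) x v \<noteq> 0)"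

definition kp_sum :: "(real^'n \<Rightarrow> real) \<Rightarrow> (real^'n) set \<Rightarrow> real^'n \<Rightarrow> real" where
  "kp_sum f \<tau> x = (\<Sum>\<sigma>\<in>{\<sigma> \<in> max_cones. \<tau> \<subseteq> \<sigma>}. e_factor \<sigma> \<tau> x * poly_on_cone f \<sigma> x)"

lemma fan_complex: "polyhedral_complex \<Delta>"
  using complete by (simp add: complete_fan_def rational_fan_def)

lemma finite_max_cones: "finite max_cones"
  using complex_finite[OF fan_complex] by (simp add: max_cones_def cells_of_dim_def)

lemma max_cone_in_fan: "\<sigma> \<in> max_cones \<Longrightarrow> \<sigma> \<in> \<Delta>"
  by (simp add: max_cones_def cells_of_dim_def)

lemma aff_dim_max_cone: "\<sigma> \<in> max_cones \<Longrightarrow> aff_dim \<sigma> = int CARD('n)"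
  by (simp add: max_cones_def cells_of_dim_def)

lemma max_cone_generated:
  assumes "\<sigma> \<in> max_cones"
  shows "lattice_basis (cone_basis \<sigma>)" "convex_cone hull (cone_basis \<sigma>) = \<sigma>"
proof -
  have s: "\<sigma> \<in> \<Delta>" "aff_dim \<sigma> = int CARD('n)" using assms by (auto simp: max_cones_def cells_of_dim_def)
  then obtain B S where B: "lattice_basis B" "S \<subseteq> B" "\<sigma> = convex_cone hull S"
    using unimodular unfolding unimodular_fan_def by blast
  have "card S = card B" using aff_dim_cone[OF B(1,2)] s card_lattice_basis[OF B(1)] B(3) by simp
  then have "S = B" using card_subset_eq[OF lattice_basis_finite[OF B(1)] B(2)] by simp
  then have sB: "\<sigma> = convex_cone hull B" using B by simp
  have "cone_basis \<sigma> = B" unfolding sB by (rule cone_basis_eq[OF B(1)])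
  then show "lattice_basis (cone_basis \<sigma>)" "convex_cone hull (cone_basis \<sigma>) = \<sigma>" using B(1) sB by auto
qed

text \<open>Points off the affine hulls of lower-dimensional cones are dense, and by completeness
  each lies in a maximal cone; a finite union of closed cones contains the closure.\<close>

lemma Union_max_cones: "\<Union>max_cones = UNIV"
proof -
  define F where "F = (\<lambda>\<tau>. affine hull \<tau>) ` {\<tau> \<in> \<Delta>. aff_dim \<tau> < int CARD('n)}"
  have "finite F" using complex_finite[OF fan_complex] by (simp add: F_def)
  moreover have "affine S \<and> \<not> UNIV \<subseteq> S" if SF: "S \<in> F" for S :: "(real^'n) set"
  proof -
    obtain \<tau> where t: "S = affine hull \<tau>" "aff_dim \<tau> < int CARD('n)" using SF by (auto simp: F_def)
    have "S \<noteq> UNIV"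
    proof
      assume "S = UNIV"
      then have "aff_dim \<tau> = aff_dim (UNIV :: (real^'n) set)" using t(1) by (metis aff_dim_affine_hull)
      then show False using t(2) by simp
    qed
    then show ?thesis using t by (auto simp: affine_affine_hull)
  qed
  ultimately have "(UNIV :: (real^'n) set) \<subseteq> closure {x \<in> rel_interior UNIV. \<forall>T\<in>F. x \<notin> T}"
    by (rule generic_points_dense[OF convex_UNIV])
  also have "\<dots> \<subseteq> \<Union>max_cones"
  proof (rule closure_minimal)
    show "{x \<in> rel_interior UNIV. \<forall>T\<in>F. x \<notin> T} \<subseteq> \<Union>max_cones"
    proof
      fix x assume x: "x \<in> {x \<in> rel_interior UNIV. \<forall>T\<in>F. x \<notin> T}"
      obtain \<sigma> where s: "\<sigma> \<in> \<Delta>" "x \<in> \<sigma>" using complete unfolding complete_fan_def by blast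
      then have "\<not> aff_dim \<sigma> < int CARD('n)" using x hull_inc[OF s(2), of affine] unfolding F_def by auto
      moreover have "aff_dim \<sigma> \<le> int CARD('n)" using aff_dim_le_DIM[of \<sigma>] by simp
      ultimately have "\<sigma> \<in> max_cones" using s by (simp add: max_cones_def cells_of_dim_def)
      then show "x \<in> \<Union>max_cones" using s by auto
    qed
    show "closed (\<Union>max_cones)"
      using finite_max_cones complex_closed[OF fan_complex] max_cone_in_fan by (intro closed_Union) auto
  qed
  finally show ?thesis by auto
qed

lemma subset_max_cone:
  assumes "\<tau> \<in> \<Delta>"
  obtains \<sigma> where "\<sigma> \<in> max_cones" "\<tau> \<subseteq> \<sigma>"
proof -
  obtain x where x: "x \<in> rel_interior \<tau>"
    using complex_nonempty[OF fan_complex assms] complex_convex[OF fan_complex assms]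
      rel_interior_eq_empty by auto
  obtain \<sigma> where s: "\<sigma> \<in> max_cones" "x \<in> \<sigma>" using Union_max_cones by blast
  have "\<tau> face_of \<sigma>"
    by (rule complex_face_if_rel_interior[OF fan_complex assms max_cone_in_fan[OF s(1)] x s(2)])
  then show thesis using that s face_of_imp_subset by auto
qed

context
  fixes \<sigma> \<tau> :: "(real^'n) set"
  assumes \<sigma>: "\<sigma> \<in> max_cones" and \<tau>: "\<tau> \<in> \<Delta>" and sub: "\<tau> \<subseteq> \<sigma>"
begin

lemma face_generated: "convex_cone hull (cone_basis \<sigma> \<inter> \<tau>) = \<tau>"
proof -
  have "\<tau> face_of (convex_cone hull (cone_basis \<sigma>))"
    using complex_subset_imp_face[OF fan_complex \<tau> max_cone_in_fan[OF \<sigma>] sub] max_cone_generated[OF \<sigma>] by simp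
  from face_of_cone_eq[OF max_cone_generated(1)[OF \<sigma>] order_refl this complex_nonempty[OF fan_complex \<tau>]]
  show ?thesis ..
qed

lemma aff_dim_face: "aff_dim \<tau> = int (card (cone_basis \<sigma> \<inter> \<tau>))"
  using aff_dim_cone[OF max_cone_generated(1)[OF \<sigma>], of "cone_basis \<sigma> \<inter> \<tau>"] face_generated by simp

end

lemma cone_in_fan:
  assumes "\<sigma> \<in> max_cones" "S \<subseteq> cone_basis \<sigma>"
  shows "convex_cone hull S \<in> \<Delta>" "convex_cone hull S \<subseteq> \<sigma>" "cone_basis \<sigma> \<inter> (convex_cone hull S) = S"
proof -
  note B = max_cone_generated[OF assms(1)]
  have "(convex_cone hull S) face_of \<sigma>"
    using cone_face_of_cone[OF B(1) assms(2) order_refl] B(2) by simp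
  then show "convex_cone hull S \<in> \<Delta>" "convex_cone hull S \<subseteq> \<sigma>"
    using complex_face[OF fan_complex max_cone_in_fan[OF assms(1)] _ convex_cone_hull_nonempty]
      face_of_imp_subset by auto
  show "cone_basis \<sigma> \<inter> (convex_cone hull S) = S"
    using generator_in_cone_iff[OF B(1) assms(2)] assms(2) by auto
qed

text \<open>Adding one generator to \<open>\<tau>\<close> is the only way to obtain a coface inside
  \<open>\<sigma>\<close>. Turns a sum over generators outside \<open>\<tau>\<close> into a sum over
  cofaces.\<close>

lemma bij_cofaces:
  assumes \<sigma>: "\<sigma> \<in> max_cones" and \<tau>: "\<tau> \<in> \<Delta>" and sub: "\<tau> \<subseteq> \<sigma>"
  shows "bij_betw (\<lambda>v. convex_cone hull (insert v (cone_basis \<sigma> \<inter> \<tau>))) (cone_basis \<sigma> - \<tau>)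
    {\<rho> \<in> cofaces \<tau>. \<rho> \<subseteq> \<sigma>}"
  unfolding bij_betw_def
proof
  let ?B = "cone_basis \<sigma>" and ?c = "\<lambda>v. convex_cone hull (insert v (cone_basis \<sigma> \<inter> \<tau>))"
  have fin: "finite ?B" by (rule lattice_basis_finite[OF max_cone_generated(1)[OF \<sigma>]])
  have Bc: "?B \<inter> ?c v = insert v (?B \<inter> \<tau>)" if "v \<in> ?B - \<tau>" for v
    by (rule cone_in_fan(3)[OF \<sigma>]) (use that in auto)
  show "inj_on ?c (?B - \<tau>)"
  proof (rule inj_onI)
    fix v w assume v: "v \<in> ?B - \<tau>" and w: "w \<in> ?B - \<tau>" and "?c v = ?c w"
    then have "insert v (?B \<inter> \<tau>) = insert w (?B \<inter> \<tau>)" using Bc by metis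
    then show "v = w" using v w by auto
  qed
  show "?c ` (?B - \<tau>) = {\<rho> \<in> cofaces \<tau>. \<rho> \<subseteq> \<sigma>}"
  proof (intro equalityI subsetI)
    fix \<rho> assume "\<rho> \<in> ?c ` (?B - \<tau>)"
    then obtain v where v: "v \<in> ?B - \<tau>" "\<rho> = ?c v" by auto
    have r: "\<rho> \<in> \<Delta>" "\<rho> \<subseteq> \<sigma>" using cone_in_fan[OF \<sigma>, of "insert v (?B \<inter> \<tau>)"] v by auto
    have "\<tau> \<subseteq> \<rho>"
      using hull_mono[of "?B \<inter> \<tau>" "insert v (?B \<inter> \<tau>)" convex_cone] face_generated[OF \<sigma> \<tau> sub] v(2) by auto
    then have face: "\<tau> face_of \<rho>" by (rule complex_subset_imp_face[OF fan_complex \<tau> r(1)])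
    have "aff_dim \<rho> = aff_dim \<tau> + 1"
      using aff_dim_face[OF \<sigma> r] aff_dim_face[OF \<sigma> \<tau> sub] Bc[OF v(1)] v fin by simp
    then have "\<tau> facet_of \<rho>"
      using face complex_nonempty[OF fan_complex \<tau>] by (simp add: facet_of_def)
    then show "\<rho> \<in> {\<rho> \<in> cofaces \<tau>. \<rho> \<subseteq> \<sigma>}" using r by (simp add: cofaces_def)
  next
    fix \<rho> assume "\<rho> \<in> {\<rho> \<in> cofaces \<tau>. \<rho> \<subseteq> \<sigma>}"
    then have r: "\<rho> \<in> \<Delta>" "\<rho> \<subseteq> \<sigma>" "\<tau> facet_of \<rho>" by (auto simp: cofaces_def)
    have sub': "?B \<inter> \<tau> \<subseteq> ?B \<inter> \<rho>" using facet_of_imp_subset[OF r(3)] by auto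
    have "aff_dim \<rho> = aff_dim \<tau> + 1" using r(3) by (simp add: facet_of_def)
    then have "card (?B \<inter> \<rho>) = card (?B \<inter> \<tau>) + 1"
      using aff_dim_face[OF \<sigma> r(1,2)] aff_dim_face[OF \<sigma> \<tau> sub] by simp
    then have "card ((?B \<inter> \<rho>) - (?B \<inter> \<tau>)) = 1"
      using card_Diff_subset[OF _ sub'] fin by simp
    then obtain v where v: "(?B \<inter> \<rho>) - (?B \<inter> \<tau>) = {v}" by (auto simp: card_1_singleton_iff)
    then have "?B \<inter> \<rho> = insert v (?B \<inter> \<tau>)" using sub' by auto
    then have "\<rho> = ?c v" using face_generated[OF \<sigma> r(1,2)] by simp
    moreover have "v \<in> ?B - \<tau>" using v by auto
    ultimately show "\<rho> \<in> ?c ` (?B - \<tau>)" by auto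
  qed
qed

lemma off_poles_exists: "\<exists>x. off_poles \<tau> x"
proof -
  define F where "F = (\<Union>\<sigma>\<in>{\<sigma> \<in> max_cones. \<tau> \<subseteq> \<sigma>}. (\<lambda>v. {x. representation (cone_basis \<sigma>) x v = 0}) ` (cone_basis \<sigma> - \<tau>))"
  have "\<exists>x\<in>rel_interior UNIV. \<forall>T\<in>F. x \<notin> T"
  proof (rule generic_point_exists)
    show "finite F" unfolding F_def
      using finite_max_cones lattice_basis_finite[OF max_cone_generated(1)] by auto
    fix T assume "T \<in> F"
    then obtain \<sigma> v where s: "\<sigma> \<in> max_cones" "v \<in> cone_basis \<sigma>" "T = {x. representation (cone_basis \<sigma>) x v = 0}"
      unfolding F_def by auto
    note B = max_cone_generated(1)[OF s(1)]
    have "subspace T" unfolding s(3) by (rule linear_subspace_kernel[OF linear_coordinate[OF B]])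
    moreover have "v \<notin> T" using coordinate_basis[OF B s(2)] s(3) by simp
    ultimately show "affine T \<and> \<not> UNIV \<subseteq> T" by (auto intro: subspace_imp_affine)
  qed auto
  then show ?thesis unfolding F_def off_poles_def by auto
qed

text \<open>A larger cone lies in fewer maximal cones and leaves fewer generators outside, so one
  point serves \<open>\<tau>\<close> and all its cofaces in the recursion.\<close>

lemma off_poles_mono: "off_poles \<tau> x \<Longrightarrow> \<tau> \<subseteq> \<rho> \<Longrightarrow> off_poles \<rho> x"
  unfolding off_poles_def by auto

lemma poly_on_cone_eq:
  assumes "\<sigma> \<in> max_cones" "real_polynomial_function p" "\<And>x. x \<in> \<sigma> \<Longrightarrow> p x = f x"
  shows "poly_on_cone f \<sigma> = p"
  unfolding poly_on_cone_def
proof (rule the_equality)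
  show "real_polynomial_function p \<and> (\<forall>x\<in>\<sigma>. p x = f x)" using assms by auto
  have conv: "convex \<sigma>" by (rule complex_convex[OF fan_complex max_cone_in_fan[OF assms(1)]])
  have "affine hull \<sigma> = UNIV" using aff_dim_eq_full aff_dim_max_cone[OF assms(1)] by fastforce
  then have "interior \<sigma> \<noteq> {}"
    using rel_interior_interior[of \<sigma>] rel_interior_eq_empty[OF conv]
      complex_nonempty[OF fan_complex max_cone_in_fan[OF assms(1)]] by auto
  then obtain z where z: "z \<in> interior \<sigma>" by auto
  fix q assume q: "real_polynomial_function q \<and> (\<forall>x\<in>\<sigma>. q x = f x)"
  show "q = p" by (rule real_polynomial_eq_on_open[OF _ assms(2) _ z]) (use q assms in auto)
qed

lemma poly_on_cone_mult:
  assumes "\<sigma> \<in> max_cones" "conewise_polynomial f" "linear l" "\<And>y. y \<in> \<sigma> \<Longrightarrow> \<phi> y = l y"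
  shows "poly_on_cone (\<lambda>x. \<phi> x * f x) \<sigma> x = l x * poly_on_cone f \<sigma> x"
proof -
  obtain p where p: "real_polynomial_function p" "\<And>x. x \<in> \<sigma> \<Longrightarrow> p x = f x"
    using assms(1,2) unfolding conewise_polynomial_def by auto
  have "poly_on_cone f \<sigma> = p" by (rule poly_on_cone_eq[OF assms(1) p])
  moreover have "poly_on_cone (\<lambda>x. \<phi> x * f x) \<sigma> = (\<lambda>x. l x * p x)"
    by (rule poly_on_cone_eq[OF assms(1)])
      (use p assms(4) in \<open>auto intro: real_polynomial_function.intros(4) real_polynomial_linear[OF assms(3)]\<close>)
  ultimately show ?thesis by simp
qed

lemma conewise_polynomial_mult:
  assumes "conewise_linear \<phi>" "conewise_polynomial f"
  shows "conewise_polynomial (\<lambda>x. \<phi> x * f x)"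
  unfolding conewise_polynomial_def
proof
  fix \<sigma> assume s: "\<sigma> \<in> max_cones"
  obtain l where l: "linear l" "\<forall>x\<in>\<sigma>. \<phi> x = l x"
    using assms(1) max_cone_in_fan[OF s] unfolding conewise_linear_def by auto
  obtain p where p: "real_polynomial_function p" "\<forall>x\<in>\<sigma>. p x = f x"
    using assms(2) s unfolding conewise_polynomial_def by auto
  show "\<exists>q. real_polynomial_function q \<and> (\<forall>x\<in>\<sigma>. q x = \<phi> x * f x)"
    by (rule exI[of _ "\<lambda>x. l x * p x"])
      (use l p real_polynomial_linear in \<open>auto intro: real_polynomial_function.intros(4)\<close>)
qed

lemma conewise_polynomial_prod_list:
  "(\<And>\<phi>. \<phi> \<in> set \<phi>s \<Longrightarrow> conewise_linear \<phi>) \<Longrightarrow> conewise_polynomial (\<lambda>x. \<Prod>\<phi>\<leftarrow>\<phi>s. \<phi> x)"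
proof (induction \<phi>s)
  case Nil
  show ?case
    unfolding conewise_polynomial_def
    by (auto intro!: exI[of _ "\<lambda>_. 1"] real_polynomial_function.intros(2))
next
  case (Cons \<phi> \<phi>s)
  then show ?case using conewise_polynomial_mult by simp
qed

text \<open>The recursion on which everything rests: on a maximal cone \<open>\<sigma> \<supseteq> \<tau>\<close> with basis \<open>v\<^sub>1, \<dots>, v\<^sub>n\<close>,
  \<open>\<phi> = l + \<Sum> (\<phi> - l)(v\<^sub>i) v\<^sub>i\<^sup>*\<close> where the sum extends over the \<open>v\<^sub>i\<close> outside \<open>\<tau>\<close>, and
  \<open>v\<^sub>i\<^sup>* e\<^sub>\<sigma>\<^sub>\<tau> = e\<^sub>\<sigma>\<^sub>\<rho>\<close> for the cone \<open>\<rho>\<close> spanned by \<open>\<tau>\<close> and \<open>v\<^sub>i\<close>.\<close>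

lemma kp_sum_mult:
  assumes phi: "conewise_linear \<phi>" and f: "conewise_polynomial f" and \<tau>: "\<tau> \<in> \<Delta>"
    and l: "linear l" "\<And>y. y \<in> \<tau> \<Longrightarrow> \<phi> y = l y" and x: "off_poles \<tau> x"
  shows "kp_sum (\<lambda>x. \<phi> x * f x) \<tau> x =
    (\<Sum>\<rho>\<in>cofaces \<tau>. (linear_part \<phi> \<rho> (normal_vec \<rho> \<tau>) - l (normal_vec \<rho> \<tau>)) * kp_sum f \<rho> x)
    + l x * kp_sum f \<tau> x"
proof -
  let ?n = "\<lambda>\<rho>. linear_part \<phi> \<rho> (normal_vec \<rho> \<tau>) - l (normal_vec \<rho> \<tau>)"
  let ?M = "{\<sigma> \<in> max_cones. \<tau> \<subseteq> \<sigma>}"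
  have fin: "finite (cofaces \<tau>)" using complex_finite[OF fan_complex] by (simp add: cofaces_def)
  have one: "e_factor \<sigma> \<tau> x * poly_on_cone (\<lambda>x. \<phi> x * f x) \<sigma> x =
      (\<Sum>\<rho>\<in>{\<rho> \<in> cofaces \<tau>. \<rho> \<subseteq> \<sigma>}. ?n \<rho> * (e_factor \<sigma> \<rho> x * poly_on_cone f \<sigma> x))
      + l x * (e_factor \<sigma> \<tau> x * poly_on_cone f \<sigma> x)" if "\<sigma> \<in> ?M" for \<sigma>
  proof -
    have s: "\<sigma> \<in> max_cones" "\<tau> \<subseteq> \<sigma>" using that by auto
    let ?B = "cone_basis \<sigma>" and ?c = "\<lambda>v. convex_cone hull (insert v (cone_basis \<sigma> \<inter> \<tau>))"
    let ?r = "\<lambda>v. representation (cone_basis \<sigma>) x v"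
    note B = max_cone_generated[OF s(1)]
    have finB: "finite ?B" by (rule lattice_basis_finite[OF B(1)])
    obtain ls where ls: "linear ls" "\<And>y. y \<in> \<sigma> \<Longrightarrow> \<phi> y = ls y"
      using phi max_cone_in_fan[OF s(1)] unfolding conewise_linear_def by auto
    have Bs: "v \<in> \<sigma>" if "v \<in> ?B" for v
    proof -
      have "v \<in> convex_cone hull ?B" using that by (rule hull_inc)
      then show ?thesis using B(2) by simp
    qed
    \<comment> \<open>The coefficient depends on the coface only, not on \<open>\<sigma>\<close>:
      \<open>v\<close> and \<open>normal_vec\<close> differ by an element of
      \<open>V_\<tau>\<close>, where \<open>ls\<close> and \<open>l\<close> agree. This lets the
      factor leave the sum over maximal cones after the sums are exchanged.\<close>
    have coef: "ls v - l v = ?n (?c v)" if v: "v \<in> ?B - \<tau>" for v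
    proof -
      let ?\<rho> = "?c v"
      have r: "?\<rho> \<in> cofaces \<tau>" "?\<rho> \<subseteq> \<sigma>" using bij_betw_apply[OF bij_cofaces[OF s(1) \<tau> s(2)] v] by auto
      have rD: "?\<rho> \<in> \<Delta>" "\<tau> facet_of ?\<rho>" using r by (auto simp: cofaces_def)
      have repv: "represents_normal ?\<rho> \<tau> v"
        using represents_normal_cone[OF B(1), of v "?B \<inter> \<tau>"] v face_generated[OF s(1) \<tau> s(2)] by auto
      have repn: "represents_normal ?\<rho> \<tau> (normal_vec ?\<rho> \<tau>)"
        by (rule represents_normal_normal_vec[OF fan_complex rD(1) \<tau> rD(2)])
      have d: "v - normal_vec ?\<rho> \<tau> \<in> dir_space \<tau>"
        by (rule represents_normal_unique[OF repv repn rD(2) complex_convex[OF fan_complex rD(1)]])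
      have "ls (v - normal_vec ?\<rho> \<tau>) = l (v - normal_vec ?\<rho> \<tau>)"
      proof (rule linear_eq_on_dir_space[OF ls(1) l(1) _ d, of 0 0])
        fix y assume y: "y \<in> \<tau>"
        then show "ls y + 0 = l y + 0" using ls(2)[of y] l(2)[OF y] s by auto
      qed
      then have "ls v - l v = ls (normal_vec ?\<rho> \<tau>) - l (normal_vec ?\<rho> \<tau>)"
        by (simp add: linear_diff[OF ls(1)] linear_diff[OF l(1)])
      moreover have "linear_part \<phi> ?\<rho> (normal_vec ?\<rho> \<tau>) = ls (normal_vec ?\<rho> \<tau>)"
        by (rule linear_part_eq[of ls ?\<rho> \<phi> 0])
          (use ls r repn in \<open>auto simp: represents_normal_def dir_lattice_def\<close>)
      ultimately show ?thesis by simp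
    qed
    have e: "?r v * e_factor \<sigma> \<tau> x = e_factor \<sigma> (?c v) x" if v: "v \<in> ?B - \<tau>" for v
    proof -
      have "?B \<inter> ?c v = insert v (?B \<inter> \<tau>)" by (rule cone_in_fan(3)[OF s(1)]) (use v in auto)
      then have "?B - ?c v = (?B - \<tau>) - {v}" by auto
      moreover have "e_factor \<sigma> \<tau> x = 1 / ?r v * (\<Prod>w\<in>(?B - \<tau>) - {v}. 1 / ?r w)"
        unfolding e_factor_def by (rule prod.remove) (use v finB in auto)
      moreover have "?r v \<noteq> 0" using x v s unfolding off_poles_def by auto
      ultimately show ?thesis unfolding e_factor_def by simp
    qed
    have lin: "linear (\<lambda>y. ls y - l y)" using ls(1) l(1) by (rule linear_compose_sub)
    have "ls x - l x = (\<lambda>y. ls y - l y) (\<Sum>v\<in>?B. ?r v *\<^sub>R v)"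
      by (simp only: coordinate_sum[OF B(1)])
    also have "\<dots> = (\<Sum>v\<in>?B. ?r v * (ls v - l v))"
      by (simp add: linear_sum[OF lin] linear_scale[OF lin] right_diff_distrib
          linear_scale[OF ls(1)] linear_scale[OF l(1)])
    also have "\<dots> = (\<Sum>v\<in>?B - \<tau>. ?r v * (ls v - l v))"
    proof (rule sum.mono_neutral_right[OF finB Diff_subset], rule ballI)
      fix v assume "v \<in> ?B - (?B - \<tau>)"
      then have "ls v = l v" using ls(2)[of v] l(2)[of v] Bs[of v] by auto
      then show "?r v * (ls v - l v) = 0" by simp
    qed
    finally have lsx: "ls x = l x + (\<Sum>v\<in>?B - \<tau>. ?r v * (ls v - l v))" by simp
    have "e_factor \<sigma> \<tau> x * ls x
        = (\<Sum>v\<in>?B - \<tau>. (ls v - l v) * (?r v * e_factor \<sigma> \<tau> x)) + l x * e_factor \<sigma> \<tau> x"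
      unfolding lsx by (simp add: distrib_left sum_distrib_left mult_ac)
    also have "(\<Sum>v\<in>?B - \<tau>. (ls v - l v) * (?r v * e_factor \<sigma> \<tau> x)) =
        (\<Sum>v\<in>?B - \<tau>. ?n (?c v) * e_factor \<sigma> (?c v) x)"
      by (rule sum.cong) (simp_all only: e coef)
    also have "\<dots> = (\<Sum>\<rho>\<in>{\<rho> \<in> cofaces \<tau>. \<rho> \<subseteq> \<sigma>}. ?n \<rho> * e_factor \<sigma> \<rho> x)"
      by (rule sum.reindex_bij_betw[OF bij_cofaces[OF s(1) \<tau> s(2)]])
    finally have main: "e_factor \<sigma> \<tau> x * ls x
        = (\<Sum>\<rho>\<in>{\<rho> \<in> cofaces \<tau>. \<rho> \<subseteq> \<sigma>}. ?n \<rho> * e_factor \<sigma> \<rho> x) + l x * e_factor \<sigma> \<tau> x" .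
    have "e_factor \<sigma> \<tau> x * poly_on_cone (\<lambda>x. \<phi> x * f x) \<sigma> x
        = (e_factor \<sigma> \<tau> x * ls x) * poly_on_cone f \<sigma> x"
      using poly_on_cone_mult[OF s(1) f ls] by simp
    then show ?thesis
      unfolding main by (simp add: distrib_right sum_distrib_right mult.assoc)
  qed
  have "kp_sum (\<lambda>x. \<phi> x * f x) \<tau> x =
      (\<Sum>\<sigma>\<in>?M. \<Sum>\<rho>\<in>{\<rho> \<in> cofaces \<tau>. \<rho> \<subseteq> \<sigma>}. ?n \<rho> * (e_factor \<sigma> \<rho> x * poly_on_cone f \<sigma> x))
      + l x * kp_sum f \<tau> x"
    unfolding kp_sum_def sum_distrib_left sum.distrib[symmetric]
    by (rule sum.cong[OF refl]) (rule one)
  also have "(\<Sum>\<sigma>\<in>?M. \<Sum>\<rho>\<in>{\<rho> \<in> cofaces \<tau>. \<rho> \<subseteq> \<sigma>}. ?n \<rho> * (e_factor \<sigma> \<rho> x * poly_on_cone f \<sigma> x))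
      = (\<Sum>\<rho>\<in>cofaces \<tau>. \<Sum>\<sigma>\<in>{\<sigma> \<in> ?M. \<rho> \<subseteq> \<sigma>}. ?n \<rho> * (e_factor \<sigma> \<rho> x * poly_on_cone f \<sigma> x))"
    by (rule sum.swap_restrict) (use fin finite_max_cones in auto)
  also have "\<dots> = (\<Sum>\<rho>\<in>cofaces \<tau>. ?n \<rho> * kp_sum f \<rho> x)"
  proof (rule sum.cong[OF refl])
    fix \<rho> assume "\<rho> \<in> cofaces \<tau>"
    then have "\<tau> \<subseteq> \<rho>" using facet_of_imp_subset by (auto simp: cofaces_def)
    then have "{\<sigma> \<in> ?M. \<rho> \<subseteq> \<sigma>} = {\<sigma> \<in> max_cones. \<rho> \<subseteq> \<sigma>}" by auto
    then show "(\<Sum>\<sigma>\<in>{\<sigma> \<in> ?M. \<rho> \<subseteq> \<sigma>}. ?n \<rho> * (e_factor \<sigma> \<rho> x * poly_on_cone f \<sigma> x)) = ?n \<rho> * kp_sum f \<rho> x"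
      unfolding kp_sum_def sum_distrib_left by simp
  qed
  finally show ?thesis .
qed

end

subsection \<open>The Katz--Payne complexes of products of linear functions\<close>

abbreviation (input) pointwise_prod :: "(real^'n \<Rightarrow> real) list \<Rightarrow> real^'n \<Rightarrow> real" where
  "pointwise_prod \<phi>s \<equiv> \<lambda>x. \<Prod>\<phi>\<leftarrow>\<phi>s. \<phi> x"

definition whole_space :: "'n::finite weighted_complex" where
  "whole_space = WComplex (int CARD('n)) {UNIV} (\<lambda>_. 1)"

lemma Rn_cycle_eq: "Rn_cycle = cycle_of whole_space"
  by (simp add: Rn_cycle_def whole_space_def)

lemma supp_cells_whole_space: "supp_cells (whole_space :: 'n::finite weighted_complex) = {UNIV}"
  by (auto simp: supp_cells_iff whole_space_def)

text \<open>The only nonempty face of the space is the space itself, so balancing is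
  vacuous.\<close>

lemma tropical_whole_space: "tropical_complex (whole_space :: 'n::finite weighted_complex)"
  unfolding tropical_complex_def
proof (intro conjI ballI)
  have "rational_polyhedron (UNIV :: (real^'n) set)"
    unfolding rational_polyhedron_def by (intro exI[of _ "{}"]) auto
  moreover have "\<tau> = UNIV" if "\<tau> face_of (UNIV :: (real^'n) set)" "\<tau> \<noteq> {}" for \<tau>
    using face_of_affine_trivial[OF affine_UNIV that(1)] that(2) by auto
  ultimately show "polyhedral_complex (cells (whole_space :: 'n weighted_complex))"
    unfolding polyhedral_complex_def by (auto simp: whole_space_def intro: face_of_refl)
  show "\<exists>\<sigma>\<in>max_cells (whole_space :: 'n weighted_complex). \<tau> \<subseteq> \<sigma>"
    if "\<tau> \<in> cells (whole_space :: 'n weighted_complex)" for \<tau>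
    by (auto simp: max_cells_iff whole_space_def)
  show "normal_sum (whole_space :: 'n weighted_complex) \<tau> \<in> dir_space \<tau>"
    if "\<tau> \<in> cells_of_dim (dimension (whole_space :: 'n weighted_complex) - 1) (cells (whole_space :: 'n weighted_complex))" for \<tau>
    using that by (auto simp: whole_space_def cells_of_dim_def)
qed

section \<open>Shape of the Katz--Payne complexes, degree zero, and vanishing\<close>

context complete_unimodular_fan
begin

text \<open>A point off the poles exists, so the integer in the definite description is
  unique.\<close>

lemma kp_weight_eqI:
  assumes "\<And>x. off_poles \<tau> x \<Longrightarrow> kp_sum f \<tau> x = of_int N"
  shows "kp_weight f \<Delta> \<tau> = N"
proof -
  obtain z where z: "off_poles \<tau> z" using off_poles_exists by auto
  have "(THE c. \<forall>x. off_poles \<tau> x \<longrightarrow> kp_sum f \<tau> x = of_int c) = N"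
  proof (rule the_equality)
    show "\<forall>x. off_poles \<tau> x \<longrightarrow> kp_sum f \<tau> x = of_int N" using assms by auto
    fix c :: int assume "\<forall>x. off_poles \<tau> x \<longrightarrow> kp_sum f \<tau> x = of_int c"
    then have "of_int c = (of_int N :: real)" using z assms by metis
    then show "c = N" by simp
  qed
  then show ?thesis
    by (simp add: kp_weight_def Let_def off_poles_def kp_sum_def max_cones_def)
qed

lemma kp_sum_one_max:
  assumes "\<sigma> \<in> max_cones"
  shows "kp_sum (pointwise_prod []) \<sigma> x = 1"
proof -
  have eq: "{\<sigma>' \<in> max_cones. \<sigma> \<subseteq> \<sigma>'} = {\<sigma>}"
  proof -
    have "\<sigma>' = \<sigma>" if s: "\<sigma>' \<in> max_cones" "\<sigma> \<subseteq> \<sigma>'" for \<sigma>'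
    proof (rule ccontr)
      assume "\<sigma>' \<noteq> \<sigma>"
      then have "aff_dim \<sigma> < aff_dim \<sigma>'"
        using face_of_aff_dim_lt[OF complex_convex[OF fan_complex max_cone_in_fan[OF s(1)]]
          complex_subset_imp_face[OF fan_complex max_cone_in_fan[OF assms] max_cone_in_fan[OF s(1)] s(2)]]
        by auto
      then show False using aff_dim_max_cone assms s by simp
    qed
    then show ?thesis using assms by auto
  qed
  have "cone_basis \<sigma> \<subseteq> \<sigma>"
    using hull_subset[of "cone_basis \<sigma>" convex_cone] max_cone_generated(2)[OF assms] by simp
  then have "cone_basis \<sigma> - \<sigma> = {}" by auto
  then have "e_factor \<sigma> \<sigma> x = 1" unfolding e_factor_def by (simp only: prod.empty)
  moreover have "poly_on_cone (pointwise_prod []) \<sigma> = (\<lambda>_. 1)"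
    by (rule poly_on_cone_eq[OF assms real_polynomial_function.intros(2)]) simp
  ultimately show ?thesis unfolding kp_sum_def eq by simp
qed

lemma kp_weight_one_max: "\<sigma> \<in> max_cones \<Longrightarrow> kp_weight (pointwise_prod []) \<Delta> \<sigma> = 1"
  by (rule kp_weight_eqI) (simp only: kp_sum_one_max of_int_1)

lemma max_cells_kp_complex:
  "\<sigma> \<in> max_cells (kp_complex k f \<Delta>) \<longleftrightarrow> \<sigma> \<in> \<Delta> \<and> aff_dim \<sigma> = int CARD('n) - int k"
  by (auto simp: max_cells_iff kp_complex_def)

lemma kp_complex_polyhedral: "polyhedral_complex (cells (kp_complex k f \<Delta>))"
proof (rule polyhedral_subcomplex[OF fan_complex])
  show "cells (kp_complex k f \<Delta>) \<subseteq> \<Delta>" by (auto simp: kp_complex_def)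
  fix \<sigma> \<tau> assume s: "\<sigma> \<in> cells (kp_complex k f \<Delta>)" and t: "\<tau> face_of \<sigma>" "\<tau> \<noteq> {}"
  have "\<tau> \<in> \<Delta>" by (rule complex_face[OF fan_complex _ t]) (use s in \<open>simp add: kp_complex_def\<close>)
  moreover have "aff_dim \<tau> \<le> aff_dim \<sigma>" using t by (intro aff_dim_subset face_of_imp_subset)
  ultimately show "\<tau> \<in> cells (kp_complex k f \<Delta>)" using s by (auto simp: kp_complex_def)
qed

lemma kp_complex_pure:
  assumes "\<tau> \<in> cells (kp_complex k f \<Delta>)"
  shows "\<exists>\<sigma>\<in>max_cells (kp_complex k f \<Delta>). \<tau> \<subseteq> \<sigma>"
proof -
  have t: "\<tau> \<in> \<Delta>" "aff_dim \<tau> \<le> int CARD('n) - int k" using assms by (auto simp: kp_complex_def)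
  obtain \<sigma> where s: "\<sigma> \<in> max_cones" "\<tau> \<subseteq> \<sigma>" using subset_max_cone[OF t(1)] .
  note B = max_cone_generated(1)[OF s(1)]
  let ?m = "CARD('n) - k"
  \<comment> \<open>This inequality of integers also yields \<open>k \<le> CARD('n)\<close>, so the
    truncated subtraction in \<open>?m\<close> is harmless.\<close>
  have card: "int (card (cone_basis \<sigma> \<inter> \<tau>)) \<le> int CARD('n) - int k"
    using aff_dim_face[OF s(1) t(1) s(2)] t(2) by simp
  then have "card (cone_basis \<sigma> \<inter> \<tau>) \<le> ?m" by linarith
  then obtain S where S: "cone_basis \<sigma> \<inter> \<tau> \<subseteq> S" "S \<subseteq> cone_basis \<sigma>" "card S = ?m"
    using exists_subset_between[of "cone_basis \<sigma> \<inter> \<tau>" ?m "cone_basis \<sigma>"] card_lattice_basis[OF B]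
      lattice_basis_finite[OF B] by auto
  have "aff_dim (convex_cone hull S) = int CARD('n) - int k"
    using aff_dim_cone[OF B S(2)] S(3) card by simp
  then have "convex_cone hull S \<in> max_cells (kp_complex k f \<Delta>)"
    using cone_in_fan(1)[OF s(1) S(2)] by (simp add: max_cells_kp_complex)
  moreover have "\<tau> \<subseteq> convex_cone hull S"
    using hull_mono[OF S(1), of convex_cone] face_generated[OF s(1) t(1) s(2)] by simp
  ultimately show ?thesis by auto
qed

lemma adjacent_cells_kp_complex:
  assumes "aff_dim \<tau> = int CARD('n) - int k - 1"
  shows "adjacent_cells (kp_complex k f \<Delta>) \<tau> = cofaces \<tau>"
  using assms by (auto simp: adjacent_cells_def cofaces_def max_cells_kp_complex facet_of_def)

text \<open>In degree zero all maximal weights are 1, so the fan subdivides the whole space. Its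
  balancing is not yet known at this point and will follow from this lemma by transfer.\<close>

lemma kp_complex_one_generically_equal:
  "generically_equal (kp_complex 0 (pointwise_prod []) \<Delta>) whole_space"
proof -
  let ?K = "kp_complex 0 (pointwise_prod []) \<Delta>"
  have wpc: "weighted_polyhedral_complex ?K"
    by unfold_locales (rule kp_complex_polyhedral)
  have max: "max_cells ?K = max_cones"
    by (auto simp: max_cells_kp_complex max_cones_def cells_of_dim_def)
  have weight: "weight ?K \<sigma> = 1" if "\<sigma> \<in> max_cones" for \<sigma>
    using kp_weight_one_max[OF that] by (simp add: kp_complex_def)
  then have supp: "supp_cells ?K = max_cones" unfolding supp_cells_def max by auto
  show ?thesis
  proof (rule generically_equal_if_refined[OF tropical_complex_imp_wpc[OF tropical_whole_space] wpc])
    show "dimension ?K = dimension (whole_space :: 'n weighted_complex)"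
      by (simp add: kp_complex_def whole_space_def)
    show "\<Union>(supp_cells ?K) = \<Union>(supp_cells whole_space)"
      unfolding supp supp_cells_whole_space using Union_max_cones by simp
    show "\<exists>\<sigma>\<in>supp_cells whole_space. \<rho> \<subseteq> \<sigma> \<and> weight ?K \<rho> = weight whole_space \<sigma>"
      if "\<rho> \<in> supp_cells ?K" for \<rho>
      using that weight unfolding supp supp_cells_whole_space by (simp add: whole_space_def)
  qed
qed

lemma tropical_kp_complex_one: "tropical_complex (kp_complex 0 (pointwise_prod []) \<Delta>)"
proof -
  have wpc: "weighted_polyhedral_complex (kp_complex 0 (pointwise_prod []) \<Delta>)"
    by unfold_locales (rule kp_complex_polyhedral)
  show ?thesis
    unfolding tropical_complex_def
    using kp_complex_polyhedral kp_complex_pure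
      balanced_transfer[OF wpc tropical_whole_space kp_complex_one_generically_equal] by blast
qed

text \<open>The two primitive normals at a wall are opposite modulo the wall. Reading this off from
  balancing in degree zero avoids counting the maximal cones at a wall.\<close>

lemma normal_sum_wall:
  assumes "\<tau> \<in> \<Delta>" "aff_dim \<tau> = int CARD('n) - 1"
  shows "(\<Sum>\<rho>\<in>cofaces \<tau>. normal_vec \<rho> \<tau>) \<in> dir_space \<tau>"
proof -
  let ?K = "kp_complex 0 (pointwise_prod []) \<Delta>"
  have "normal_sum ?K \<tau> \<in> dir_space \<tau>"
    using tropical_kp_complex_one assms
    by (auto simp: tropical_complex_def cells_of_dim_def kp_complex_def)
  moreover have "normal_sum ?K \<tau> = (\<Sum>\<rho>\<in>cofaces \<tau>. normal_vec \<rho> \<tau>)"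
  proof -
    have adj: "adjacent_cells ?K \<tau> = cofaces \<tau>" by (rule adjacent_cells_kp_complex) (simp add: assms)
    have "weight ?K \<rho> = 1" if "\<rho> \<in> cofaces \<tau>" for \<rho>
    proof -
      have "\<rho> \<in> max_cones"
        using that assms by (auto simp: cofaces_def max_cones_def cells_of_dim_def facet_of_def)
      then show ?thesis using kp_weight_one_max by (simp add: kp_complex_def)
    qed
    then show ?thesis unfolding normal_sum_def adj by (intro sum.cong) auto
  qed
  ultimately show ?thesis by simp
qed

text \<open>The recursion for the zero function, with \<open>l\<close> as its linear extension from
  \<open>\<tau>\<close>: the sum of the product is zero, which leaves this identity.\<close>

lemma kp_sum_annihilator:
  assumes f: "conewise_polynomial f" and \<tau>: "\<tau> \<in> \<Delta>" and x: "off_poles \<tau> x"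
    and l: "linear l" "\<And>y. y \<in> \<tau> \<Longrightarrow> l y = 0"
  shows "l x * kp_sum f \<tau> x = (\<Sum>\<rho>\<in>cofaces \<tau>. l (normal_vec \<rho> \<tau>) * kp_sum f \<rho> x)"
proof -
  have zero: "conewise_linear (\<lambda>_. 0)"
    unfolding conewise_linear_def by (auto intro!: exI[of _ "\<lambda>_. 0"] linear_zero)
  have "kp_sum (\<lambda>x. 0 * f x) \<tau> x = 0"
    unfolding kp_sum_def
  proof (rule sum.neutral, rule ballI)
    fix \<sigma> assume "\<sigma> \<in> {\<sigma> \<in> max_cones. \<tau> \<subseteq> \<sigma>}"
    then have s: "\<sigma> \<in> max_cones" by simp
    have "poly_on_cone (\<lambda>x. 0 * f x) \<sigma> x = 0 * poly_on_cone f \<sigma> x"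
      by (rule poly_on_cone_mult[OF s f linear_zero]) simp
    then show "e_factor \<sigma> \<tau> x * poly_on_cone (\<lambda>x. 0 * f x) \<sigma> x = 0" by simp
  qed
  moreover have "linear_part (\<lambda>_. 0) \<rho> (normal_vec \<rho> \<tau>) = 0" if "\<rho> \<in> cofaces \<tau>" for \<rho>
  proof -
    have r: "\<rho> \<in> \<Delta>" "\<tau> facet_of \<rho>" using that by (auto simp: cofaces_def)
    have "normal_vec \<rho> \<tau> \<in> dir_space \<rho>"
      using represents_normal_normal_vec[OF fan_complex r(1) \<tau> r(2)]
      by (simp add: represents_normal_def dir_lattice_def)
    from linear_part_eq[OF linear_zero _ this, of "\<lambda>_. 0" 0] show ?thesis by simp
  qed
  ultimately have "0 = (\<Sum>\<rho>\<in>cofaces \<tau>. (0 - l (normal_vec \<rho> \<tau>)) * kp_sum f \<rho> x) + l x * kp_sum f \<tau> x"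
    using kp_sum_mult[OF zero f \<tau> l(1) _ x] l(2) by simp
  then show ?thesis by (simp add: sum_negf)
qed

text \<open>The dual coordinate of a generator outside \<open>\<tau>\<close> vanishes on
  \<open>\<tau>\<close> but not at \<open>x\<close>, so it suffices that the sum over cofaces is
  zero. For walls this is the cancellation of normals, in higher codimension the induction
  hypothesis.\<close>

lemma kp_sum_one_zero:
  assumes "\<tau> \<in> \<Delta>" "aff_dim \<tau> < int CARD('n)" "off_poles \<tau> x"
  shows "kp_sum (pointwise_prod []) \<tau> x = 0"
  using assms
proof (induction "nat (int CARD('n) - aff_dim \<tau>)" arbitrary: \<tau> rule: less_induct)
  case less
  obtain \<sigma> where s: "\<sigma> \<in> max_cones" "\<tau> \<subseteq> \<sigma>" using subset_max_cone[OF less.prems(1)] .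
  note B = max_cone_generated(1)[OF s(1)]
  have poly: "conewise_polynomial (pointwise_prod [])" by (rule conewise_polynomial_prod_list) simp
  have "cone_basis \<sigma> \<inter> \<tau> \<noteq> cone_basis \<sigma>"
    using aff_dim_face[OF s(1) less.prems(1) s(2)] less.prems(2) card_lattice_basis[OF B] by auto
  then obtain v where v: "v \<in> cone_basis \<sigma>" "v \<notin> \<tau>" by auto
  let ?l = "\<lambda>y. representation (cone_basis \<sigma>) y v"
  have lx: "?l x \<noteq> 0" using less.prems(3) s v unfolding off_poles_def by auto
  have l0: "?l y = 0" if y: "y \<in> \<tau>" for y
    using y cone_iff_coordinates[OF B, of "cone_basis \<sigma> \<inter> \<tau>" y]
      face_generated[OF s(1) less.prems(1) s(2)] v by auto
  have lin: "linear ?l" by (rule linear_coordinate[OF B])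
  have eq: "?l x * kp_sum (pointwise_prod []) \<tau> x
      = (\<Sum>\<rho>\<in>cofaces \<tau>. ?l (normal_vec \<rho> \<tau>) * kp_sum (pointwise_prod []) \<rho> x)"
    by (rule kp_sum_annihilator[OF poly less.prems(1,3) lin l0])
  have r: "\<rho> \<in> \<Delta>" "aff_dim \<rho> = aff_dim \<tau> + 1" "off_poles \<rho> x" if "\<rho> \<in> cofaces \<tau>" for \<rho>
    using that off_poles_mono[OF less.prems(3)] facet_of_imp_subset[of \<tau> \<rho>]
    by (auto simp: cofaces_def facet_of_def)
  have "(\<Sum>\<rho>\<in>cofaces \<tau>. ?l (normal_vec \<rho> \<tau>) * kp_sum (pointwise_prod []) \<rho> x) = 0"
  proof (cases "aff_dim \<tau> = int CARD('n) - 1")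
    case True
    have "kp_sum (pointwise_prod []) \<rho> x = 1" if "\<rho> \<in> cofaces \<tau>" for \<rho>
      by (rule kp_sum_one_max) (use r[OF that] True in \<open>simp add: max_cones_def cells_of_dim_def\<close>)
    then have "(\<Sum>\<rho>\<in>cofaces \<tau>. ?l (normal_vec \<rho> \<tau>) * kp_sum (pointwise_prod []) \<rho> x)
        = ?l (\<Sum>\<rho>\<in>cofaces \<tau>. normal_vec \<rho> \<tau>)"
      by (simp add: linear_sum[OF lin])
    also have "\<dots> = 0"
      using linear_eq_on_dir_space[OF lin linear_zero _ normal_sum_wall[OF less.prems(1) True], of 0 0] l0
      by simp
    finally show ?thesis .
  next
    case False
    have "kp_sum (pointwise_prod []) \<rho> x = 0" if "\<rho> \<in> cofaces \<tau>" for \<rho>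
      by (rule less.hyps) (use r[OF that] False less.prems(2) in auto)
    then show ?thesis by simp
  qed
  then show ?case using eq lx by simp
qed

text \<open>Removing a factor lowers the degree by one while passing to a coface raises the
  dimension by one, so the strict inequality holds for every term of the recursion.\<close>

lemma kp_sum_zero:
  assumes "\<And>\<phi>. \<phi> \<in> set \<phi>s \<Longrightarrow> conewise_linear \<phi>" "\<tau> \<in> \<Delta>" "aff_dim \<tau> + int (length \<phi>s) < int CARD('n)"
    "off_poles \<tau> x"
  shows "kp_sum (pointwise_prod \<phi>s) \<tau> x = 0"
  using assms
proof (induction \<phi>s arbitrary: \<tau>)
  case Nil
  then show ?case using kp_sum_one_zero by simp
next
  case (Cons \<phi> \<phi>s)
  have phi: "conewise_linear \<phi>" and phis: "\<And>\<psi>. \<psi> \<in> set \<phi>s \<Longrightarrow> conewise_linear \<psi>"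
    using Cons.prems(1) by auto
  have poly: "conewise_polynomial (pointwise_prod \<phi>s)" by (rule conewise_polynomial_prod_list[OF phis])
  obtain l where l: "linear l" "\<And>y. y \<in> \<tau> \<Longrightarrow> \<phi> y = l y"
    using phi Cons.prems(2) unfolding conewise_linear_def by auto
  have "kp_sum (pointwise_prod \<phi>s) \<rho> x = 0" if "\<rho> \<in> cofaces \<tau>" for \<rho>
    by (rule Cons.IH[OF phis])
      (use that Cons.prems off_poles_mono[OF Cons.prems(4), of \<rho>] facet_of_imp_subset[of \<tau> \<rho>] in
        \<open>auto simp: cofaces_def facet_of_def\<close>)
  moreover have "kp_sum (pointwise_prod \<phi>s) \<tau> x = 0"
    by (rule Cons.IH[OF phis]) (use Cons.prems in auto)
  moreover have "kp_sum (pointwise_prod (\<phi> # \<phi>s)) \<tau> x =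
    (\<Sum>\<rho>\<in>cofaces \<tau>. (linear_part \<phi> \<rho> (normal_vec \<rho> \<tau>) - l (normal_vec \<rho> \<tau>)) * kp_sum (pointwise_prod \<phi>s) \<rho> x)
    + l x * kp_sum (pointwise_prod \<phi>s) \<tau> x"
    using kp_sum_mult[OF phi poly Cons.prems(2) l Cons.prems(4)] by simp
  ultimately show ?case by simp
qed

text \<open>In contrast to \<open>int_form_on\<close>, integrality is demanded on the whole lattice,
  since the form for \<open>\<tau>\<close> is evaluated at normal vectors of cofaces, which lie
  outside \<open>V_\<tau>\<close>.\<close>

definition conewise_integral :: "(real^'n \<Rightarrow> real) \<Rightarrow> bool" where
  "conewise_integral \<phi> \<longleftrightarrow> (\<forall>\<sigma>\<in>\<Delta>. \<exists>l. linear l \<and> (\<forall>v\<in>int_lattice. l v \<in> \<int>) \<and> (\<forall>x\<in>\<sigma>. \<phi> x = l x))"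

lemma conewise_integralE:
  assumes "conewise_integral \<phi>" "\<sigma> \<in> \<Delta>"
  obtains l where "linear l" "\<And>v. v \<in> int_lattice \<Longrightarrow> l v \<in> \<int>" "\<And>x. x \<in> \<sigma> \<Longrightarrow> \<phi> x = l x"
  using assms unfolding conewise_integral_def by auto

lemma conewise_integral_imp_linear: "conewise_integral \<phi> \<Longrightarrow> conewise_linear \<phi>"
  unfolding conewise_integral_def conewise_linear_def by blast

section \<open>Integrality, balancing and divisors of the Katz--Payne weights\<close>

lemma normal_vec_cofaces:
  assumes "\<tau> \<in> \<Delta>" "\<rho> \<in> cofaces \<tau>"
  shows "normal_vec \<rho> \<tau> \<in> int_lattice" "normal_vec \<rho> \<tau> \<in> dir_space \<rho>"
  using represents_normal_normal_vec[OF fan_complex _ assms(1), of \<rho>] assms(2)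
  by (auto simp: cofaces_def represents_normal_def dir_lattice_def)

text \<open>The codimension of \<open>\<tau>\<close> exceeds the degree of the product over
  \<open>\<phi>s\<close> by one, so the term with the factor \<open>l x\<close> drops out and no
  dependence on \<open>x\<close> remains. The hypothesis \<open>spec\<close> is the statement for
  the shorter list, so that the lemma can be used inside the induction proving it.\<close>

lemma kp_sum_Cons_weight:
  assumes phi: "conewise_integral \<phi>" and phis: "\<And>\<psi>. \<psi> \<in> set \<phi>s \<Longrightarrow> conewise_integral \<psi>"
    and \<tau>: "\<tau> \<in> \<Delta>" "aff_dim \<tau> = int CARD('n) - int (length \<phi>s) - 1" and x: "off_poles \<tau> x"
    and l: "linear l" "\<And>y. y \<in> \<tau> \<Longrightarrow> \<phi> y = l y"
    and spec: "\<And>\<rho> x. \<rho> \<in> \<Delta> \<Longrightarrow> aff_dim \<rho> = int CARD('n) - int (length \<phi>s) \<Longrightarrow> off_poles \<rho> x \<Longrightarrow>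
      kp_sum (pointwise_prod \<phi>s) \<rho> x = of_int (kp_weight (pointwise_prod \<phi>s) \<Delta> \<rho>)"
  shows "kp_sum (pointwise_prod (\<phi> # \<phi>s)) \<tau> x =
    (\<Sum>\<rho>\<in>cofaces \<tau>. (linear_part \<phi> \<rho> (normal_vec \<rho> \<tau>) - l (normal_vec \<rho> \<tau>))
       * of_int (kp_weight (pointwise_prod \<phi>s) \<Delta> \<rho>))"
proof -
  have poly: "conewise_polynomial (pointwise_prod \<phi>s)"
    by (rule conewise_polynomial_prod_list) (use phis conewise_integral_imp_linear in auto)
  have "kp_sum (pointwise_prod \<phi>s) \<tau> x = 0"
    by (rule kp_sum_zero) (use phis conewise_integral_imp_linear \<tau> x in auto)
  moreover have "kp_sum (pointwise_prod \<phi>s) \<rho> x = of_int (kp_weight (pointwise_prod \<phi>s) \<Delta> \<rho>)"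
    if "\<rho> \<in> cofaces \<tau>" for \<rho>
    by (rule spec) (use that \<tau> off_poles_mono[OF x, of \<rho>] facet_of_imp_subset[of \<tau> \<rho>] in
        \<open>auto simp: cofaces_def facet_of_def\<close>)
  ultimately show ?thesis
    using kp_sum_mult[OF conewise_integral_imp_linear[OF phi] poly \<tau>(1) l x] by simp
qed

text \<open>The recursion expresses the sum by weights of a shorter product with coefficients free
  of the point; these are integers because the linear forms are integral on normal vectors.\<close>

lemma kp_sum_eq_kp_weight:
  assumes "\<And>\<phi>. \<phi> \<in> set \<phi>s \<Longrightarrow> conewise_integral \<phi>" "\<tau> \<in> \<Delta>" "aff_dim \<tau> = int CARD('n) - int (length \<phi>s)"
    "off_poles \<tau> x"
  shows "kp_sum (pointwise_prod \<phi>s) \<tau> x = of_int (kp_weight (pointwise_prod \<phi>s) \<Delta> \<tau>)"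
  using assms
proof (induction \<phi>s arbitrary: \<tau> x)
  case Nil
  then have "\<tau> \<in> max_cones" by (simp add: max_cones_def cells_of_dim_def)
  then show ?case by (simp only: kp_sum_one_max kp_weight_one_max of_int_1)
next
  case (Cons \<phi> \<phi>s)
  have phi: "conewise_integral \<phi>" and phis: "\<And>\<psi>. \<psi> \<in> set \<phi>s \<Longrightarrow> conewise_integral \<psi>"
    using Cons.prems(1) by auto
  obtain l where l: "linear l" "\<And>v. v \<in> int_lattice \<Longrightarrow> l v \<in> \<int>" "\<And>y. y \<in> \<tau> \<Longrightarrow> \<phi> y = l y"
    by (rule conewise_integralE[OF phi Cons.prems(2)]) (rule that)
  have dim: "aff_dim \<tau> = int CARD('n) - int (length \<phi>s) - 1" using Cons.prems(3) by simp
  let ?R = "\<Sum>\<rho>\<in>cofaces \<tau>. (linear_part \<phi> \<rho> (normal_vec \<rho> \<tau>) - l (normal_vec \<rho> \<tau>))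
       * of_int (kp_weight (pointwise_prod \<phi>s) \<Delta> \<rho>)"
  have "?R \<in> \<int>"
  proof (rule Ints_sum)
    fix \<rho> assume r: "\<rho> \<in> cofaces \<tau>"
    then have "\<rho> \<in> \<Delta>" by (simp add: cofaces_def)
    then obtain m where m: "linear m" "\<And>v. v \<in> int_lattice \<Longrightarrow> m v \<in> \<int>" "\<And>y. y \<in> \<rho> \<Longrightarrow> \<phi> y = m y"
      by (rule conewise_integralE[OF phi]) (rule that)
    note nv = normal_vec_cofaces[OF Cons.prems(2) r]
    have "linear_part \<phi> \<rho> (normal_vec \<rho> \<tau>) = m (normal_vec \<rho> \<tau>)"
      by (rule linear_part_eq[OF m(1) _ nv(2), of \<phi> 0]) (simp add: m(3))
    then show "(linear_part \<phi> \<rho> (normal_vec \<rho> \<tau>) - l (normal_vec \<rho> \<tau>))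
       * of_int (kp_weight (pointwise_prod \<phi>s) \<Delta> \<rho>) \<in> \<int>"
      using m(2)[OF nv(1)] l(2)[OF nv(1)] by simp
  qed
  then obtain N where N: "?R = of_int N" by (auto elim: Ints_cases)
  have sum: "kp_sum (pointwise_prod (\<phi> # \<phi>s)) \<tau> y = of_int N" if y: "off_poles \<tau> y" for y
    unfolding N[symmetric]
    by (rule kp_sum_Cons_weight[OF phi phis Cons.prems(2) dim y l(1,3)])
      (use Cons.IH[OF phis] in auto)
  have "kp_weight (pointwise_prod (\<phi> # \<phi>s)) \<Delta> \<tau> = N" by (rule kp_weight_eqI[OF sum])
  then show ?case using sum[OF Cons.prems(4)] by simp
qed

text \<open>Pair the normal sum with its own projection \<open>?a\<close>. The form
  \<open>?a \<bullet> y\<close> vanishes on \<open>\<tau>\<close>, so the annihilator identity makes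
  the pairing a multiple of a vanishing Katz--Payne sum. The pairing is the squared norm of
  \<open>?a\<close>, whence \<open>?a = 0\<close>.\<close>

lemma tropical_kp_complex:
  assumes phis: "\<And>\<phi>. \<phi> \<in> set \<phi>s \<Longrightarrow> conewise_integral \<phi>"
  shows "tropical_complex (kp_complex (length \<phi>s) (pointwise_prod \<phi>s) \<Delta>)" (is "tropical_complex ?K")
  unfolding tropical_complex_def
proof (intro conjI ballI)
  show "polyhedral_complex (cells ?K)" by (rule kp_complex_polyhedral)
  show "\<exists>\<sigma>\<in>max_cells ?K. \<tau> \<subseteq> \<sigma>" if "\<tau> \<in> cells ?K" for \<tau> using that by (rule kp_complex_pure)
  fix \<tau> assume "\<tau> \<in> cells_of_dim (dimension ?K - 1) (cells ?K)"
  then have t: "\<tau> \<in> \<Delta>" "aff_dim \<tau> = int CARD('n) - int (length \<phi>s) - 1"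
    by (auto simp: cells_of_dim_def kp_complex_def)
  have lin: "\<And>\<phi>. \<phi> \<in> set \<phi>s \<Longrightarrow> conewise_linear \<phi>" using phis conewise_integral_imp_linear by auto
  have poly: "conewise_polynomial (pointwise_prod \<phi>s)" by (rule conewise_polynomial_prod_list[OF lin])
  obtain x where x: "off_poles \<tau> x" using off_poles_exists by auto
  have zero: "kp_sum (pointwise_prod \<phi>s) \<tau> x = 0" by (rule kp_sum_zero[OF lin t(1) _ x]) (use t in auto)
  let ?a = "orth_proj (dir_space \<tau>) (normal_sum ?K \<tau>)"
  note sT = subspace_dir_space[of \<tau>]
  have l: "linear (\<lambda>y. ?a \<bullet> y)" by (simp add: bounded_linear.linear bounded_linear_inner_right)
  have l0: "?a \<bullet> y = 0" if "y \<in> \<tau>" for y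
  proof -
    have "0 \<in> \<tau>"
    proof -
      obtain \<sigma> where s: "\<sigma> \<in> max_cones" "\<tau> \<subseteq> \<sigma>" using subset_max_cone[OF t(1)] .
      show ?thesis using convex_cone_hull_contains_0[of "cone_basis \<sigma> \<inter> \<tau>"] face_generated[OF s(1) t(1) s(2)] by simp
    qed
    then have "y \<in> dir_space \<tau>" using diff_in_dir_space[OF that, of 0] by simp
    then show ?thesis by (rule orth_proj_orthogonal[OF sT])
  qed
  have weights: "kp_sum (pointwise_prod \<phi>s) \<rho> x = of_int (weight ?K \<rho>)" if "\<rho> \<in> cofaces \<tau>" for \<rho>
  proof -
    have "kp_sum (pointwise_prod \<phi>s) \<rho> x = of_int (kp_weight (pointwise_prod \<phi>s) \<Delta> \<rho>)"
      by (rule kp_sum_eq_kp_weight[OF phis])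
        (use that t off_poles_mono[OF x, of \<rho>] facet_of_imp_subset[of \<tau> \<rho>] in
          \<open>auto simp: cofaces_def facet_of_def\<close>)
    then show ?thesis by (simp add: kp_complex_def)
  qed
  have adj: "adjacent_cells ?K \<tau> = cofaces \<tau>" by (rule adjacent_cells_kp_complex[OF t(2)])
  have "?a \<bullet> normal_sum ?K \<tau> = (\<Sum>\<rho>\<in>cofaces \<tau>. ?a \<bullet> normal_vec \<rho> \<tau> * kp_sum (pointwise_prod \<phi>s) \<rho> x)"
    unfolding normal_sum_def adj inner_sum_right
    by (rule sum.cong) (auto simp: weights)
  also have "\<dots> = ?a \<bullet> x * kp_sum (pointwise_prod \<phi>s) \<tau> x"
    using kp_sum_annihilator[OF poly t(1) x l l0] by simp
  finally have "?a \<bullet> normal_sum ?K \<tau> = 0" using zero by simp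
  moreover have "?a \<bullet> (normal_sum ?K \<tau> - ?a) = 0"
    by (rule orth_proj_orthogonal[OF sT orth_proj_diff[OF sT]])
  ultimately have "?a = 0" by (simp add: inner_diff_right)
  then show "normal_sum ?K \<tau> \<in> dir_space \<tau>" by (simp add: orth_proj_zero_iff sT)
qed

lemma divisor_weight_kp_complex:
  assumes phi: "conewise_integral \<phi>" and phis: "\<And>\<psi>. \<psi> \<in> set \<phi>s \<Longrightarrow> conewise_integral \<psi>"
    and \<tau>: "\<tau> \<in> \<Delta>" "aff_dim \<tau> = int CARD('n) - int (length \<phi>s) - 1"
  shows "divisor_weight \<phi> (kp_complex (length \<phi>s) (pointwise_prod \<phi>s) \<Delta>) \<tau> =
    kp_weight (pointwise_prod (\<phi> # \<phi>s)) \<Delta> \<tau>"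
proof -
  let ?K = "kp_complex (length \<phi>s) (pointwise_prod \<phi>s) \<Delta>"
  obtain l where l: "linear l" "\<And>v. v \<in> int_lattice \<Longrightarrow> l v \<in> \<int>" "\<And>y. y \<in> \<tau> \<Longrightarrow> \<phi> y = l y"
    by (rule conewise_integralE[OF phi \<tau>(1)]) (rule that)
  obtain x where x: "off_poles \<tau> x" using off_poles_exists by auto
  have adj: "adjacent_cells ?K \<tau> = cofaces \<tau>" by (rule adjacent_cells_kp_complex[OF \<tau>(2)])
  \<comment> \<open>\<open>linear_part \<phi> \<tau>\<close> is determined on
    \<open>V_\<tau>\<close> only, so balancing has to be known before it may be replaced by
    \<open>l\<close>.\<close>
  have "normal_sum ?K \<tau> \<in> dir_space \<tau>"
    using tropical_kp_complex[OF phis] \<tau>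
    by (auto simp: tropical_complex_def cells_of_dim_def kp_complex_def)
  then have "linear_part \<phi> \<tau> (normal_sum ?K \<tau>) = l (normal_sum ?K \<tau>)"
    by (intro linear_part_eq[OF l(1), of \<tau> \<phi> 0]) (auto simp: l(3))
  then have "(\<Sum>\<sigma>\<in>adjacent_cells ?K \<tau>. of_int (weight ?K \<sigma>) * linear_part \<phi> \<sigma> (normal_vec \<sigma> \<tau>))
       - linear_part \<phi> \<tau> (normal_sum ?K \<tau>) =
    (\<Sum>\<rho>\<in>cofaces \<tau>. (linear_part \<phi> \<rho> (normal_vec \<rho> \<tau>) - l (normal_vec \<rho> \<tau>))
       * of_int (kp_weight (pointwise_prod \<phi>s) \<Delta> \<rho>))"
    unfolding normal_sum_def adj
    by (simp add: linear_sum[OF l(1)] linear_scale[OF l(1)] sum_subtractf[symmetric] kp_complex_def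
        algebra_simps)
  also have "\<dots> = kp_sum (pointwise_prod (\<phi> # \<phi>s)) \<tau> x"
    by (rule kp_sum_Cons_weight[OF phi phis \<tau> x l(1,3), symmetric])
      (use kp_sum_eq_kp_weight[OF phis] in auto)
  also have "\<dots> = of_int (kp_weight (pointwise_prod (\<phi> # \<phi>s)) \<Delta> \<tau>)"
    by (rule kp_sum_eq_kp_weight[OF _ \<tau>(1) _ x]) (use phi phis \<tau> in auto)
  finally show ?thesis unfolding divisor_weight_def by simp
qed

lemma divisor_kp_complex:
  assumes "conewise_integral \<phi>" "\<And>\<psi>. \<psi> \<in> set \<phi>s \<Longrightarrow> conewise_integral \<psi>"
  shows "generically_equal (divisor_complex \<phi> (kp_complex (length \<phi>s) (pointwise_prod \<phi>s) \<Delta>))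
    (kp_complex (length (\<phi> # \<phi>s)) (pointwise_prod (\<phi> # \<phi>s)) \<Delta>)"
proof -
  let ?D = "divisor_complex \<phi> (kp_complex (length \<phi>s) (pointwise_prod \<phi>s) \<Delta>)"
  let ?K = "kp_complex (length (\<phi> # \<phi>s)) (pointwise_prod (\<phi> # \<phi>s)) \<Delta>"
  have max: "max_cells ?D = max_cells ?K"
    by (rule set_eqI, unfold max_cells_divisor_complex max_cells_kp_complex) (auto simp: kp_complex_def)
  have "weight ?D \<tau> = weight ?K \<tau>" if "\<tau> \<in> max_cells ?K" for \<tau>
  proof -
    have "weight ?D \<tau> = divisor_weight \<phi> (kp_complex (length \<phi>s) (pointwise_prod \<phi>s) \<Delta>) \<tau>"
      by (simp add: divisor_complex_def)
    also have "\<dots> = kp_weight (pointwise_prod (\<phi> # \<phi>s)) \<Delta> \<tau>"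
      by (rule divisor_weight_kp_complex[OF assms]) (use that in \<open>auto simp: max_cells_kp_complex\<close>)
    finally show ?thesis by (simp add: kp_complex_def)
  qed
  then have "point_weight ?D x = point_weight ?K x" for x
    unfolding point_weight_def max by (intro sum.cong) auto
  moreover have "dimension ?D = dimension ?K" by (simp add: divisor_complex_def kp_complex_def)
  ultimately show ?thesis unfolding generically_equal_def by (intro conjI exI[of _ "{}"]) auto
qed

section \<open>Comparison with the inductive product\<close>

lemma int_affine_on_kp_complex:
  assumes "conewise_integral \<phi>"
  shows "int_affine_on_cells \<phi> (kp_complex k f \<Delta>)"
  unfolding int_affine_on_cells_def
proof
  fix \<sigma> assume "\<sigma> \<in> cells (kp_complex k f \<Delta>)"
  then have "\<sigma> \<in> \<Delta>" by (simp add: kp_complex_def)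
  then obtain l where "linear l" "\<And>v. v \<in> int_lattice \<Longrightarrow> l v \<in> \<int>" "\<And>x. x \<in> \<sigma> \<Longrightarrow> \<phi> x = l x"
    by (rule conewise_integralE[OF assms]) (rule that)
  then show "\<exists>l c. int_form_on \<sigma> l \<and> (\<forall>x\<in>\<sigma>. \<phi> x = l x + c)"
    by (intro exI[of _ l] exI[of _ 0]) (auto simp: int_form_on_def dir_lattice_def)
qed

text \<open>The Katz--Payne complex shows that an admissible representative exists, so
  \<open>SOME\<close> yields one generically equal to it, whose divisor defines the same cycle.
  \<open>foldr\<close> applies the head of the list last, as the recursion does.\<close>

lemma intersect_list_eq:
  assumes "\<And>\<phi>. \<phi> \<in> set \<phi>s \<Longrightarrow> conewise_integral \<phi>"
  shows "intersect_list \<phi>s Rn_cycle = cycle_of (kp_complex (length \<phi>s) (pointwise_prod \<phi>s) \<Delta>)"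
  using assms
proof (induction \<phi>s)
  case Nil
  have "cycle_of whole_space = cycle_of (kp_complex 0 (pointwise_prod []) \<Delta>)"
    by (rule cycle_of_eq[OF tropical_whole_space tropical_kp_complex_one
          generically_equal_sym[OF kp_complex_one_generically_equal]])
  then show ?case by (simp add: intersect_list_def Rn_cycle_eq)
next
  case (Cons \<phi> \<phi>s)
  let ?K = "kp_complex (length \<phi>s) (pointwise_prod \<phi>s) \<Delta>"
  let ?P = "\<lambda>A. A \<in> cycle_of ?K \<and> int_affine_on_cells \<phi> A"
  have phi: "conewise_integral \<phi>" and phis: "\<And>\<psi>. \<psi> \<in> set \<phi>s \<Longrightarrow> conewise_integral \<psi>"
    using Cons.prems by auto
  have trop: "tropical_complex ?K" by (rule tropical_kp_complex[OF phis])
  have aff: "int_affine_on_cells \<phi> ?K" by (rule int_affine_on_kp_complex[OF phi])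
  have "?P ?K" using trop aff by (simp add: cycle_of_def)
  then have "?P (SOME A. ?P A)" by (rule someI)
  then have A: "tropical_complex (SOME A. ?P A)" "generically_equal ?K (SOME A. ?P A)"
      "int_affine_on_cells \<phi> (SOME A. ?P A)"
    using cycle_of_iff[OF trop] by auto
  have "intersect_list (\<phi> # \<phi>s) Rn_cycle = cycle_of (divisor_complex \<phi> (SOME A. ?P A))"
    using Cons.IH[OF phis] by (simp add: intersect_list_def intersect_def)
  also have "\<dots> = cycle_of (kp_complex (length (\<phi> # \<phi>s)) (pointwise_prod (\<phi> # \<phi>s)) \<Delta>)"
    by (rule cycle_of_divisor_eq[OF A(1) trop generically_equal_sym[OF A(2)] A(3) aff
          tropical_kp_complex[OF Cons.prems] divisor_kp_complex[OF phi phis]])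
  finally show ?case .
qed

text \<open>Integrality is given only on cells of some representative of the whole space. A generic
  point of a maximal cone has weight 1, hence lies inside a full-dimensional cell, and on the
  overlap, which has interior, the two linear forms coincide. Smaller cones inherit the form of a
  maximal one.\<close>

lemma conewise_integral_if_rational_function:
  assumes rat: "rational_function_on Rn_cycle \<phi>" and lin: "conewise_linear \<phi>"
  shows "conewise_integral \<phi>"
proof -
  obtain A where A: "A \<in> cycle_of whole_space" "int_affine_on_cells \<phi> A"
    using rat unfolding rational_function_on_def Rn_cycle_eq by auto
  have trop: "tropical_complex A" and gen: "generically_equal whole_space A"
    using A(1) cycle_of_iff[OF tropical_whole_space] by auto
  interpret A: weighted_polyhedral_complex A by (rule tropical_complex_imp_wpc[OF trop])
  interpret W: weighted_polyhedral_complex "whole_space :: 'n weighted_complex"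
    by (rule tropical_complex_imp_wpc[OF tropical_whole_space])
  obtain F where dim: "dimension (whole_space :: 'n weighted_complex) = dimension A" and F: "finite F"
      "\<forall>S\<in>F. affine S \<and> aff_dim S < dimension (whole_space :: 'n weighted_complex)"
      "\<forall>x. (\<forall>S\<in>F. x \<notin> S) \<longrightarrow> point_weight whole_space x = point_weight A x"
    by (rule generically_equalE[OF gen]) (rule that)
  have dimW: "dimension (whole_space :: 'n weighted_complex) = int CARD('n)" by (simp add: whole_space_def)
  have full: "rel_interior S = interior S" if "aff_dim S = int CARD('n)" for S :: "(real^'n) set"
    using rel_interior_interior[of S] aff_dim_eq_full[of S] that by simp
  have dir_full: "dir_space S = UNIV" if "interior S \<noteq> {}" for S :: "(real^'n) set"
  proof -
    have "S \<noteq> {}" using that interior_subset by blast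
    then have "dim (dir_space S) = CARD('n)"
      using aff_dim_nonempty_interior[OF that] aff_dim_eq_dim_dir_space[of S] by simp
    then show ?thesis
      using dim_eq_full[of "dir_space S"] by (simp add: subspace_dir_space span_eq_iff[THEN iffD2])
  qed
  have int: "\<exists>l. linear l \<and> (\<forall>v\<in>int_lattice. l v \<in> \<int>) \<and> (\<forall>x\<in>\<sigma>. \<phi> x = l x)" if s: "\<sigma> \<in> max_cones" for \<sigma>
  proof -
    have sD: "\<sigma> \<in> \<Delta>" by (rule max_cone_in_fan[OF s])
    have proper: "affine S \<and> \<not> \<sigma> \<subseteq> S" if "S \<in> F" for S
      using F(2) that aff_dim_subset[of \<sigma> S] aff_dim_max_cone[OF s] dimW by auto
    obtain x where x: "x \<in> rel_interior \<sigma>" "\<forall>S\<in>F. x \<notin> S"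
      using generic_point_exists[OF complex_convex[OF fan_complex sD] complex_nonempty[OF fan_complex sD] F(1) proper]
      by auto
    have "point_weight (whole_space :: 'n weighted_complex) x = weight (whole_space :: 'n weighted_complex) UNIV"
      by (rule W.point_weight_rel_interior) (simp_all add: max_cells_iff whole_space_def)
    then have "point_weight A x \<noteq> 0" using F(3) x(2) by (simp add: whole_space_def)
    then obtain \<rho> where r: "\<rho> \<in> supp_cells A" "x \<in> rel_interior \<rho>" by (rule A.point_weight_nonzero)
    have rc: "\<rho> \<in> cells A" "aff_dim \<rho> = int CARD('n)" using r dim dimW by (auto simp: supp_cells_iff)
    have xi: "x \<in> interior (\<sigma> \<inter> \<rho>)" "x \<in> interior \<rho>"
      using x(1) r(2) full[OF aff_dim_max_cone[OF s]] full[OF rc(2)] by auto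
    obtain l where l: "linear l" "\<And>y. y \<in> \<sigma> \<Longrightarrow> \<phi> y = l y"
      using lin sD unfolding conewise_linear_def by auto
    have "\<exists>l c. int_form_on \<rho> l \<and> (\<forall>x\<in>\<rho>. \<phi> x = l x + c)"
      using A(2) rc(1) unfolding int_affine_on_cells_def by auto
    then obtain l' c where l': "int_form_on \<rho> l'" "\<forall>x\<in>\<rho>. \<phi> x = l' x + c" by (elim exE conjE)
    have lin': "linear l'" using l'(1) by (simp add: int_form_on_def)
    have eq: "l v = l' v" for v
    proof (rule linear_eq_on_dir_space[OF l(1) lin', of "\<sigma> \<inter> \<rho>" 0 c])
      show "l y + 0 = l' y + c" if "y \<in> \<sigma> \<inter> \<rho>" for y using that l(2)[of y] l'(2) by auto
      show "v \<in> dir_space (\<sigma> \<inter> \<rho>)" using dir_full[of "\<sigma> \<inter> \<rho>"] xi by auto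
    qed
    have "dir_space \<rho> = UNIV" using dir_full[of \<rho>] xi by auto
    then have "l v \<in> \<int>" if "v \<in> int_lattice" for v
      using that l'(1) by (simp add: eq int_form_on_def dir_lattice_def)
    then show ?thesis using l by auto
  qed
  show ?thesis
    unfolding conewise_integral_def
  proof
    fix \<tau> assume "\<tau> \<in> \<Delta>"
    then obtain \<sigma> where s: "\<sigma> \<in> max_cones" "\<tau> \<subseteq> \<sigma>" by (rule subset_max_cone)
    show "\<exists>l. linear l \<and> (\<forall>v\<in>int_lattice. l v \<in> \<int>) \<and> (\<forall>x\<in>\<tau>. \<phi> x = l x)"
      using int[OF s(1)] s(2) by (meson subsetD)
  qed
qed

section \<open>The product as a piecewise polynomial\<close>

lemma continuous_on_conewise_linear:
  assumes "conewise_linear \<phi>"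
  shows "continuous_on UNIV \<phi>"
proof -
  have "continuous_on (\<Union>\<sigma>\<in>max_cones. \<sigma>) \<phi>"
  proof (rule continuous_on_closed_Union[OF finite_max_cones])
    fix \<sigma> assume s: "\<sigma> \<in> max_cones"
    show "closed \<sigma>" by (rule complex_closed[OF fan_complex max_cone_in_fan[OF s]])
    obtain l where l: "linear l" "\<And>y. y \<in> \<sigma> \<Longrightarrow> \<phi> y = l y"
      using assms max_cone_in_fan[OF s] unfolding conewise_linear_def by auto
    have "continuous_on \<sigma> l" using l(1) by (simp add: linear_continuous_on linear_conv_bounded_linear)
    then show "continuous_on \<sigma> \<phi>" using l(2) by (simp cong: continuous_on_cong)
  qed
  then show ?thesis using Union_max_cones by simp
qed

lemma pointwise_prod_piecewise_polynomial:
  assumes "\<And>\<phi>. \<phi> \<in> set \<phi>s \<Longrightarrow> conewise_integral \<phi>"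
  shows "pointwise_prod \<phi>s \<in> piecewise_polynomials (length \<phi>s) \<Delta>"
proof -
  have "continuous_on UNIV (pointwise_prod \<phi>s)"
    using assms
  proof (induction \<phi>s)
    case (Cons \<phi> \<phi>s)
    then show ?case
      using continuous_on_conewise_linear[OF conewise_integral_imp_linear, of \<phi>]
      by (auto intro!: continuous_intros)
  qed simp
  then have cont: "continuous_on (\<Union>\<Delta>) (pointwise_prod \<phi>s)" by (rule continuous_on_subset) simp
  have "\<exists>p\<in>int_sym_power (length \<phi>s) \<sigma>. \<forall>x\<in>\<sigma>. pointwise_prod \<phi>s x = p x" if s: "\<sigma> \<in> \<Delta>" for \<sigma>
  proof -
    have "\<forall>\<phi>\<in>set \<phi>s. \<exists>l. linear l \<and> (\<forall>v\<in>int_lattice. l v \<in> \<int>) \<and> (\<forall>x\<in>\<sigma>. \<phi> x = l x)"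
      using assms s unfolding conewise_integral_def by auto
    then obtain L where L: "\<forall>\<phi>\<in>set \<phi>s. linear (L \<phi>) \<and> (\<forall>v\<in>int_lattice. L \<phi> v \<in> \<int>) \<and> (\<forall>x\<in>\<sigma>. \<phi> x = L \<phi> x)"
      by metis
    \<comment> \<open>A single product of linear forms: \<open>m = 1\<close> with coefficient 1 in
      \<open>int_sym_power\<close>.\<close>
    define p where "p x = (\<Prod>i<length \<phi>s. L (\<phi>s ! i) x)" for x
    have "p \<in> int_sym_power (length \<phi>s) \<sigma>"
      unfolding int_sym_power_def
      by (rule CollectI, rule exI[of _ 1], rule exI[of _ "\<lambda>_. 1"], rule exI[of _ "\<lambda>_ i. L (\<phi>s ! i)"])
        (use L in \<open>auto simp: p_def[abs_def] int_form_on_def dir_lattice_def\<close>)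
    moreover have "pointwise_prod \<phi>s x = p x" if x: "x \<in> \<sigma>" for x
    proof -
      have "pointwise_prod \<phi>s x = (\<Prod>i<length \<phi>s. (\<phi>s ! i) x)"
        by (simp add: prod.list_conv_set_nth atLeast0LessThan)
      also have "\<dots> = p x" unfolding p_def by (rule prod.cong) (use L x in auto)
      finally show ?thesis .
    qed
    ultimately show ?thesis by blast
  qed
  then show ?thesis using cont by (simp add: piecewise_polynomials_def)
qed

end

theorem proposition3p7:
  fixes \<Delta> :: "(real^'n::finite) set set"
    and \<phi>s :: "(real^'n \<Rightarrow> real) list"
    and f :: "real^'n \<Rightarrow> real"
    and k :: nat
  assumes "complete_fan \<Delta>" and "unimodular_fan \<Delta>"
    and "length \<phi>s = k"
    and "\<And>\<phi>. \<phi> \<in> set \<phi>s \<Longrightarrow> rational_function_on Rn_cycle \<phi>"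
    and "\<And>\<phi> \<sigma>. \<phi> \<in> set \<phi>s \<Longrightarrow> \<sigma> \<in> \<Delta> \<Longrightarrow> \<exists>l. linear l \<and> (\<forall>x\<in>\<sigma>. \<phi> x = l x)"
    and "\<And>x. f x = (\<Prod>\<phi>\<leftarrow>\<phi>s. \<phi> x)"
  shows "f \<in> piecewise_polynomials k \<Delta> \<and>
         kp_intersection k f \<Delta> = intersect_list \<phi>s Rn_cycle"
proof -
  interpret complete_unimodular_fan \<Delta> using assms(1,2) by unfold_locales
  have int: "conewise_integral \<phi>" if "\<phi> \<in> set \<phi>s" for \<phi>
    by (rule conewise_integral_if_rational_function[OF assms(4)[OF that]])
      (use assms(5)[OF that] in \<open>auto simp: conewise_linear_def\<close>)
  have f: "f = pointwise_prod \<phi>s" using assms(6) by auto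
  show ?thesis
    unfolding f assms(3)[symmetric] kp_intersection_def
    using pointwise_prod_piecewise_polynomial[OF int] intersect_list_eq[OF int] by simp
qed

end
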